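(* Let $F=(F,\mathcal T,\nu,\mathcal G)$ be a divisible, $\nu$-archimedean $\nu$-semifield$^\dagger$ and $\Lambda=\{\lambda_1,\dots,\lambda_n\}$. If $L\in\mathrm{HSpec}(\overline{F(\Lambda)})$, then $\mathrm{hgt}(L)=\mathrm d_{\mathrm{conv}}(L)$. Moreover, every factor of a descending chain of HS-kernels (from $L$) of maximal length is an HP-kernel.
   Context: **$\nu$-structures.** A semiring$^\dagger$ is a commutative semiring with unit $1$, not required to have a zero (and containing $r_0,r_1$ with $r_0+r_1=1$). A $\nu$-domain$^\dagger$ is a quadruple $(R,\mathcal T,\nu,\mathcal G)$ with $R$ a semiring$^\dagger$, $\mathcal T\subset R$ a cancellative multiplicative submonoid (tangible elements), $\mathcal G$ an ideal of $R$ (ghost elements) with a partial order, and $\nu:R\to\mathcal G$ an idempotent homomorphism with $\nu|_{\mathcal T}$ onto, such that $a+b=a$ if $\nu(a)>\nu(b)$ and $a+b=\nu(a)$ if $\nu(a)=\nu(b)$. It is a $\nu$-semifield$^\dagger$ if $\mathcal T$ is an abelian group, $\nu$-archimedean if $a^{k}\le_\nu b$ for all $k\in\mathbb Z$ implies $a\cong_\nu1$, divisible if every element has an $m$-th root for each $m\ge1$. Write $a^\nu=\nu(a)$; $a\cong_\nu b$ means $a^\nu=b^\nu$; $a\ge_\nu b$ means $a^\nu\ge b^\nu$. Set $a^*=a^{-1}$, $(a^\nu)^*=(a^{-1})^\nu$ for $a\in\mathcal T$, $|a|=a+a^*$; these apply to functions pointwise. **Rational functions and kernels.** $\overline{F(\Lambda)}$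 consists of the functions $F^{(n)}\to F$, $\mathbf a\mapsto h(\mathbf a)g(\mathbf a)^*$, with $h$ a polynomial over $F$ and $g$ a polynomial with tangible coefficients, with pointwise operations. A $\nu$-kernel is a subgroup $K$ (closed under products and $*$) such that $a,b\in K$, $\alpha+\beta\cong_\nu1$ imply $\alpha a+\beta b\in K$; these are handled up to $\cong_\nu$. $\langle S\rangle$ is the $\nu$-kernel generated by $S$; principal means generated by one element; $K_1K_2=\{ab\}$ is the product. $\langle F\rangle$ is the $\nu$-kernel generated by the constants. Write $f\sim f'$ if $\langle f\rangle\cap\langle F\rangle=\langle f'\rangle\cap\langle F\rangle$. **HP- and HS-kernels, HSpec, height.** An $\mathscr L$-monomial is a non-constant Laurent monomial. An HP-kernel is a $\nu$-kernel generated by an $\mathscr L$-monomial (in a quotient of $\overline{F(\Lambda)}$: by the image of an $\mathscr L$-monomial). An HS-fraction is an $f\sim\sum_{i=1}^t|f_i|$ with $f_i$ non-proportional $\mathscr L$-monomials; an HS-kernel is a principal $\nu$-kernel generated by an HS-fraction; HS-kernels are finite products of HP-kernels. $\Omega(\overline{F(\Lambda)})$ is the lattice of $\nu$-kernels obtained from HP-kernels by finite intersections and products. $\langle f\rangle\in\Omega(\overline{F(\Lambda)})$ is reducible if there are $\langle g\rangle,\langle h\rangle\in\Omega(\overline{F(\Lambda)})$, neither contained in $\langle f\rangle$, with $\langle g\rangle\cap\langle h\rangle\subseteq\langle f\rangle$; otherwise irreducible. $\mathrm{HSpec}(\overline{F(\Lambda)})$ is the family of irreducible $\nu$-kernels in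 $\Omega(\overline{F(\Lambda)})$; it is the family of HS-kernels. A chain $P_0\subset P_1\subset\dots\subset P_t$ in $\mathrm{HSpec}$ has length $t$; $\mathrm{hgt}(P)=t$ if some chain of length $t$ terminates at $P=P_t$ but none of length $t+1$ does. The trivial kernel $\langle1\rangle$ is admitted as the bottom member of such chains. The factors of a chain are the successive quotients. **Convex dimension.** An HS-fraction $f$ is $F$-convexly dependent on a set $A$ of HS-fractions if $f\in\langle A\rangle\cdot\langle F\rangle$; a set $A$ is $F$-convexly independent if no $f\in A$ is $F$-convexly dependent on $A\setminus\{f\}$. On $\mathscr L$-monomials this is an abstract dependence relation. $\mathrm d_{\mathrm{conv}}(L)$ is the cardinality of a maximal $F$-convexly independent set of $\mathscr L$-monomials in $L\cdot\langle F\rangle$.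
   Formalization: It is additionally assumed that the only constants in L are those ν-equivalent to 1; without this the claim fails, e.g. for L = ⟨λ⟩⟨αλ⟩ with α not ν-equivalent to 1, which has height at least 2 but convex dimension 1. *)

theory Defs
  imports Main
begin

(* The semiring R is the whole type 'a.  The sort {comm_semiring, comm_monoid_mult} is a
   commutative semiring with unit and without a zero; hence finite sums below are non-empty. *)

record 'a nu_struct =
  tangible :: "'a set"
  nu :: "'a \<Rightarrow> 'a"
  ghost :: "'a set"
  ghost_le :: "'a \<Rightarrow> 'a \<Rightarrow> bool"

definition nu_equiv :: "'a nu_struct \<Rightarrow> 'a \<Rightarrow> 'a \<Rightarrow> bool" where
  "nu_equiv F a b \<longleftrightarrow> nu F a = nu F b"

definition nu_le :: "'a nu_struct \<Rightarrow> 'a \<Rightarrow> 'a \<Rightarrow> bool" where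
  "nu_le F a b \<longleftrightarrow> ghost_le F (nu F a) (nu F b)"

definition nu_domain :: "'a::{comm_semiring, comm_monoid_mult} nu_struct \<Rightarrow> bool" where
  "nu_domain F \<longleftrightarrow>
     (\<exists>r0 r1 :: 'a. r0 + r1 = 1) \<and>
     1 \<in> tangible F \<and>
     (\<forall>a\<in>tangible F. \<forall>b\<in>tangible F. a * b \<in> tangible F) \<and>
     (\<forall>a\<in>tangible F. \<forall>b\<in>tangible F. \<forall>c\<in>tangible F. a * b = a * c \<longrightarrow> b = c) \<and>
     (\<forall>a\<in>ghost F. \<forall>b\<in>ghost F. a + b \<in> ghost F) \<and>
     (\<forall>r. \<forall>a\<in>ghost F. r * a \<in> ghost F) \<and>
     reflp_on (ghost F) (ghost_le F) \<and>
     transp_on (ghost F) (ghost_le F) \<and>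
     antisymp_on (ghost F) (ghost_le F) \<and>
     (\<forall>a. nu F a \<in> ghost F) \<and>
     (\<forall>a. nu F (nu F a) = nu F a) \<and>
     (\<forall>a b. nu F (a + b) = nu F a + nu F b) \<and>
     (\<forall>a b. nu F (a * b) = nu F a * nu F b) \<and>
     nu F ` tangible F = ghost F \<and>
     (\<forall>a b. nu_le F b a \<and> \<not> nu_equiv F a b \<longrightarrow> a + b = a) \<and>
     (\<forall>a b. nu_equiv F a b \<longrightarrow> a + b = nu F a)"

definition nu_semifield :: "'a::{comm_semiring, comm_monoid_mult} nu_struct \<Rightarrow> bool" where
  "nu_semifield F \<longleftrightarrow> nu_domain F \<and> (\<forall>a\<in>tangible F. \<exists>b\<in>tangible F. a * b = 1)"

definition tinv :: "'a::{comm_semiring, comm_monoid_mult} nu_struct \<Rightarrow> 'a \<Rightarrow> 'a" where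
  "tinv F a = (THE b. b \<in> tangible F \<and> a * b = 1)"

(* On a ghost a = nu c with c tangible this is nu (c^-1); the value does not depend on the
   choice of c.  An element that is neither tangible nor ghost is treated like its ghost nu a,
   so that a^* is total without assuming that every element is tangible or ghost. *)
definition star :: "'a::{comm_semiring, comm_monoid_mult} nu_struct \<Rightarrow> 'a \<Rightarrow> 'a" where
  "star F a = (if a \<in> tangible F then tinv F a
               else nu F (tinv F (SOME c. c \<in> tangible F \<and> nu F c = nu F a)))"

definition zpow :: "'a::{comm_semiring, comm_monoid_mult} nu_struct \<Rightarrow> 'a \<Rightarrow> int \<Rightarrow> 'a" where
  "zpow F a k = (if k \<ge> 0 then a ^ nat k else star F a ^ nat (- k))"

definition nu_archimedean :: "'a::{comm_semiring, comm_monoid_mult} nu_struct \<Rightarrow> bool" where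
  "nu_archimedean F \<longleftrightarrow>
     (\<forall>a b. (\<forall>k::int. nu_le F (zpow F a k) b) \<longrightarrow> nu_equiv F a 1)"

definition nu_divisible :: "'a::{comm_semiring, comm_monoid_mult} nu_struct \<Rightarrow> bool" where
  "nu_divisible F \<longleftrightarrow> (\<forall>a::'a. \<forall>m::nat. m \<ge> 1 \<longrightarrow> (\<exists>b. b ^ m = a))"


(* The variables are indexed by a finite type 'n; a point of F^(n) is a map 'n => 'a, with
   arbitrary (also ghost) coordinates. *)

type_synonym ('n, 'a) fn = "('n \<Rightarrow> 'a) \<Rightarrow> 'a"

fun nsum :: "'a::semigroup_add list \<Rightarrow> 'a" where
  "nsum [] = undefined"
| "nsum [a] = a"
| "nsum (a # b # as) = a + nsum (b # as)"

(* A polynomial is a non-empty list of coefficients paired with distinct exponent vectors. *)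
definition polys :: "'a set \<Rightarrow> ('a \<times> ('n::finite \<Rightarrow> nat)) list set" where
  "polys C = {p. p \<noteq> [] \<and> distinct (map snd p) \<and> fst ` set p \<subseteq> C}"

definition power_prod :: "('n::finite \<Rightarrow> nat) \<Rightarrow> ('n \<Rightarrow> 'a::comm_monoid_mult) \<Rightarrow> 'a" where
  "power_prod e x = (\<Prod>i\<in>UNIV. x i ^ e i)"

definition peval ::
  "('a::{comm_semiring, comm_monoid_mult} \<times> ('n::finite \<Rightarrow> nat)) list \<Rightarrow> ('n, 'a) fn" where
  "peval p x = nsum (map (\<lambda>(c, e). c * power_prod e x) p)"

definition ratfun :: "'a::{comm_semiring, comm_monoid_mult} nu_struct \<Rightarrow> ('n::finite, 'a) fn set" where
  "ratfun F = {\<lambda>x. peval h x * star F (peval g x) | h g.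
                 h \<in> polys UNIV \<and> g \<in> polys (tangible F)}"

definition fn_equiv :: "'a nu_struct \<Rightarrow> ('n::finite, 'a) fn \<Rightarrow> ('n, 'a) fn \<Rightarrow> bool" where
  "fn_equiv F f g \<longleftrightarrow> (\<forall>x. nu_equiv F (f x) (g x))"

(* Kernels are taken up to an equivalence E of functions: a kernel contains every rational
   function E-equivalent to one that the closure rules put into it (in particular it is
   E-saturated).  With E = fn_equiv F these are the nu-kernels of the semifield of rational
   functions.  The quotient of that semifield by a nu-kernel K has the same representatives and
   the coarser equivalence E = mod_equiv F K (f g^* lies in K, up to nu), so kernels of the
   quotient are kernels for that E, given as unions of classes. *)
definition is_kernel ::
  "'a::{comm_semiring, comm_monoid_mult} nu_struct \<Rightarrow>
   (('n::finite, 'a) fn \<Rightarrow> ('n, 'a) fn \<Rightarrow> bool) \<Rightarrow> ('n, 'a) fn set \<Rightarrow> bool" where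
  "is_kernel F E K \<longleftrightarrow>
     K \<subseteq> ratfun F \<and> K \<noteq> {} \<and>
     (\<forall>a\<in>K. \<forall>b\<in>K. \<forall>u\<in>ratfun F. E u (\<lambda>x. a x * b x) \<longrightarrow> u \<in> K) \<and>
     (\<forall>a\<in>K. \<forall>u\<in>ratfun F. E u (\<lambda>x. star F (a x)) \<longrightarrow> u \<in> K) \<and>
     (\<forall>a\<in>K. \<forall>b\<in>K. \<forall>\<alpha>\<in>ratfun F. \<forall>\<beta>\<in>ratfun F. E (\<lambda>x. \<alpha> x + \<beta> x) (\<lambda>_. 1) \<longrightarrow>
        (\<forall>u\<in>ratfun F. E u (\<lambda>x. \<alpha> x * a x + \<beta> x * b x) \<longrightarrow> u \<in> K))"

definition gen_kernel ::
  "'a::{comm_semiring, comm_monoid_mult} nu_struct \<Rightarrow>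
   (('n::finite, 'a) fn \<Rightarrow> ('n, 'a) fn \<Rightarrow> bool) \<Rightarrow> ('n, 'a) fn set \<Rightarrow> ('n, 'a) fn set" where
  "gen_kernel F E S = \<Inter> {K. is_kernel F E K \<and> S \<subseteq> K}"

abbreviation kgen ::
  "'a::{comm_semiring, comm_monoid_mult} nu_struct \<Rightarrow> ('n::finite, 'a) fn set \<Rightarrow> ('n, 'a) fn set" where
  "kgen F S \<equiv> gen_kernel F (fn_equiv F) S"

definition mod_equiv ::
  "'a::{comm_semiring, comm_monoid_mult} nu_struct \<Rightarrow> ('n::finite, 'a) fn set \<Rightarrow>
   ('n, 'a) fn \<Rightarrow> ('n, 'a) fn \<Rightarrow> bool" where
  "mod_equiv F K f g \<longleftrightarrow> (\<exists>u\<in>K. fn_equiv F u (\<lambda>x. f x * star F (g x)))"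

(* P / K as a kernel of the quotient by K: the union of the classes of the elements of P. *)
definition kquot ::
  "'a::{comm_semiring, comm_monoid_mult} nu_struct \<Rightarrow> ('n::finite, 'a) fn set \<Rightarrow>
   ('n, 'a) fn set \<Rightarrow> ('n, 'a) fn set" where
  "kquot F P K = {u \<in> ratfun F. \<exists>f\<in>P. mod_equiv F K u f}"

definition kprod ::
  "'a::{comm_semiring, comm_monoid_mult} nu_struct \<Rightarrow> ('n::finite, 'a) fn set \<Rightarrow>
   ('n, 'a) fn set \<Rightarrow> ('n, 'a) fn set" where
  "kprod F K M = {u \<in> ratfun F. \<exists>a\<in>K. \<exists>b\<in>M. fn_equiv F u (\<lambda>x. a x * b x)}"

definition constants :: "('n::finite, 'a) fn set" where
  "constants = range (\<lambda>c. \<lambda>_. c)"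

(* Laurent monomials carry an arbitrary coefficient c. *)
definition L_monomials ::
  "'a::{comm_semiring, comm_monoid_mult} nu_struct \<Rightarrow> ('n::finite, 'a) fn set" where
  "L_monomials F =
     {\<lambda>x. c * power_prod (\<lambda>i. nat (k i)) x * star F (power_prod (\<lambda>i. nat (- k i)) x)
      | c k. k \<noteq> (\<lambda>_. 0::int)}"

definition HP_kernel ::
  "'a::{comm_semiring, comm_monoid_mult} nu_struct \<Rightarrow>
   (('n::finite, 'a) fn \<Rightarrow> ('n, 'a) fn \<Rightarrow> bool) \<Rightarrow> ('n, 'a) fn set \<Rightarrow> bool" where
  "HP_kernel F E K \<longleftrightarrow> (\<exists>m\<in>L_monomials F. K = gen_kernel F E {m})"

inductive_set Omega ::
  "'a::{comm_semiring, comm_monoid_mult} nu_struct \<Rightarrow> ('n::finite, 'a) fn set set"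
  for F :: "'a::{comm_semiring, comm_monoid_mult} nu_struct" where
  HP: "HP_kernel F (fn_equiv F) K \<Longrightarrow> K \<in> Omega F"
| Int: "K \<in> Omega F \<Longrightarrow> M \<in> Omega F \<Longrightarrow> K \<inter> M \<in> Omega F"
| Prod: "K \<in> Omega F \<Longrightarrow> M \<in> Omega F \<Longrightarrow> kprod F K M \<in> Omega F"

definition reducible ::
  "'a::{comm_semiring, comm_monoid_mult} nu_struct \<Rightarrow> ('n::finite, 'a) fn set \<Rightarrow> bool" where
  "reducible F K \<longleftrightarrow>
     (\<exists>g\<in>ratfun F. \<exists>h\<in>ratfun F.
        kgen F {g} \<in> Omega F \<and> kgen F {h} \<in> Omega F \<and>
        \<not> kgen F {g} \<subseteq> K \<and> \<not> kgen F {h} \<subseteq> K \<and>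
        kgen F {g} \<inter> kgen F {h} \<subseteq> K)"

definition HSpec ::
  "'a::{comm_semiring, comm_monoid_mult} nu_struct \<Rightarrow> ('n::finite, 'a) fn set set" where
  "HSpec F = {kgen F {f} | f. f \<in> ratfun F \<and> kgen F {f} \<in> Omega F \<and> \<not> reducible F (kgen F {f})}"

definition hs_chain ::
  "'a::{comm_semiring, comm_monoid_mult} nu_struct \<Rightarrow> (nat \<Rightarrow> ('n::finite, 'a) fn set) \<Rightarrow>
   nat \<Rightarrow> bool" where
  "hs_chain F P t \<longleftrightarrow>
     (\<forall>i\<le>t. P i \<in> HSpec F \<or> i = 0 \<and> P i = kgen F {\<lambda>_. 1}) \<and>
     (\<forall>i<t. P i \<subset> P (Suc i))"

definition has_hgt ::
  "'a::{comm_semiring, comm_monoid_mult} nu_struct \<Rightarrow> ('n::finite, 'a) fn set \<Rightarrow> nat \<Rightarrow> bool" where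
  "has_hgt F L t \<longleftrightarrow>
     (\<exists>P. hs_chain F P t \<and> P t = L) \<and>
     \<not> (\<exists>P. hs_chain F P (t + 1) \<and> P (t + 1) = L)"

definition convexly_dependent ::
  "'a::{comm_semiring, comm_monoid_mult} nu_struct \<Rightarrow> ('n::finite, 'a) fn \<Rightarrow>
   ('n, 'a) fn set \<Rightarrow> bool" where
  "convexly_dependent F f A \<longleftrightarrow> f \<in> kprod F (kgen F A) (kgen F constants)"

definition convexly_independent ::
  "'a::{comm_semiring, comm_monoid_mult} nu_struct \<Rightarrow> ('n::finite, 'a) fn set \<Rightarrow> bool" where
  "convexly_independent F A \<longleftrightarrow> (\<forall>f\<in>A. \<not> convexly_dependent F f (A - {f}))"

definition conv_basis ::
  "'a::{comm_semiring, comm_monoid_mult} nu_struct \<Rightarrow> ('n::finite, 'a) fn set \<Rightarrow>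
   ('n, 'a) fn set \<Rightarrow> bool" where
  "conv_basis F L B \<longleftrightarrow>
     B \<subseteq> L_monomials F \<inter> kprod F L (kgen F constants) \<and> convexly_independent F B \<and>
     (\<forall>A \<subseteq> L_monomials F \<inter> kprod F L (kgen F constants).
        convexly_independent F A \<and> B \<subseteq> A \<longrightarrow> A = B)"

(* All maximal independent sets are required to have the same finite cardinality d. *)
definition has_d_conv ::
  "'a::{comm_semiring, comm_monoid_mult} nu_struct \<Rightarrow> ('n::finite, 'a) fn set \<Rightarrow> nat \<Rightarrow> bool" where
  "has_d_conv F L d \<longleftrightarrow>
     (\<exists>B. conv_basis F L B) \<and> (\<forall>B. conv_basis F L B \<longrightarrow> finite B \<and> card B = d)"

end

theory Submission
  imports Defs "HOL-Analysis.Cartesian_Space"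
begin

text \<open>Up to \<open>\<nu>\<close>, kernels are the convex sublattice subgroups of the group of rational functions. Their
  lattice is distributive, so an irreducible \<open>L\<close> is generated by finitely many monomials, and
  since \<open>L\<close> has no constants, irreducibility also forces the ghosts to be totally ordered. A monomial
  lies in \<open>L\<langle>F\<rangle>\<close> iff its exponent vector lies in the rational span of the exponents of
  the generators: otherwise it is unbounded along a line on which the generators are constant. The coefficient of a
  monomial in \<open>L\<close> is determined by its exponents, so HS-kernels below \<open>L\<close> correspond to
  rational subspaces: both invariants are the dimension of the span, and along a chain of
  maximal length the dimension grows by one, that is, by one monomial generator. Every HS-kernel without constants is
  irreducible because a rational affine subspace is not a finite union of proper ones.\<close>

text \<open>Two obstacles shape the proof. A generated kernel is easy to bound from below, by
  exhibiting elements, but hard to bound from above. Every upper bound comes from one device,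
  \<open>kern_bounded\<close>: functions whose absolute value is dominated by a member of a family
  of bounds, each at least 1 and the family closed under products, form a kernel. Varying the family
  gives products of kernels, principal kernels, constancy along a line, and values at a point. The
  second obstacle is the coefficient of a monomial. A kernel containing \<open>lmon c k\<close> and
  \<open>lmon d k\<close> contains the constant \<open>c * star F d\<close>, so in the presence of
  constants a chain could grow while the exponents stay in the same subspace. Excluding constants
  not nu-equal to 1 from \<open>L\<close> rules this out in all kernels below \<open>L\<close> as
  well. If \<open>nu\<close> takes a single value, no monomial is unbounded and the dictionary with
  linear algebra breaks down; that case is settled separately, with both invariants equal to
  0.\<close>

locale div_semifield =
  fixes F :: "'a::{comm_semiring, comm_monoid_mult} nu_struct"
  assumes semifield: "nu_semifield F" and divisible: "nu_divisible F"
begin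

section \<open>Arithmetic modulo \<open>nu\<close>: an idempotent addition and a multiplicative
  group\<close>

abbreviation eqv (infix "\<approx>" 50) where "a \<approx> b \<equiv> nu F a = nu F b"

abbreviation inv_star ("_\<^sup>\<star>" [1000] 1000) where "a\<^sup>\<star> \<equiv> star F a"

lemma dom: "nu_domain F"
  using semifield by (simp add: nu_semifield_def)

lemma nu_nu [simp]: "nu F (nu F a) = nu F a"
  using dom by (simp add: nu_domain_def)

lemma nu_add [simp]: "nu F (a + b) = nu F a + nu F b"
  using dom by (simp add: nu_domain_def)

lemma nu_mult [simp]: "nu F (a * b) = nu F a * nu F b"
  using dom by (simp add: nu_domain_def)

lemma nu_idem [simp]: "nu F a + nu F a = nu F a"
proof -
  have "a + a = nu F a" using dom by (simp add: nu_domain_def nu_equiv_def)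
  then show ?thesis by (metis nu_add nu_nu)
qed

lemma nu_idem2 [simp]: "nu F a + (nu F a + b) = nu F a + b"
  by (simp flip: add.assoc)

lemma nu_one_mult [simp]: "nu F 1 * nu F a = nu F a" "nu F a * nu F 1 = nu F a"
  by (metis nu_mult mult_1, metis nu_mult mult_1_right)

lemma nu_one_mult2 [simp]: "nu F 1 * (nu F a * b) = nu F a * b" "nu F a * (nu F 1 * b) = nu F a * b"
  by (simp_all flip: mult.assoc)

lemma tangible_one: "1 \<in> tangible F"
  using dom by (simp add: nu_domain_def)

lemma tangible_rep: "\<exists>c\<in>tangible F. c \<approx> a"
proof -
  have "nu F a \<in> ghost F" "nu F ` tangible F = ghost F" using dom by (simp_all add: nu_domain_def)
  then show ?thesis by (metis image_iff)
qed

lemma tinv: assumes "a \<in> tangible F" shows "tinv F a \<in> tangible F" "a * tinv F a = 1"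
proof -
  obtain b where b: "b \<in> tangible F" "a * b = 1"
    using assms semifield by (auto simp: nu_semifield_def)
  have "\<And>c. c \<in> tangible F \<and> a * c = 1 \<Longrightarrow> c = b"
    using assms b dom unfolding nu_domain_def by metis
  then have "tinv F a = b" unfolding tinv_def using b by blast
  then show "tinv F a \<in> tangible F" "a * tinv F a = 1" using b by auto
qed

lemma star_one: "star F 1 = 1"
  using tinv(2)[OF tangible_one] by (simp add: star_def tangible_one)

text \<open>Since \<open>nu\<close> maps the tangibles onto the ghosts, every element shares its
  ghost with an invertible one; inverting that representative works in both branches of
  \<open>star\<close>.\<close>

lemma nu_star: "nu F a * nu F (a\<^sup>\<star>) = nu F 1"
proof (cases "a \<in> tangible F")
  case True
  then show ?thesis using tinv(2)[OF True] by (simp add: star_def flip: nu_mult)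
next
  case False
  define c where "c = (SOME c. c \<in> tangible F \<and> nu F c = nu F a)"
  have c: "c \<in> tangible F \<and> nu F c = nu F a"
    unfolding c_def using tangible_rep[of a] by (intro someI_ex[of "\<lambda>c. c \<in> tangible F \<and> nu F c = nu F a"]) blast
  have "a\<^sup>\<star> = nu F (tinv F c)" using False by (simp add: star_def c_def)
  then have "nu F a * nu F (a\<^sup>\<star>) = nu F c * nu F (tinv F c)" using c by simp
  also have "\<dots> = nu F 1" using tinv(2)[of c] c by (metis nu_mult)
  finally show ?thesis .
qed

lemma star_mult [simp]: "nu F a * nu F (a\<^sup>\<star>) = nu F 1" "nu F (a\<^sup>\<star>) * nu F a = nu F 1"
   using nu_star by (auto simp: mult.commute)

lemma star_mult2 [simp]:
  "nu F a * (nu F (a\<^sup>\<star>) * nu F b) = nu F b" "nu F (a\<^sup>\<star>) * (nu F a * nu F b) = nu F b"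
  by (simp_all flip: mult.assoc)

lemma eqv_cancel: "a * c \<approx> b * c \<Longrightarrow> a \<approx> b"
proof -
  assume *: "a * c \<approx> b * c"
  have "nu F a = nu F (a * c) * nu F (c\<^sup>\<star>)" by (simp add: mult.assoc)
  also have "\<dots> = nu F b" unfolding * by (simp add: mult.assoc)
  finally show ?thesis .
qed

lemma star_unique: "a * b \<approx> 1 \<Longrightarrow> a\<^sup>\<star> \<approx> b"
  using eqv_cancel[of "a\<^sup>\<star>" a b] by (simp add: mult.commute)

lemma star_cong: "a \<approx> b \<Longrightarrow> a\<^sup>\<star> \<approx> b\<^sup>\<star>"
  by (rule star_unique) simp

lemma star_star [simp]: "nu F (a\<^sup>\<star>\<^sup>\<star>) = nu F a"
  by (rule star_unique) simp

lemma star_times [simp]: "nu F ((a * b)\<^sup>\<star>) = nu F (a\<^sup>\<star>) * nu F (b\<^sup>\<star>)"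
proof -
  have "(a * b)\<^sup>\<star> \<approx> a\<^sup>\<star> * b\<^sup>\<star>" 
  proof (rule star_unique)
    have "a * b * (a\<^sup>\<star> * b\<^sup>\<star>) = a * a\<^sup>\<star> * (b * b\<^sup>\<star>)" by (simp add: ac_simps)
    then show "a * b * (a\<^sup>\<star> * b\<^sup>\<star>) \<approx> 1" by simp
  qed
  then show ?thesis by simp
qed

lemma power_cong: "a \<approx> b \<Longrightarrow> a ^ n \<approx> b ^ n"
  by (induction n) auto

lemma prod_cong: "(\<And>i. i \<in> A \<Longrightarrow> f i \<approx> g i) \<Longrightarrow> prod f A \<approx> prod g A"
  by (induction A rule: infinite_finite_induct) auto

lemma star_prod: "(prod f A)\<^sup>\<star> \<approx> prod (\<lambda>i. (f i)\<^sup>\<star>) A"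
  by (induction A rule: infinite_finite_induct) (auto simp: star_one)

subsection \<open>The lattice order\<close>

text \<open>\<open>ghost_le\<close> is only a partial order contained in this one. With respect to \<open>\<sqsubseteq>\<close> the ghosts form
  a lattice-ordered abelian group.\<close>

definition le (infix "\<sqsubseteq>" 50) where "a \<sqsubseteq> b \<longleftrightarrow> a + b \<approx> b"

lemma le_refl [simp]: "a \<sqsubseteq> a" by (simp add: le_def)

lemma le_eqv: "a \<approx> b \<Longrightarrow> a \<sqsubseteq> b" by (simp add: le_def)

lemma le_cong: "a \<approx> a' \<Longrightarrow> b \<approx> b' \<Longrightarrow> a \<sqsubseteq> b \<longleftrightarrow> a' \<sqsubseteq> b'" by (simp add: le_def)

lemma le_trans [trans]: "a \<sqsubseteq> b \<Longrightarrow> b \<sqsubseteq> c \<Longrightarrow> a \<sqsubseteq> c"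
  using add.assoc[of "nu F a" "nu F b" "nu F c"] by (simp add: le_def)

lemma le_eqv_trans [trans]: "a \<sqsubseteq> b \<Longrightarrow> b \<approx> c \<Longrightarrow> a \<sqsubseteq> c" "a \<approx> b \<Longrightarrow> b \<sqsubseteq> c \<Longrightarrow> a \<sqsubseteq> c"
  unfolding le_def by simp_all

lemma le_antisym: "a \<sqsubseteq> b \<Longrightarrow> b \<sqsubseteq> a \<Longrightarrow> a \<approx> b"
  by (simp add: le_def add.commute)

lemma le_add [simp]: "a \<sqsubseteq> a + b" "b \<sqsubseteq> a + b"
  by (simp_all add: le_def ac_simps)

lemma add_least: "a \<sqsubseteq> c \<Longrightarrow> b \<sqsubseteq> c \<Longrightarrow> a + b \<sqsubseteq> c"
  by (simp add: le_def add.assoc)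

lemma le_addI: "a \<sqsubseteq> b \<Longrightarrow> a \<sqsubseteq> b + c" "a \<sqsubseteq> c \<Longrightarrow> a \<sqsubseteq> b + c"
  using le_trans[OF _ le_add(1)] le_trans[OF _ le_add(2)] by blast+

lemma add_mono: "a \<sqsubseteq> b \<Longrightarrow> c \<sqsubseteq> d \<Longrightarrow> a + c \<sqsubseteq> b + d"
  by (intro add_least) (simp_all add: le_addI)

lemma mult_right_mono: "a \<sqsubseteq> b \<Longrightarrow> a * c \<sqsubseteq> b * c"
  by (simp add: le_def flip: distrib_right)

lemma mult_mono: "a \<sqsubseteq> b \<Longrightarrow> c \<sqsubseteq> d \<Longrightarrow> a * c \<sqsubseteq> b * d"
  using mult_right_mono[of a b c] mult_right_mono[of c d b] le_trans[of "a * c" "b * c" "b * d"]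
  by (simp add: mult.commute)

lemma power_mono: "a \<sqsubseteq> b \<Longrightarrow> a ^ n \<sqsubseteq> b ^ n"
  by (induction n) (auto intro: mult_mono)

lemma mult_le_cancel: "a * c \<sqsubseteq> b * c \<Longrightarrow> a \<sqsubseteq> b"
  using mult_right_mono[of "a*c" "b*c" "c\<^sup>\<star>"] by (simp add: le_def mult.assoc)

lemma star_antimono: "a \<sqsubseteq> b \<Longrightarrow> b\<^sup>\<star> \<sqsubseteq> a\<^sup>\<star>"
proof -
  assume "a \<sqsubseteq> b"
  then have "a * (a\<^sup>\<star> * b\<^sup>\<star>) \<sqsubseteq> b * (a\<^sup>\<star> * b\<^sup>\<star>)" by (rule mult_right_mono)
  moreover have "a * (a\<^sup>\<star> * b\<^sup>\<star>) \<approx> b\<^sup>\<star>" "b * (a\<^sup>\<star> * b\<^sup>\<star>) \<approx> a\<^sup>\<star>"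
    by (simp_all add: mult.left_commute[of _ "nu F (a\<^sup>\<star>)"])
  ultimately show ?thesis using le_cong by blast
qed

lemma le_mult_left: "1 \<sqsubseteq> a \<Longrightarrow> b \<sqsubseteq> a * b"
  using mult_right_mono[of 1 a b] by simp

lemma le_mult_right: "1 \<sqsubseteq> a \<Longrightarrow> b \<sqsubseteq> b * a"
  using mult_right_mono[of 1 a b] by (simp add: mult.commute)

lemma one_le_mult: "1 \<sqsubseteq> a \<Longrightarrow> 1 \<sqsubseteq> b \<Longrightarrow> 1 \<sqsubseteq> a * b"
  using le_mult_left le_trans by blast

lemma one_le_power: "1 \<sqsubseteq> a \<Longrightarrow> 1 \<sqsubseteq> a ^ n"
  by (induction n) (auto intro: one_le_mult)

lemma le_power: "1 \<sqsubseteq> a \<Longrightarrow> n \<ge> 1 \<Longrightarrow> a \<sqsubseteq> a ^ n"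
  by (cases n) (auto intro: le_mult_right one_le_power)

text \<open>Lattice-ordered groups are unperforated. The order is only partial here, so comparing
  \<open>b\<close> with 1 by cases is impossible. All later statements about roots and torsion rest
  on this one.\<close>

lemma one_le_of_power:
  assumes "1 \<sqsubseteq> b ^ n" "n \<ge> 1" shows "1 \<sqsubseteq> b"
proof -
  obtain s where s0: "s 0 = 1" and sS: "\<And>i. s (Suc i) = 1 + b * s i"
  proof
    show "rec_nat 1 (\<lambda>i t. 1 + b * t) 0 = 1" by simp
    show "rec_nat 1 (\<lambda>i t. 1 + b * t) (Suc i) = 1 + b * rec_nat 1 (\<lambda>i t. 1 + b * t) i" for i by simp
  qed
  obtain m where m: "n = Suc m" using assms(2) by (cases n) auto
  \<comment> \<open>With \<open>s m = 1 + b + \<dots> + b ^ m\<close> the claim is \<open>s m \<sqsubseteq> b * s m\<close>, and \<open>s m\<close> cancels.\<close>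
  have *: "b ^ Suc i + s i \<approx> 1 + b * s i" for i
  proof (induction i)
    case 0 then show ?case by (simp add: s0 add.commute)
  next
    case (Suc i)
    have "b ^ Suc (Suc i) + s (Suc i) = 1 + b * (b ^ Suc i + s i)"
      unfolding sS power_Suc[of b "Suc i"] distrib_left by (simp only: ac_simps)
    also have "\<dots> \<approx> 1 + b * (1 + b * s i)" using Suc by simp
    finally show ?case by (simp add: sS)
  qed
  have "b ^ Suc i \<sqsubseteq> b * s i" for i
  proof (induction i)
    case 0 show ?case by (simp add: s0)
  next
    case (Suc i)
    have "b * b ^ Suc i \<sqsubseteq> b * (b * s i)" using Suc by (metis mult_mono le_refl)
    also have "b * (b * s i) \<sqsubseteq> b * s (Suc i)" unfolding sS by (rule mult_mono) simp_all
    finally show ?case by simp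
  qed
  from le_trans[OF _ this[of m]] have "1 \<sqsubseteq> b * s m" using assms m by simp
  then have "1 + b * s m \<sqsubseteq> b * s m" by (simp add: add_least)
  with le_trans[OF le_eqv_trans(1)[OF le_add(2) *[of m]]] have "1 * s m \<sqsubseteq> b * s m" by simp
  then show ?thesis by (rule mult_le_cancel)
qed

lemma power_eqv_one: "b ^ n \<approx> 1 \<Longrightarrow> n \<ge> 1 \<Longrightarrow> b \<approx> 1"
proof -
  assume *: "b ^ n \<approx> 1" and n: "n \<ge> 1"
  have "(b\<^sup>\<star>) ^ n * b ^ n \<approx> 1" by (induction n) (auto simp: ac_simps)
  with * have "(b\<^sup>\<star>) ^ n \<approx> 1" by (metis eqv_cancel nu_mult mult_1)
  then have "1 \<sqsubseteq> b\<^sup>\<star>" using n one_le_of_power le_eqv by metis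
  then have "b \<sqsubseteq> 1" using star_antimono[of 1 "b\<^sup>\<star>"] by (simp add: le_def star_one)
  moreover have "1 \<sqsubseteq> b" using * n one_le_of_power le_eqv by metis
  ultimately show ?thesis by (intro le_antisym)
qed

section \<open>Absolute value and infimum\<close>

definition ab where "ab a = a + a\<^sup>\<star>"

text \<open>Inversion reverses the order, so the infimum is the inverse of the supremum of the
  inverses.\<close>

definition meet (infixl "\<sqinter>" 66) where "a \<sqinter> b = (a\<^sup>\<star> + b\<^sup>\<star>)\<^sup>\<star>"

text \<open>Neither \<open>a\<close> nor its inverse need be above 1, but the square of
  \<open>ab a\<close> dominates their product, and a square root of something above 1 is above
  1.\<close>

lemma one_le_ab [simp]: "1 \<sqsubseteq> ab a"
proof -
  have "a * a\<^sup>\<star> \<sqsubseteq> ab a * ab a" unfolding ab_def by (intro mult_mono) simp_all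
  then have "1 \<sqsubseteq> ab a ^ 2" by (simp add: le_def power2_eq_square)
  then show ?thesis by (rule one_le_of_power) simp
qed

lemma le_ab [simp]: "a \<sqsubseteq> ab a" "a\<^sup>\<star> \<sqsubseteq> ab a"
  by (simp_all add: ab_def)

text \<open>The second hypothesis is the bound on the inverse of \<open>a\<close> with the inverse
  cleared. In this form it survives convex combinations, where the inverse of a sum would be
  unmanageable.\<close>

lemma ab_le: "a \<sqsubseteq> w \<Longrightarrow> 1 \<sqsubseteq> w * a \<Longrightarrow> ab a \<sqsubseteq> w"
proof -
  assume "a \<sqsubseteq> w" "1 \<sqsubseteq> w * a"
  from mult_right_mono[OF this(2), of "a\<^sup>\<star>"] have "a\<^sup>\<star> \<sqsubseteq> w" by (simp add: le_def mult.assoc)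
  with \<open>a \<sqsubseteq> w\<close> show ?thesis by (simp add: ab_def add_least)
qed

lemma ab_le_iff: "ab a \<sqsubseteq> w \<longleftrightarrow> a \<sqsubseteq> w \<and> a\<^sup>\<star> \<sqsubseteq> w"
  using le_trans[OF le_ab(1), of a w] le_trans[OF le_ab(2), of a w] add_least[of a w "a\<^sup>\<star>"]
  by (auto simp: ab_def)

lemma one_le_mult_ab: "ab a \<sqsubseteq> w \<Longrightarrow> 1 \<sqsubseteq> w * a"
proof -
  assume "ab a \<sqsubseteq> w"
  then have "a\<^sup>\<star> * a \<sqsubseteq> w * a" using ab_le_iff mult_right_mono by blast
  then show ?thesis by (simp add: le_def)
qed

lemma ab_cong: "a \<approx> b \<Longrightarrow> ab a \<approx> ab b"
  by (simp add: ab_def star_cong[of a b])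

lemma ab_star: "ab (a\<^sup>\<star>) \<approx> ab a"
  by (simp add: ab_def add.commute)

lemma ab_mult: "ab (a * b) \<sqsubseteq> ab a * ab b"
proof -
  have "a\<^sup>\<star> * b\<^sup>\<star> \<sqsubseteq> ab a * ab b" by (intro mult_mono) simp_all
  moreover have "(a * b)\<^sup>\<star> \<approx> a\<^sup>\<star> * b\<^sup>\<star>" by simp
  ultimately have "(a * b)\<^sup>\<star> \<sqsubseteq> ab a * ab b" by (metis le_eqv_trans(2))
  then show ?thesis unfolding ab_le_iff by (simp add: mult_mono)
qed

lemma ab_pos: "1 \<sqsubseteq> a \<Longrightarrow> ab a \<approx> a"
proof -
  assume a: "1 \<sqsubseteq> a"
  then have "a\<^sup>\<star> \<sqsubseteq> 1" using star_antimono star_one by metis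
  then have "a\<^sup>\<star> \<sqsubseteq> a" using a le_trans by blast
  then show ?thesis by (simp add: ab_def le_def add.commute)
qed

lemma ab_one: "ab 1 \<approx> 1" by (simp add: ab_pos)

lemma ab_eqv_one: "ab a \<approx> 1 \<Longrightarrow> a \<approx> 1"
proof -
  assume *: "ab a \<approx> 1"
  have "a \<sqsubseteq> 1" "a\<^sup>\<star> \<sqsubseteq> 1" using * le_ab le_eqv_trans by blast+
  moreover have "1 \<sqsubseteq> a" using star_antimono[OF \<open>a\<^sup>\<star> \<sqsubseteq> 1\<close>] by (simp add: star_one le_def)
  ultimately show ?thesis by (intro le_antisym)
qed

lemma star_power: "(a ^ n)\<^sup>\<star> \<approx> (a\<^sup>\<star>) ^ n"
  by (induction n) (simp_all add: star_one)

text \<open>The \<open>n\<close>-th power of \<open>ab (a ^ n) * a\<^sup>\<star>\<close> is above 1,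
  because \<open>ab (a ^ n)\<close> lies below its own \<open>n\<close>-th power; then
  \<open>one_le_of_power\<close> extracts the root.\<close>

lemma le_ab_power: "n \<ge> 1 \<Longrightarrow> a \<sqsubseteq> ab (a ^ n)"
proof -
  assume n: "n \<ge> 1"
  have "(ab (a ^ n) * a\<^sup>\<star>) ^ n \<approx> ab (a ^ n) ^ n * (a ^ n)\<^sup>\<star>"
    by (simp add: power_mult_distrib star_power)
  moreover have "1 \<sqsubseteq> ab (a ^ n) ^ n * (a ^ n)\<^sup>\<star>"
  proof -
    have "a ^ n * (a ^ n)\<^sup>\<star> \<sqsubseteq> ab (a ^ n) * (a ^ n)\<^sup>\<star>" by (rule mult_right_mono) simp
    also have "\<dots> \<sqsubseteq> ab (a ^ n) ^ n * (a ^ n)\<^sup>\<star>"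
      by (rule mult_right_mono) (use n in \<open>simp add: le_power\<close>)
    finally show ?thesis by (simp add: le_def)
  qed
  ultimately have "1 \<sqsubseteq> (ab (a ^ n) * a\<^sup>\<star>) ^ n" by (metis le_eqv_trans(1))
  then have "1 \<sqsubseteq> ab (a ^ n) * a\<^sup>\<star>" using n by (rule one_le_of_power)
  from mult_right_mono[OF this, of a] show ?thesis by (simp add: le_def mult.assoc)
qed

lemma ab_le_ab_power: "n \<ge> 1 \<Longrightarrow> ab a \<sqsubseteq> ab (a ^ n)"
proof -
  assume n: "n \<ge> 1"
  have "ab ((a\<^sup>\<star>) ^ n) \<approx> ab ((a ^ n)\<^sup>\<star>)" by (rule ab_cong) (simp add: star_power)
  also have "\<dots> = nu F (ab (a ^ n))" by (rule ab_star)
  finally show ?thesis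
    using le_ab_power[OF n, of a] le_eqv_trans(1)[OF le_ab_power[OF n, of "a\<^sup>\<star>"]] by (simp add: ab_le_iff)
qed

lemma meet_le: "a \<sqinter> b \<sqsubseteq> a" "a \<sqinter> b \<sqsubseteq> b"
proof -
  have "(a\<^sup>\<star> + b\<^sup>\<star>)\<^sup>\<star> \<sqsubseteq> a\<^sup>\<star>\<^sup>\<star>" "(a\<^sup>\<star> + b\<^sup>\<star>)\<^sup>\<star> \<sqsubseteq> b\<^sup>\<star>\<^sup>\<star>" by (simp_all add: star_antimono)
  then show "a \<sqinter> b \<sqsubseteq> a" "a \<sqinter> b \<sqsubseteq> b" by (simp_all add: meet_def le_def)
qed

lemma meet_greatest: "c \<sqsubseteq> a \<Longrightarrow> c \<sqsubseteq> b \<Longrightarrow> c \<sqsubseteq> a \<sqinter> b"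
proof -
  assume "c \<sqsubseteq> a" "c \<sqsubseteq> b"
  then have "a\<^sup>\<star> + b\<^sup>\<star> \<sqsubseteq> c\<^sup>\<star>" by (simp add: add_least star_antimono)
  then have "c\<^sup>\<star>\<^sup>\<star> \<sqsubseteq> (a\<^sup>\<star> + b\<^sup>\<star>)\<^sup>\<star>" by (rule star_antimono)
  then show ?thesis by (simp add: meet_def le_def)
qed

lemma meet_mult_le: "a * c \<sqinter> b * c \<sqsubseteq> (a \<sqinter> b) * c"
proof -
  have "(a * c \<sqinter> b * c) * c\<^sup>\<star> \<sqsubseteq> a \<sqinter> b"
  proof (rule meet_greatest)
    have "(a * c \<sqinter> b * c) * c\<^sup>\<star> \<sqsubseteq> a * c * c\<^sup>\<star>" "(a * c \<sqinter> b * c) * c\<^sup>\<star> \<sqsubseteq> b * c * c\<^sup>\<star>"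
      by (simp_all add: mult_right_mono meet_le)
    then show "(a * c \<sqinter> b * c) * c\<^sup>\<star> \<sqsubseteq> a" "(a * c \<sqinter> b * c) * c\<^sup>\<star> \<sqsubseteq> b"
      by (simp_all add: le_def mult.assoc)
  qed
  from mult_right_mono[OF this, of c] show ?thesis by (simp add: le_def mult.assoc)
qed

text \<open>This is what makes intersections of principal kernels principal. With
  \<open>l = n + m - 1\<close>, enlarging one side by a factor \<open>a\<close>, respectively
  \<open>b\<close>, and applying induction bounds the left side by \<open>a\<close> and by
  \<open>b\<close> times the \<open>l\<close>-th power of the meet; the infimum of the two bounds is
  the next power. If an exponent is 0, the left side is below 1.\<close>

lemma meet_power_le:
  assumes "1 \<sqsubseteq> a" "1 \<sqsubseteq> b" shows "a ^ n \<sqinter> b ^ m \<sqsubseteq> (a \<sqinter> b) ^ (n + m)"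
proof (induction "n + m" arbitrary: n m)
  case 0 then show ?case by (simp add: meet_le)
next
  case (Suc l)
  have ge: "1 \<sqsubseteq> a \<sqinter> b" using assms meet_greatest by blast
  show ?case
  proof (cases "n = 0 \<or> m = 0")
    case True
    then have "a ^ n \<sqinter> b ^ m \<sqsubseteq> 1" by (metis meet_le power_0)
    then show ?thesis using one_le_power[OF ge] le_trans by blast
  next
    case False
    then obtain n' m' where nm: "n = Suc n'" "m = Suc m'" by (metis not0_implies_Suc)
    let ?i = "a ^ n \<sqinter> b ^ m" and ?p = "(a \<sqinter> b) ^ l"
    have "?i \<sqsubseteq> a ^ n' * a \<sqinter> b ^ m * a"
    proof (rule meet_greatest)
      show "?i \<sqsubseteq> a ^ n' * a" using meet_le(1)[of "a ^ n" "b ^ m"] nm by (simp add: mult.commute)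
      show "?i \<sqsubseteq> b ^ m * a" using meet_le(2) le_mult_right[OF assms(1)] le_trans by blast
    qed
    also have "\<dots> \<sqsubseteq> (a ^ n' \<sqinter> b ^ m) * a" by (rule meet_mult_le)
    also have "\<dots> \<sqsubseteq> ?p * a" using Suc(1)[of n' m] Suc(2) nm by (auto intro: mult_right_mono)
    finally have 1: "?i \<sqsubseteq> a * ?p" by (simp add: mult.commute)
    have "?i \<sqsubseteq> a ^ n * b \<sqinter> b ^ m' * b"
    proof (rule meet_greatest)
      show "?i \<sqsubseteq> b ^ m' * b" using meet_le(2)[of "a ^ n" "b ^ m"] nm by (simp add: mult.commute)
      show "?i \<sqsubseteq> a ^ n * b" using meet_le(1) le_mult_right[OF assms(2)] le_trans by blast
    qed
    also have "\<dots> \<sqsubseteq> (a ^ n \<sqinter> b ^ m') * b" by (rule meet_mult_le)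
    also have "\<dots> \<sqsubseteq> ?p * b" using Suc(1)[of n m'] Suc(2) nm by (auto intro: mult_right_mono)
    finally have 2: "?i \<sqsubseteq> b * ?p" by (simp add: mult.commute)
    have "?i \<sqsubseteq> a * ?p \<sqinter> b * ?p" using 1 2 by (rule meet_greatest)
    also have "\<dots> \<sqsubseteq> (a \<sqinter> b) * ?p" by (rule meet_mult_le)
    finally show ?thesis using Suc(2) by (metis power_Suc)
  qed
qed

section \<open>Polynomial and rational functions up to pointwise \<open>nu\<close>-equality\<close>

abbreviation feq (infix "\<simeq>" 50) where "f \<simeq> g \<equiv> \<forall>x. f x \<approx> g x"

lemma feq_sym: "f \<simeq> g \<Longrightarrow> g \<simeq> f" by simp

lemma fn_equiv_iff: "fn_equiv F f g \<longleftrightarrow> f \<simeq> g"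
  by (simp add: fn_equiv_def nu_equiv_def)

lemma power_prod_add: "power_prod (\<lambda>i. d i + e i) x = power_prod d x * power_prod e x"
  by (simp add: power_prod_def power_add prod.distrib)

lemma power_prod_zero [simp]: "power_prod (\<lambda>i. 0) x = 1"
  by (simp add: power_prod_def)

text \<open>Repeated exponents and arbitrary coefficients are allowed, which makes closure under
  sums and products immediate; \<open>polyfun_polys\<close> returns to the restricted form demanded
  by \<open>polys\<close>.\<close>

inductive polyfun :: "('n::finite, 'a) fn \<Rightarrow> bool" where
  mono: "polyfun (\<lambda>x. c * power_prod e x)"
| add: "polyfun u \<Longrightarrow> polyfun (\<lambda>x. c * power_prod e x + u x)"

lemma polyfun_add: "polyfun u \<Longrightarrow> polyfun v \<Longrightarrow> polyfun (\<lambda>x. u x + v x)"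
  by (induction rule: polyfun.induct) (auto simp: add.assoc intro: polyfun.add)

lemma polyfun_term_mult: "polyfun v \<Longrightarrow> polyfun (\<lambda>x. c * power_prod e x * v x)"
proof (induction rule: polyfun.induct)
  case (mono d d')
  have "(\<lambda>x. c * power_prod e x * (d * power_prod d' x)) = (\<lambda>x. (c * d) * power_prod (\<lambda>i. e i + d' i) x)"
    by (simp add: power_prod_add ac_simps)
  then show ?case by (simp only: polyfun.mono)
next
  case (add u d d')
  have "(\<lambda>x. c * power_prod e x * (d * power_prod d' x + u x)) =
     (\<lambda>x. (c * d) * power_prod (\<lambda>i. e i + d' i) x + c * power_prod e x * u x)"
    by (simp add: power_prod_add distrib_left ac_simps)
  then show ?case by (simp only: polyfun.add add.IH)
qed

lemma polyfun_mult: "polyfun u \<Longrightarrow> polyfun v \<Longrightarrow> polyfun (\<lambda>x. u x * v x)"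
  by (induction rule: polyfun.induct) (auto simp: distrib_right intro: polyfun_term_mult polyfun_add)

lemma peval_single [simp]: "peval [(c, e)] = (\<lambda>x. c * power_prod e x)"
  by (simp add: peval_def fun_eq_iff)

lemma peval_Cons: "q \<noteq> [] \<Longrightarrow> peval ((c, e) # q) = (\<lambda>x. c * power_prod e x + peval q x)"
  by (cases q) (simp_all add: peval_def fun_eq_iff)

lemma polyfun_peval: "p \<noteq> [] \<Longrightarrow> polyfun (peval p)"
proof (induction p)
  case (Cons t p)
  obtain c e where t: "t = (c, e)" by (cases t)
  show ?case
  proof (cases "p = []")
    case True then show ?thesis by (simp add: t polyfun.mono)
  next
    case False then show ?thesis using Cons by (simp add: t peval_Cons polyfun.add)
  qed
qed simp

lemma peval_remove1:
  "(d, e) \<in> set p \<Longrightarrow> remove1 (d, e) p \<noteq> [] \<Longrightarrow>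
    peval p = (\<lambda>x. d * power_prod e x + peval (remove1 (d, e) p) x)"
proof (induction p)
  case (Cons t p)
  obtain c e' where t: "t = (c, e')" by (cases t)
  show ?case
  proof (cases "t = (d, e)")
    case True then show ?thesis using Cons.prems by (simp add: peval_Cons)
  next
    case False
    then have p: "(d, e) \<in> set p" "p \<noteq> []" using Cons.prems by auto
    show ?thesis
    proof (cases "remove1 (d, e) p = []")
      case True
      then have "p = [(d, e)]" using p by (cases p) (auto split: if_splits)
      then show ?thesis using False by (simp add: t peval_Cons add.commute)
    next
      case r: False
      show ?thesis using Cons.IH[OF p(1) r] False p r
        by (simp add: t peval_Cons add.left_commute)
    qed
  qed
qed simp

text \<open>A repeated exponent is merged by distributivity, and the resulting coefficient is
  replaced by a tangible one with the same ghost. Hence the equality holds only up to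
  \<open>nu\<close>.\<close>

lemma polys_merge:
  assumes p: "p \<in> polys (tangible F)"
  shows "\<exists>q\<in>polys (tangible F). (\<lambda>x. c * power_prod e x + peval p x) \<simeq> peval q"
proof (cases "e \<in> snd ` set p")
  case False
  obtain d where d: "d \<in> tangible F" "d \<approx> c" using tangible_rep by blast
  have "(d, e) # p \<in> polys (tangible F)" using p d False by (auto simp: polys_def)
  moreover have "(\<lambda>x. c * power_prod e x + peval p x) \<simeq> peval ((d, e) # p)"
    using p d by (simp add: peval_Cons polys_def)
  ultimately show ?thesis by blast
next
  case True
  then obtain d where d: "(d, e) \<in> set p" by auto
  obtain b where b: "b \<in> tangible F" "b \<approx> c + d" using tangible_rep by blast
  let ?r = "remove1 (d, e) p"
  have dist: "distinct p" using p by (auto simp: polys_def distinct_map)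
  have "e \<notin> snd ` set ?r"
    using p d by (force simp: polys_def distinct_map inj_on_def set_remove1_eq[OF dist])
  moreover have "distinct (map snd ?r)"
    using p by (simp add: polys_def distinct_map dist set_remove1_eq inj_on_diff)
  moreover have "fst ` set ?r \<subseteq> tangible F" using p set_remove1_subset[of "(d, e)" p] by (auto simp: polys_def)
  ultimately have *: "(b, e) # ?r \<in> polys (tangible F)" using b by (simp add: polys_def)
  have "(\<lambda>x. c * power_prod e x + peval p x) \<simeq> peval ((b, e) # ?r)"
  proof (cases "?r = []")
    case True
    then have "p = [(d, e)]" using d by (cases p) (auto split: if_splits)
    then show ?thesis using b by (simp add: distrib_right)
  next
    case False
    then show ?thesis using b peval_remove1[OF d False]
      by (simp add: peval_Cons distrib_right add.assoc)
  qed
  with * show ?thesis by blast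
qed

lemma polyfun_polys: "polyfun u \<Longrightarrow> \<exists>p\<in>polys (tangible F). u \<simeq> peval p"
proof (induction rule: polyfun.induct)
  case (mono c e)
  obtain d where d: "d \<in> tangible F" "d \<approx> c" using tangible_rep by blast
  then have "[(d, e)] \<in> polys (tangible F)" by (simp add: polys_def)
  with d show ?case by (intro bexI[of _ "[(d, e)]"]) auto
next
  case (add u c e)
  then obtain p where p: "p \<in> polys (tangible F)" "u \<simeq> peval p" by blast
  from polys_merge[OF p(1), of c e] p(2) show ?case by auto
qed

text \<open>The saturation of \<open>ratfun F\<close> under pointwise \<open>nu\<close>-equality. It
  is visibly closed under all operations, whereas a sum or product of members of
  \<open>ratfun F\<close> has to be brought back to that shape by
  \<open>rational_ratfun\<close>.\<close>

definition rational :: "('n::finite, 'a) fn \<Rightarrow> bool" where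
  "rational u \<longleftrightarrow> (\<exists>h g. polyfun h \<and> polyfun g \<and> u \<simeq> (\<lambda>x. h x * (g x)\<^sup>\<star>))"

lemma rationalI: "polyfun h \<Longrightarrow> polyfun g \<Longrightarrow> u \<simeq> (\<lambda>x. h x * (g x)\<^sup>\<star>) \<Longrightarrow> rational u"
  by (auto simp: rational_def)

lemma rational_cong: "rational u \<Longrightarrow> u \<simeq> v \<Longrightarrow> rational v"
  unfolding rational_def by metis

lemma ratfun_rational: "u \<in> ratfun F \<Longrightarrow> rational u"
  unfolding ratfun_def rational_def polys_def using polyfun_peval by blast

lemma rational_ratfun: "rational u \<Longrightarrow> \<exists>v\<in>ratfun F. u \<simeq> v"
proof -
  assume "rational u"
  then obtain h g where hg: "polyfun h" "polyfun g" "u \<simeq> (\<lambda>x. h x * (g x)\<^sup>\<star>)"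
    by (auto simp: rational_def)
  obtain p q where p: "p \<in> polys (tangible F)" "h \<simeq> peval p" and q: "q \<in> polys (tangible F)" "g \<simeq> peval q"
    using hg polyfun_polys by metis
  have "p \<in> polys UNIV" using p by (simp add: polys_def)
  then have "(\<lambda>x. peval p x * (peval q x)\<^sup>\<star>) \<in> ratfun F" using q by (auto simp: ratfun_def)
  moreover have "u \<simeq> (\<lambda>x. peval p x * (peval q x)\<^sup>\<star>)" 
    using hg(3) p(2) star_cong[OF spec[OF q(2)]] by simp
  ultimately show ?thesis by (intro bexI[of _ "\<lambda>x. peval p x * (peval q x)\<^sup>\<star>"])
qed

lemma rational_mult: "rational u \<Longrightarrow> rational v \<Longrightarrow> rational (\<lambda>x. u x * v x)"
proof -
  assume "rational u" "rational v"
  then obtain h g k l where *: "polyfun h" "polyfun g" "u \<simeq> (\<lambda>x. h x * (g x)\<^sup>\<star>)"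
     "polyfun k" "polyfun l" "v \<simeq> (\<lambda>x. k x * (l x)\<^sup>\<star>)"
    by (auto simp: rational_def)
  show ?thesis
  proof (rule rationalI[of "\<lambda>x. h x * k x" "\<lambda>x. g x * l x"])
    show "(\<lambda>x. u x * v x) \<simeq> (\<lambda>x. h x * k x * (g x * l x)\<^sup>\<star>)" using * by (simp add: ac_simps)
  qed (use * in \<open>simp_all add: polyfun_mult\<close>)
qed

lemma rational_star: "rational u \<Longrightarrow> rational (\<lambda>x. (u x)\<^sup>\<star>)"
proof -
  assume "rational u"
  then obtain h g where *: "polyfun h" "polyfun g" "u \<simeq> (\<lambda>x. h x * (g x)\<^sup>\<star>)"
    by (auto simp: rational_def)
  have "(u x)\<^sup>\<star> \<approx> (h x * (g x)\<^sup>\<star>)\<^sup>\<star>" for x using * by (intro star_cong) auto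
  then have "(\<lambda>x. (u x)\<^sup>\<star>) \<simeq> (\<lambda>x. g x * (h x)\<^sup>\<star>)" by (simp add: mult.commute)
  with * show ?thesis by (intro rationalI)
qed

lemma rational_add: "rational u \<Longrightarrow> rational v \<Longrightarrow> rational (\<lambda>x. u x + v x)"
proof -
  assume "rational u" "rational v"
  then obtain h g k l where *: "polyfun h" "polyfun g" "u \<simeq> (\<lambda>x. h x * (g x)\<^sup>\<star>)"
     "polyfun k" "polyfun l" "v \<simeq> (\<lambda>x. k x * (l x)\<^sup>\<star>)"
    by (auto simp: rational_def)
  have "nu F (h x * l x + k x * g x) * (nu F ((g x)\<^sup>\<star>) * nu F ((l x)\<^sup>\<star>)) =
      nu F (h x) * nu F ((g x)\<^sup>\<star>) * (nu F (l x) * nu F ((l x)\<^sup>\<star>)) +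
      nu F (k x) * nu F ((l x)\<^sup>\<star>) * (nu F (g x) * nu F ((g x)\<^sup>\<star>))" for x
    unfolding nu_add nu_mult distrib_right by (simp only: ac_simps)
  then have "nu F (h x * l x + k x * g x) * (nu F ((g x)\<^sup>\<star>) * nu F ((l x)\<^sup>\<star>)) =
      nu F (h x) * nu F ((g x)\<^sup>\<star>) + nu F (k x) * nu F ((l x)\<^sup>\<star>)" for x
    by (simp add: mult.assoc)
  then have "(\<lambda>x. u x + v x) \<simeq> (\<lambda>x. (h x * l x + k x * g x) * (g x * l x)\<^sup>\<star>)"
    using * by simp
  then show ?thesis
    by (rule rationalI[rotated 2]) (use * in \<open>simp_all add: polyfun_mult polyfun_add\<close>)
qed

lemma const_ratfun: "(\<lambda>_. c) \<in> ratfun F"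
proof -
  have "[(c, \<lambda>_. 0)] \<in> polys UNIV" "[(1, \<lambda>_. 0)] \<in> polys (tangible F)"
    by (auto simp: polys_def tangible_one)
  moreover have "(\<lambda>_. c) = (\<lambda>x. peval [(c, \<lambda>_. 0)] x * (peval [(1, \<lambda>_. 0)] x)\<^sup>\<star>)"
    by (simp add: star_one)
  ultimately show ?thesis unfolding ratfun_def by blast
qed

lemma rational_const: "rational (\<lambda>_. c)"
  using const_ratfun ratfun_rational by blast

lemma rational_ab: "rational u \<Longrightarrow> rational (\<lambda>x. ab (u x))"
  unfolding ab_def by (intro rational_add rational_star)

lemma rational_meet: "rational u \<Longrightarrow> rational v \<Longrightarrow> rational (\<lambda>x. u x \<sqinter> v x)"
  unfolding meet_def by (intro rational_add rational_star)

subsection \<open>Kernels\<close>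

abbreviation kern :: "('n::finite, 'a) fn set \<Rightarrow> bool" where "kern K \<equiv> is_kernel F (fn_equiv F) K"

text \<open>Membership up to \<open>nu\<close>, meaningful also for expressions that are not
  literally fractions of the prescribed shape. On \<open>ratfun F\<close> it agrees with membership
  in a kernel by \<open>mem_iff\<close>.\<close>

definition mem :: "('n::finite, 'a) fn set \<Rightarrow> ('n, 'a) fn \<Rightarrow> bool" where
  "mem K u \<longleftrightarrow> (\<exists>v\<in>K. u \<simeq> v)"

lemma memI: "u \<in> K \<Longrightarrow> mem K u" by (auto simp: mem_def)

lemma mem_cong: "mem K u \<Longrightarrow> u \<simeq> v \<Longrightarrow> mem K v"
  by (auto simp: mem_def)

lemma mem_mono: "K \<subseteq> M \<Longrightarrow> mem K u \<Longrightarrow> mem M u"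
  by (auto simp: mem_def)

lemma kernelI:
  assumes cong: "\<And>u v. Q u \<Longrightarrow> u \<simeq> v \<Longrightarrow> Q v"
    and one: "Q (\<lambda>_. 1)"
    and mult: "\<And>a b. rational a \<Longrightarrow> rational b \<Longrightarrow> Q a \<Longrightarrow> Q b \<Longrightarrow> Q (\<lambda>x. a x * b x)"
    and star: "\<And>a. rational a \<Longrightarrow> Q a \<Longrightarrow> Q (\<lambda>x. (a x)\<^sup>\<star>)"
    and conv: "\<And>a b \<alpha> \<beta>. rational \<alpha> \<Longrightarrow> rational \<beta> \<Longrightarrow> rational a \<Longrightarrow> rational b \<Longrightarrow>
       (\<lambda>x. \<alpha> x + \<beta> x) \<simeq> (\<lambda>_. 1) \<Longrightarrow> Q a \<Longrightarrow> Q b \<Longrightarrow> Q (\<lambda>x. \<alpha> x * a x + \<beta> x * b x)"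
  shows "kern {u \<in> ratfun F. Q u}"
proof -
  have cong': "Q v \<Longrightarrow> u \<simeq> v \<Longrightarrow> Q u" for u v using cong[of v u] by simp
  show ?thesis unfolding is_kernel_def fn_equiv_iff
  proof (intro conjI ballI impI CollectI)
    show "{u \<in> ratfun F. Q u} \<noteq> {}" using one const_ratfun by blast
  next
    fix a b u assume "a \<in> {u \<in> ratfun F. Q u}" "b \<in> {u \<in> ratfun F. Q u}" "u \<simeq> (\<lambda>x. a x * b x)"
    then show "Q u" using mult[of a b] cong'[of "\<lambda>x. a x * b x" u] ratfun_rational by blast
  next
    fix a u assume "a \<in> {u \<in> ratfun F. Q u}" "u \<simeq> (\<lambda>x. (a x)\<^sup>\<star>)"
    then show "Q u" using star[of a] cong'[of "\<lambda>x. (a x)\<^sup>\<star>" u] ratfun_rational by blast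
  next
    fix a b \<alpha> \<beta> u assume "a \<in> {u \<in> ratfun F. Q u}" "b \<in> {u \<in> ratfun F. Q u}" "\<alpha> \<in> ratfun F" "\<beta> \<in> ratfun F"
      "(\<lambda>x. \<alpha> x + \<beta> x) \<simeq> (\<lambda>_. 1)" "u \<simeq> (\<lambda>x. \<alpha> x * a x + \<beta> x * b x)"
    then show "Q u" using conv[of \<alpha> \<beta> a b] cong'[of "\<lambda>x. \<alpha> x * a x + \<beta> x * b x" u] ratfun_rational by blast
  qed auto
qed

lemma kern_ratfun: "kern (ratfun F)"
  using kernelI[of "\<lambda>_. True"] by simp

context
  fixes K :: "('n::finite, 'a) fn set"
  assumes K: "kern K"
begin

lemma kern_sub: "K \<subseteq> ratfun F"
  using K by (simp add: is_kernel_def)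

lemma mem_rational: "mem K u \<Longrightarrow> rational u"
  using kern_sub ratfun_rational rational_cong unfolding mem_def by (metis subsetD)

lemma in_conv:
  assumes "a \<in> K" "b \<in> K" "\<alpha> \<in> ratfun F" "\<beta> \<in> ratfun F" "(\<lambda>x. \<alpha> x + \<beta> x) \<simeq> (\<lambda>_. 1)"
    "u \<in> ratfun F" "u \<simeq> (\<lambda>x. \<alpha> x * a x + \<beta> x * b x)"
  shows "u \<in> K"
  using K assms unfolding is_kernel_def fn_equiv_iff by blast

lemma mem_iff: "u \<in> ratfun F \<Longrightarrow> mem K u \<longleftrightarrow> u \<in> K"
proof
  assume u: "u \<in> ratfun F" "mem K u"
  then obtain v where v: "v \<in> K" "u \<simeq> v" by (auto simp: mem_def)
  \<comment> \<open>With both weights 1, \<open>v\<close> combined with itself is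
    \<open>nu\<close>-equal to \<open>v\<close>, so the convexity clause absorbs every rational
    function \<open>nu\<close>-equal to \<open>v\<close>.\<close>
  show "u \<in> K"
    by (rule in_conv[OF v(1) v(1) const_ratfun[of 1] const_ratfun[of 1]]) (use u v in auto)
qed (rule memI)

lemma mem_conv:
  assumes "mem K a" "mem K b" "rational \<alpha>" "rational \<beta>" "(\<lambda>x. \<alpha> x + \<beta> x) \<simeq> (\<lambda>_. 1)"
  shows "mem K (\<lambda>x. \<alpha> x * a x + \<beta> x * b x)"
proof -
  obtain a' b' where ab: "a' \<in> K" "a \<simeq> a'" "b' \<in> K" "b \<simeq> b'" using assms by (auto simp: mem_def)
  obtain \<alpha>' \<beta>' where \<alpha>\<beta>: "\<alpha>' \<in> ratfun F" "\<alpha> \<simeq> \<alpha>'" "\<beta>' \<in> ratfun F" "\<beta> \<simeq> \<beta>'"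
    using assms rational_ratfun by metis
  have "rational (\<lambda>x. \<alpha> x * a x + \<beta> x * b x)"
    using assms mem_rational by (intro rational_add rational_mult) auto
  then obtain u where u: "u \<in> ratfun F" "(\<lambda>x. \<alpha> x * a x + \<beta> x * b x) \<simeq> u"
    using rational_ratfun by blast
  have "u \<in> K"
    by (rule in_conv[OF ab(1,3) \<alpha>\<beta>(1,3) _ u(1)]) (use assms(5) ab \<alpha>\<beta> feq_sym[OF u(2)] in simp_all)
  with u show ?thesis by (auto simp: mem_def)
qed

lemma mem_mult:
  assumes "mem K a" "mem K b" shows "mem K (\<lambda>x. a x * b x)"
proof -
  obtain a' b' where ab: "a' \<in> K" "a \<simeq> a'" "b' \<in> K" "b \<simeq> b'" using assms by (auto simp: mem_def)
  obtain u where u: "u \<in> ratfun F" "(\<lambda>x. a x * b x) \<simeq> u"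
    using rational_ratfun[OF rational_mult] mem_rational assms by blast
  have "u \<simeq> (\<lambda>x. a' x * b' x)" using feq_sym[OF u(2)] ab by simp
  then have "u \<in> K" using K ab u unfolding is_kernel_def fn_equiv_iff by blast
  with u show ?thesis by (auto simp: mem_def)
qed

lemma mem_star:
  assumes "mem K a" shows "mem K (\<lambda>x. (a x)\<^sup>\<star>)"
proof -
  obtain a' where ab: "a' \<in> K" "a \<simeq> a'" using assms by (auto simp: mem_def)
  obtain u where u: "u \<in> ratfun F" "(\<lambda>x. (a x)\<^sup>\<star>) \<simeq> u"
    using rational_ratfun[OF rational_star] mem_rational assms by blast
  have "u \<simeq> (\<lambda>x. (a' x)\<^sup>\<star>)" using feq_sym[OF u(2)] star_cong[OF spec[OF ab(2)]] by simp
  then have "u \<in> K" using K ab u unfolding is_kernel_def fn_equiv_iff by blast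
  with u show ?thesis by (auto simp: mem_def)
qed

lemma mem_one: "mem K (\<lambda>_. 1)"
proof -
  have "K \<noteq> {}" using K unfolding is_kernel_def by (elim conjE)
  then obtain a where "a \<in> K" by blast
  then have "mem K a" by (rule memI)
  from mem_mult[OF this mem_star[OF this]] show ?thesis by (rule mem_cong) simp
qed

text \<open>Both weights may be 1, as \<open>1 + 1 \<approx> 1\<close>; thus kernels are closed
  under suprema.\<close>

lemma mem_add: "mem K a \<Longrightarrow> mem K b \<Longrightarrow> mem K (\<lambda>x. a x + b x)"
  using mem_conv[OF _ _ rational_const[of 1] rational_const[of 1]] by simp

lemma mem_power: "mem K a \<Longrightarrow> mem K (\<lambda>x. a x ^ n)"
  by (induction n) (simp_all add: mem_one mem_mult)

lemma mem_ab: "mem K a \<Longrightarrow> mem K (\<lambda>x. ab (a x))"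
  unfolding ab_def by (intro mem_add mem_star)

lemma mem_between:
  assumes "mem K w" "rational u" "\<And>x. 1 \<sqsubseteq> u x" "\<And>x. u x \<sqsubseteq> w x"
  shows "mem K u"
proof -
  have w: "rational w" using assms(1) by (rule mem_rational)
  \<comment> \<open>\<open>u = (u / w) * w + 1 * 1\<close> is a convex combination of \<open>w\<close> and \<open>1\<close>.\<close>
  have "mem K (\<lambda>x. (u x * (w x)\<^sup>\<star>) * w x + 1 * 1)"
  proof (rule mem_conv[OF assms(1) mem_one])
    show "rational (\<lambda>x. u x * (w x)\<^sup>\<star>)" using w assms by (intro rational_mult rational_star)
    show "rational (\<lambda>_. 1)" by (rule rational_const)
    have "u x * (w x)\<^sup>\<star> \<sqsubseteq> w x * (w x)\<^sup>\<star>" for x by (rule mult_right_mono) (rule assms)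
    then show "(\<lambda>x. u x * (w x)\<^sup>\<star> + 1) \<simeq> (\<lambda>_. 1)" by (simp add: le_def)
  qed
  then show ?thesis
    by (rule mem_cong) (use assms(3) in \<open>simp add: le_def mult.assoc add.commute\<close>)
qed

text \<open>\<open>mem_between\<close> handles functions above 1 only. The product of
  \<open>u\<close> with its absolute value lies between 1 and the square of that absolute value, so
  it belongs to \<open>K\<close>, and the absolute value can be divided out.\<close>

lemma mem_bound:
  assumes "mem K w" "rational u" "\<And>x. ab (u x) \<sqsubseteq> w x"
  shows "mem K u"
proof -
  have ab: "mem K (\<lambda>x. ab (u x))"
    by (rule mem_between[OF assms(1)]) (use assms in \<open>auto intro: rational_ab\<close>)
  have "mem K (\<lambda>x. u x * ab (u x))"
  proof (rule mem_between[OF mem_mult[OF ab ab]])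
    show "rational (\<lambda>x. u x * ab (u x))" using assms by (intro rational_mult rational_ab)
    show "1 \<sqsubseteq> u x * ab (u x)" for x using one_le_mult_ab[OF le_refl, of "u x"] by (simp add: mult.commute)
    show "u x * ab (u x) \<sqsubseteq> ab (u x) * ab (u x)" for x by (rule mult_right_mono) simp
  qed
  from mem_mult[OF this mem_star[OF ab]] show ?thesis
    by (rule mem_cong) (simp add: mult.assoc)
qed

lemma mem_root:
  assumes "mem K (\<lambda>x. u x ^ n)" "n \<ge> 1" "rational u"
  shows "mem K u"
  by (rule mem_bound[OF mem_ab[OF assms(1)] assms(3)]) (rule ab_le_ab_power[OF assms(2)])

end

lemma mem_Int:
  assumes "kern K" "kern M" shows "mem (K \<inter> M) u \<longleftrightarrow> mem K u \<and> mem M u"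
proof (intro iffI conjI)
  assume *: "mem K u \<and> mem M u"
  then obtain v where v: "v \<in> ratfun F" "u \<simeq> v" using rational_ratfun mem_rational assms by blast
  then have "mem K v" "mem M v" using * mem_cong by blast+
  then have "v \<in> K \<inter> M" using v mem_iff assms by blast
  then show "mem (K \<inter> M) u" using v by (auto simp: mem_def)
qed (auto simp: mem_def)

lemma kern_Inter:
  assumes "KK \<noteq> {}" "\<And>K. K \<in> KK \<Longrightarrow> kern K" shows "kern (\<Inter>KK)"
proof -
  have "\<Inter>KK = {u \<in> ratfun F. \<forall>K\<in>KK. mem K u}"
    using assms kern_sub mem_iff by blast
  moreover have "kern {u \<in> ratfun F. \<forall>K\<in>KK. mem K u}"
  proof (rule kernelI)
    show "\<forall>K\<in>KK. mem K v" if "\<forall>K\<in>KK. mem K u" "u \<simeq> v" for u v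
      using that mem_cong by blast
  qed (use assms in \<open>simp_all add: mem_one mem_mult mem_star mem_conv\<close>)
  ultimately show ?thesis by simp
qed

lemma kern_Int: "kern K \<Longrightarrow> kern M \<Longrightarrow> kern (K \<inter> M)"
  using kern_Inter[of "{K, M}"] by auto

lemma kern_kgen: "S \<subseteq> ratfun F \<Longrightarrow> kern (kgen F S)"
  unfolding gen_kernel_def using kern_ratfun by (intro kern_Inter) auto

lemma kgen_sub: "S \<subseteq> kgen F S"
  by (auto simp: gen_kernel_def)

lemma kgen_least: "kern K \<Longrightarrow> S \<subseteq> K \<Longrightarrow> kgen F S \<subseteq> K"
  by (auto simp: gen_kernel_def)

lemma kgen_mono: "S \<subseteq> T \<Longrightarrow> kgen F S \<subseteq> kgen F T"
  by (auto simp: gen_kernel_def)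

text \<open>The source of all upper bounds on generated kernels. Since bounds are at least 1, a
  product of two bounds dominates both, so a single product serves for products of functions and for
  convex combinations alike.\<close>

lemma kern_bounded:
  fixes W :: "('n::finite, 'a) fn set"
  assumes one: "(\<lambda>_. 1) \<in> W" and ge: "\<And>w x. w \<in> W \<Longrightarrow> 1 \<sqsubseteq> w x"
    and mult: "\<And>v w. v \<in> W \<Longrightarrow> w \<in> W \<Longrightarrow> (\<lambda>x. v x * w x) \<in> W"
  shows "kern {u \<in> ratfun F. \<exists>w\<in>W. \<forall>x. ab (u x) \<sqsubseteq> w x}"
proof (rule kernelI)
  fix u v :: "('n, 'a) fn" assume "\<exists>w\<in>W. \<forall>x. ab (u x) \<sqsubseteq> w x" "u \<simeq> v"
  then show "\<exists>w\<in>W. \<forall>x. ab (v x) \<sqsubseteq> w x"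
    by (metis ab_cong le_eqv_trans(2))
next
  show "\<exists>w\<in>W. \<forall>x. ab 1 \<sqsubseteq> w x" 
    using one le_eqv[OF ab_one] by (intro bexI[of _ "\<lambda>_. 1"]) auto
next
  fix a b :: "('n, 'a) fn"
  assume "\<exists>w\<in>W. \<forall>x. ab (a x) \<sqsubseteq> w x" "\<exists>w\<in>W. \<forall>x. ab (b x) \<sqsubseteq> w x"
  then obtain v w where vw: "v \<in> W" "w \<in> W" "\<forall>x. ab (a x) \<sqsubseteq> v x" "\<forall>x. ab (b x) \<sqsubseteq> w x" by blast
  then have "ab (a x * b x) \<sqsubseteq> v x * w x" for x
    using le_trans[OF ab_mult mult_mono] by blast
  then show "\<exists>w\<in>W. \<forall>x. ab (a x * b x) \<sqsubseteq> w x"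
    using mult[OF vw(1,2)] by (intro bexI[of _ "\<lambda>x. v x * w x"]) auto
next
  fix a :: "('n, 'a) fn" assume "\<exists>w\<in>W. \<forall>x. ab (a x) \<sqsubseteq> w x"
  then show "\<exists>w\<in>W. \<forall>x. ab ((a x)\<^sup>\<star>) \<sqsubseteq> w x"
    by (metis ab_star le_eqv_trans(2))
next
  fix a b \<alpha> \<beta> :: "('n, 'a) fn"
  assume "\<exists>w\<in>W. \<forall>x. ab (a x) \<sqsubseteq> w x" "\<exists>w\<in>W. \<forall>x. ab (b x) \<sqsubseteq> w x"
    and one: "(\<lambda>x. \<alpha> x + \<beta> x) \<simeq> (\<lambda>_. 1)"
  then obtain v w where vw: "v \<in> W" "w \<in> W" "\<forall>x. ab (a x) \<sqsubseteq> v x" "\<forall>x. ab (b x) \<sqsubseteq> w x" by blast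
  have "ab (\<alpha> x * a x + \<beta> x * b x) \<sqsubseteq> v x * w x" (is "_ \<sqsubseteq> ?w") for x
  proof -
    have 1: "ab (a x) \<sqsubseteq> ?w" "ab (b x) \<sqsubseteq> ?w"
      using vw ge le_mult_left le_mult_right le_trans by blast+
    have eq: "\<alpha> x * ?w + \<beta> x * ?w \<approx> ?w" "\<alpha> x + \<beta> x \<approx> 1"
      using one by (simp_all flip: distrib_right nu_add)
    show ?thesis
    proof (rule ab_le)
      have "a x \<sqsubseteq> ?w" "b x \<sqsubseteq> ?w" using 1 by (simp_all add: ab_le_iff)
      then have "\<alpha> x * a x + \<beta> x * b x \<sqsubseteq> \<alpha> x * ?w + \<beta> x * ?w" by (intro add_mono mult_mono) auto
      then show "\<alpha> x * a x + \<beta> x * b x \<sqsubseteq> ?w" using eq(1) by (rule le_eqv_trans)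
      \<comment> \<open>The lower bound is obtained without inverting a sum: both
        \<open>?w * a x\<close> and \<open>?w * b x\<close> are above 1, and weights adding up to 1
        preserve this.\<close>
      have "1 \<sqsubseteq> ?w * a x" "1 \<sqsubseteq> ?w * b x" using 1 by (simp_all add: one_le_mult_ab)
      then have "\<alpha> x * 1 + \<beta> x * 1 \<sqsubseteq> \<alpha> x * (?w * a x) + \<beta> x * (?w * b x)"
        by (intro add_mono mult_mono) auto
      then have "1 \<sqsubseteq> \<alpha> x * (?w * a x) + \<beta> x * (?w * b x)"
        using le_eqv_trans(2)[OF eq(2)[symmetric]] by simp
      moreover have "\<alpha> x * (?w * a x) + \<beta> x * (?w * b x) = ?w * (\<alpha> x * a x + \<beta> x * b x)"
        unfolding distrib_left by (simp only: ac_simps)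
      ultimately show "1 \<sqsubseteq> ?w * (\<alpha> x * a x + \<beta> x * b x)" by simp
    qed
  qed
  then show "\<exists>w\<in>W. \<forall>x. ab (\<alpha> x * a x + \<beta> x * b x) \<sqsubseteq> w x"
    using mult[OF vw(1,2)] by (intro bexI[of _ "\<lambda>x. v x * w x"]) auto
qed

subsection \<open>Products\<close>

text \<open>The infimum of \<open>t\<close> and \<open>p\<close> takes from \<open>t\<close> as much
  as fits below \<open>p\<close>. The rest is below \<open>q\<close>, because \<open>t\<close> is
  below both \<open>t x * q x\<close> and \<open>p x * q x\<close>, hence below the infimum times
  \<open>q x\<close>.\<close>

lemma riesz_decomposition:
  assumes K: "kern K" and M: "kern M" and t: "rational t" "\<And>x. 1 \<sqsubseteq> t x" "\<And>x. t x \<sqsubseteq> p x * q x"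
    and p: "mem K p" "\<And>x. 1 \<sqsubseteq> p x" and q: "mem M q" "\<And>x. 1 \<sqsubseteq> q x"
  shows "\<exists>a b. mem K a \<and> mem M b \<and> t \<simeq> (\<lambda>x. a x * b x)"
proof (intro exI conjI)
  let ?a = "\<lambda>x. t x \<sqinter> p x"
  have rat: "rational ?a" using t mem_rational[OF K p(1)] by (intro rational_meet)
  show "mem K ?a"
    by (rule mem_between[OF K p(1) rat]) (use t p in \<open>auto simp: meet_le meet_greatest\<close>)
  show "mem M (\<lambda>x. t x * (?a x)\<^sup>\<star>)"
  proof (rule mem_between[OF M q(1)])
    show "rational (\<lambda>x. t x * (?a x)\<^sup>\<star>)" using rat t by (intro rational_mult rational_star)
    fix x
    have "?a x * (?a x)\<^sup>\<star> \<sqsubseteq> t x * (?a x)\<^sup>\<star>" by (intro mult_right_mono meet_le)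
    then show "1 \<sqsubseteq> t x * (?a x)\<^sup>\<star>" by (simp add: le_def)
    have "t x \<sqsubseteq> t x * q x \<sqinter> p x * q x" using t q by (simp add: meet_greatest le_mult_right)
    also have "\<dots> \<sqsubseteq> ?a x * q x" by (rule meet_mult_le)
    finally have "t x * (?a x)\<^sup>\<star> \<sqsubseteq> ?a x * q x * (?a x)\<^sup>\<star>" by (rule mult_right_mono)
    moreover have "?a x * q x * (?a x)\<^sup>\<star> \<approx> q x" by (simp add: mult.commute[of "nu F (t x \<sqinter> p x)"] mult.assoc)
    ultimately show "t x * (?a x)\<^sup>\<star> \<sqsubseteq> q x" by (rule le_eqv_trans)
  qed
  show "t \<simeq> (\<lambda>x. ?a x * (t x * (?a x)\<^sup>\<star>))" by (simp add: mult.left_commute)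
qed

text \<open>For the converse, \<open>u\<close> may lie on both sides of 1, so it is written as the
  quotient of \<open>1 + u x\<close> by \<open>1 + (u x)\<^sup>\<star>\<close>. Both are between 1
  and the bound and decompose; dividing the decompositions factorwise splits
  \<open>u\<close>.\<close>

lemma kprod_iff:
  assumes K: "kern K" and M: "kern M" and u: "u \<in> ratfun F"
  shows "u \<in> kprod F K M \<longleftrightarrow>
    (\<exists>p q. mem K p \<and> mem M q \<and> (\<forall>x. 1 \<sqsubseteq> p x) \<and> (\<forall>x. 1 \<sqsubseteq> q x) \<and> (\<forall>x. ab (u x) \<sqsubseteq> p x * q x))"
    (is "_ \<longleftrightarrow> ?R")
proof
  assume "u \<in> kprod F K M"
  then obtain a b where ab: "a \<in> K" "b \<in> M" "u \<simeq> (\<lambda>x. a x * b x)"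
    by (auto simp: kprod_def fn_equiv_iff)
  have "ab (u x) \<sqsubseteq> ab (a x) * ab (b x)" for x
    using le_eqv_trans(2)[OF ab_cong[OF spec[OF ab(3)]] ab_mult] .
  then show ?R
    using ab by (intro exI[of _ "\<lambda>x. ab (a x)"] exI[of _ "\<lambda>x. ab (b x)"]) (auto simp: memI mem_ab K M)
next
  assume ?R
  then obtain p q where pq: "mem K p" "mem M q" "\<And>x. 1 \<sqsubseteq> p x" "\<And>x. 1 \<sqsubseteq> q x" "\<And>x. ab (u x) \<sqsubseteq> p x * q x"
    by blast
  have ru: "rational u" using u by (rule ratfun_rational)
  have ge: "1 \<sqsubseteq> p x * q x" "u x \<sqsubseteq> p x * q x" "(u x)\<^sup>\<star> \<sqsubseteq> p x * q x" for x
    using pq(5)[of x] one_le_mult pq(3,4) by (auto simp: ab_le_iff)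
  obtain a b where ab: "mem K a" "mem M b" "(\<lambda>x. 1 + u x) \<simeq> (\<lambda>x. a x * b x)"
    using riesz_decomposition[OF K M, of "\<lambda>x. 1 + u x" p q] pq ge ru
    by (auto simp: rational_add rational_const add_least)
  obtain c d where cd: "mem K c" "mem M d" "(\<lambda>x. 1 + (u x)\<^sup>\<star>) \<simeq> (\<lambda>x. c x * d x)"
    using riesz_decomposition[OF K M, of "\<lambda>x. 1 + (u x)\<^sup>\<star>" p q] pq ge ru
    by (auto simp: rational_add rational_const rational_star add_least)
  have "u x \<approx> (a x * (c x)\<^sup>\<star>) * (b x * (d x)\<^sup>\<star>)" for x
  proof (rule eqv_cancel)
    have "u x * (1 + (u x)\<^sup>\<star>) \<approx> 1 + u x" by (simp add: distrib_left add.commute)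
    also have "\<dots> = nu F (a x * b x)" using ab(3) by blast
    also have "\<dots> = nu F ((a x * (c x)\<^sup>\<star>) * (b x * (d x)\<^sup>\<star>) * (c x * d x))"
    proof -
      have "(a x * (c x)\<^sup>\<star>) * (b x * (d x)\<^sup>\<star>) * (c x * d x) =
          (a x * b x) * ((c x * (c x)\<^sup>\<star>) * (d x * (d x)\<^sup>\<star>))" by (simp only: ac_simps)
      then show ?thesis by (simp add: mult.assoc)
    qed
    finally show "u x * (c x * d x) \<approx> (a x * (c x)\<^sup>\<star>) * (b x * (d x)\<^sup>\<star>) * (c x * d x)"
      using cd(3) by simp
  qed
  moreover obtain k where k: "k \<in> K" "(\<lambda>x. a x * (c x)\<^sup>\<star>) \<simeq> k"
    using mem_mult[OF K ab(1) mem_star[OF K cd(1)]] unfolding mem_def by blast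
  moreover obtain l where l: "l \<in> M" "(\<lambda>x. b x * (d x)\<^sup>\<star>) \<simeq> l"
    using mem_mult[OF M ab(2) mem_star[OF M cd(2)]] unfolding mem_def by blast
  ultimately have "u \<simeq> (\<lambda>x. k x * l x)" by simp
  then show "u \<in> kprod F K M" using u k l by (auto simp: kprod_def fn_equiv_iff)
qed

lemma kern_kprod:
  assumes K: "kern K" and M: "kern M" shows "kern (kprod F K M)"
proof -
  let ?W = "{\<lambda>x. p x * q x | p q. mem K p \<and> mem M q \<and> (\<forall>x. 1 \<sqsubseteq> p x) \<and> (\<forall>x. 1 \<sqsubseteq> q x)}"
  have "u \<in> kprod F K M \<longleftrightarrow> u \<in> ratfun F \<and> (\<exists>w\<in>?W. \<forall>x. ab (u x) \<sqsubseteq> w x)" for u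
  proof (cases "u \<in> ratfun F")
    case True
    have "(\<exists>w\<in>?W. P w) \<longleftrightarrow> (\<exists>p q. mem K p \<and> mem M q \<and> (\<forall>x. 1 \<sqsubseteq> p x) \<and> (\<forall>x. 1 \<sqsubseteq> q x) \<and>
        P (\<lambda>x. p x * q x))" for P by blast
    from this[of "\<lambda>w. \<forall>x. ab (u x) \<sqsubseteq> w x"] show ?thesis
      unfolding kprod_iff[OF K M True] by (simp only: True simp_thms)
  qed (simp add: kprod_def)
  then have "kprod F K M = {u \<in> ratfun F. \<exists>w\<in>?W. \<forall>x. ab (u x) \<sqsubseteq> w x}"
    by (intro set_eqI) (simp only: mem_Collect_eq)
  moreover have "kern {u \<in> ratfun F. \<exists>w\<in>?W. \<forall>x. ab (u x) \<sqsubseteq> w x}"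
  proof (rule kern_bounded)
    have "mem K (\<lambda>_. 1)" "mem M (\<lambda>_. 1)" by (simp_all add: mem_one K M)
    then show "(\<lambda>_. 1) \<in> ?W"
      by (intro CollectI exI[of _ "\<lambda>_. 1"]) simp
    show "1 \<sqsubseteq> w x" if "w \<in> ?W" for w x using that by (auto intro: one_le_mult)
    fix v w assume "v \<in> ?W" "w \<in> ?W"
    then obtain p q p' q' where
      "mem K p" "mem M q" "\<forall>x. 1 \<sqsubseteq> p x" "\<forall>x. 1 \<sqsubseteq> q x" "v = (\<lambda>x. p x * q x)"
      "mem K p'" "mem M q'" "\<forall>x. 1 \<sqsubseteq> p' x" "\<forall>x. 1 \<sqsubseteq> q' x" "w = (\<lambda>x. p' x * q' x)"
      by blast
    then show "(\<lambda>x. v x * w x) \<in> ?W"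
      by (intro CollectI exI[of _ "\<lambda>x. p x * p' x"] exI[of _ "\<lambda>x. q x * q' x"])
         (auto simp: ac_simps K M intro: mem_mult one_le_mult)
  qed
  ultimately show ?thesis by simp
qed

lemma kprod_upper:
  assumes K: "kern K" and M: "kern M" shows "K \<subseteq> kprod F K M" "M \<subseteq> kprod F K M"
proof -
  obtain k l where kl: "k \<in> K" "(\<lambda>_. 1) \<simeq> k" "l \<in> M" "(\<lambda>_. 1) \<simeq> l"
    using mem_one[OF K] mem_one[OF M] unfolding mem_def by blast
  show "K \<subseteq> kprod F K M"
  proof
    fix u assume u: "u \<in> K"
    have "u \<simeq> (\<lambda>x. u x * l x)" by (simp flip: kl(4)[rule_format])
    then show "u \<in> kprod F K M" using u kl(3) kern_sub[OF K] unfolding kprod_def fn_equiv_iff by blast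
  qed
  show "M \<subseteq> kprod F K M"
  proof
    fix u assume u: "u \<in> M"
    have "u \<simeq> (\<lambda>x. k x * u x)" by (simp flip: kl(2)[rule_format])
    then show "u \<in> kprod F K M" using u kl(1) kern_sub[OF M] unfolding kprod_def fn_equiv_iff by blast
  qed
qed

lemma kprod_least:
  assumes "kern N" "K \<subseteq> N" "M \<subseteq> N" shows "kprod F K M \<subseteq> N"
proof
  fix u assume "u \<in> kprod F K M"
  then obtain a b where *: "a \<in> K" "b \<in> M" "u \<simeq> (\<lambda>x. a x * b x)" "u \<in> ratfun F"
    by (auto simp: kprod_def fn_equiv_iff)
  have "mem N (\<lambda>x. a x * b x)" by (rule mem_mult) (use * assms memI in blast)+
  then have "mem N u" using feq_sym[OF *(3)] by (rule mem_cong)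
  then show "u \<in> N" using mem_iff[OF assms(1) *(4)] by simp
qed

lemma kprod_commute: "kern K \<Longrightarrow> kern M \<Longrightarrow> kprod F K M = kprod F M K"
  by (intro equalityI kprod_least kern_kprod kprod_upper)

lemma kprod_kgen:
  assumes "S \<subseteq> ratfun F" "T \<subseteq> ratfun F"
  shows "kprod F (kgen F S) (kgen F T) = kgen F (S \<union> T)"
proof
  have kk: "kern (kgen F S)" "kern (kgen F T)" using assms kern_kgen by auto
  show "kprod F (kgen F S) (kgen F T) \<subseteq> kgen F (S \<union> T)"
    using assms by (intro kprod_least kern_kgen kgen_mono) auto
  show "kgen F (S \<union> T) \<subseteq> kprod F (kgen F S) (kgen F T)"
    using kprod_upper[OF kk] kgen_sub by (intro kgen_least kern_kprod kk) blast
qed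

text \<open>If the absolute value of \<open>u\<close> is below \<open>p x * q x\<close> and below
  \<open>p' x * q' x\<close>, it is below the infimum of \<open>p x\<close> and \<open>p' x\<close>
  times \<open>q x * q' x\<close>. Distributivity is what brings \<open>Omega F\<close> into the
  normal form \<open>hs_meets\<close>.\<close>

lemma kprod_Int_distrib:
  assumes A: "kern A" and B: "kern B" and C: "kern C"
  shows "kprod F (A \<inter> B) C = kprod F A C \<inter> kprod F B C"
proof
  have AB: "kern (A \<inter> B)" using A B by (rule kern_Int)
  show "kprod F (A \<inter> B) C \<subseteq> kprod F A C \<inter> kprod F B C"
    using kprod_upper[OF A C] kprod_upper[OF B C]
    by (intro kprod_least kern_Int kern_kprod A B C) auto
  show "kprod F A C \<inter> kprod F B C \<subseteq> kprod F (A \<inter> B) C"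
  proof
    fix u assume u: "u \<in> kprod F A C \<inter> kprod F B C"
    then have ru: "u \<in> ratfun F" by (simp add: kprod_def)
    obtain p q where pq: "mem A p" "mem C q" "\<And>x. 1 \<sqsubseteq> p x" "\<And>x. 1 \<sqsubseteq> q x" "\<And>x. ab (u x) \<sqsubseteq> p x * q x"
      using u unfolding Int_iff kprod_iff[OF A C ru] by blast
    obtain p' q' where pq': "mem B p'" "mem C q'" "\<And>x. 1 \<sqsubseteq> p' x" "\<And>x. 1 \<sqsubseteq> q' x" "\<And>x. ab (u x) \<sqsubseteq> p' x * q' x"
      using u unfolding Int_iff kprod_iff[OF B C ru] by blast
    have rat: "rational (\<lambda>x. p x \<sqinter> p' x)" using pq pq' A B by (intro rational_meet mem_rational)
    have "mem (A \<inter> B) (\<lambda>x. p x \<sqinter> p' x)"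
      unfolding mem_Int[OF A B]
      using mem_between[OF A pq(1) rat] mem_between[OF B pq'(1) rat] pq pq'
      by (auto simp: meet_le meet_greatest)
    moreover have "mem C (\<lambda>x. q x * q' x)" using C pq(2) pq'(2) by (rule mem_mult)
    moreover have "ab (u x) \<sqsubseteq> (p x \<sqinter> p' x) * (q x * q' x)" for x
    proof -
      have "ab (u x) \<sqsubseteq> p x * (q x * q' x)"
        using le_trans[OF pq(5) le_mult_right[OF pq'(4)]] by (simp add: mult.assoc)
      moreover have "ab (u x) \<sqsubseteq> p' x * (q x * q' x)"
        using le_trans[OF pq'(5) le_mult_right[OF pq(4)]] by (simp add: ac_simps)
      ultimately show ?thesis using le_trans[OF meet_greatest meet_mult_le] by blast
    qed
    moreover have "\<forall>x. 1 \<sqsubseteq> p x \<sqinter> p' x" "\<forall>x. 1 \<sqsubseteq> q x * q' x"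
      using pq pq' by (auto simp: meet_greatest one_le_mult)
    ultimately show "u \<in> kprod F (A \<inter> B) C"
      unfolding kprod_iff[OF AB C ru]
      by (intro exI[of _ "\<lambda>x. p x \<sqinter> p' x"] exI[of _ "\<lambda>x. q x * q' x"]) auto
  qed
qed

subsection \<open>Principal kernels\<close>

lemma kgen_single_iff:
  assumes g: "g \<in> ratfun F" and u: "u \<in> ratfun F"
  shows "u \<in> kgen F {g} \<longleftrightarrow> (\<exists>N. \<forall>x. ab (u x) \<sqsubseteq> ab (g x) ^ N)"
proof
  let ?W = "{\<lambda>x. ab (g x) ^ N | N. True}"
  let ?K = "{u \<in> ratfun F. \<exists>w\<in>?W. \<forall>x. ab (u x) \<sqsubseteq> w x}"
  have "kern ?K"
  proof (rule kern_bounded)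
    show "(\<lambda>_. 1) \<in> ?W" by (intro CollectI exI[of _ 0]) simp
    show "1 \<sqsubseteq> w x" if "w \<in> ?W" for w x using that by (auto intro: one_le_power)
    fix v w assume "v \<in> ?W" "w \<in> ?W"
    then obtain N M where "v = (\<lambda>x. ab (g x) ^ N)" "w = (\<lambda>x. ab (g x) ^ M)" by blast
    then show "(\<lambda>x. v x * w x) \<in> ?W" by (intro CollectI exI[of _ "N + M"]) (simp add: power_add)
  qed
  moreover have "{g} \<subseteq> ?K"
  proof -
    have "(\<lambda>x. ab (g x)) \<in> ?W" by (intro CollectI exI[of _ 1]) simp
    then have "\<exists>w\<in>?W. \<forall>x. ab (g x) \<sqsubseteq> w x" by (rule bexI[rotated]) simp
    then show ?thesis using g by blast
  qed
  ultimately have "kgen F {g} \<subseteq> ?K" by (rule kgen_least)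
  then show "\<exists>N. \<forall>x. ab (u x) \<sqsubseteq> ab (g x) ^ N" if "u \<in> kgen F {g}" using that by blast
next
  assume "\<exists>N. \<forall>x. ab (u x) \<sqsubseteq> ab (g x) ^ N"
  then obtain N where N: "\<And>x. ab (u x) \<sqsubseteq> ab (g x) ^ N" by blast
  have K: "kern (kgen F {g})" using g by (simp add: kern_kgen)
  have "mem (kgen F {g}) g" using kgen_sub by (intro memI) blast
  then have "mem (kgen F {g}) u"
    by (intro mem_bound[OF K mem_power[OF K mem_ab[OF K]] ratfun_rational[OF u], OF _ N])
  then show "u \<in> kgen F {g}" using mem_iff[OF K u] by simp
qed

text \<open>\<open>reducible\<close> and \<open>HSpec\<close> speak of principal kernels, so the
  members of \<open>Omega F\<close> have to be recognised as such.\<close>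

definition one_generated :: "('n::finite, 'a) fn set \<Rightarrow> bool" where
  "one_generated K \<longleftrightarrow> (\<exists>g\<in>ratfun F. K = kgen F {g})"

lemma one_generated_kern: "one_generated K \<Longrightarrow> kern K"
  by (auto simp: one_generated_def kern_kgen)

text \<open>The generator is the infimum of the absolute values of the two generators: a function
  below a power of each is below a power of the infimum by \<open>meet_power_le\<close>.\<close>

lemma one_generated_Int:
  assumes "one_generated K" "one_generated M" shows "one_generated (K \<inter> M)"
proof -
  obtain g h where gh: "g \<in> ratfun F" "h \<in> ratfun F" "K = kgen F {g}" "M = kgen F {h}"
    using assms by (auto simp: one_generated_def)
  have "rational (\<lambda>x. ab (g x) \<sqinter> ab (h x))"
    using gh by (intro rational_meet rational_ab ratfun_rational)
  then obtain m where m: "m \<in> ratfun F" "(\<lambda>x. ab (g x) \<sqinter> ab (h x)) \<simeq> m"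
    using rational_ratfun by blast
  have "1 \<sqsubseteq> ab (g x) \<sqinter> ab (h x)" for x by (simp add: meet_greatest)
  then have am: "ab (m x) \<approx> ab (g x) \<sqinter> ab (h x)" for x
    using ab_cong[OF spec[OF m(2)]] ab_pos by metis
  have "u \<in> K \<inter> M \<longleftrightarrow> u \<in> kgen F {m}" if u: "u \<in> ratfun F" for u
    unfolding gh Int_iff kgen_single_iff[OF gh(1) u] kgen_single_iff[OF gh(2) u] kgen_single_iff[OF m(1) u]
  proof safe
    fix N M assume *: "\<forall>x. ab (u x) \<sqsubseteq> ab (g x) ^ N" "\<forall>x. ab (u x) \<sqsubseteq> ab (h x) ^ M"
    have "ab (u x) \<sqsubseteq> ab (m x) ^ (N + M)" for x
    proof -
      have "ab (u x) \<sqsubseteq> ab (g x) ^ N \<sqinter> ab (h x) ^ M" using * by (simp add: meet_greatest)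
      also have "\<dots> \<sqsubseteq> (ab (g x) \<sqinter> ab (h x)) ^ (N + M)" by (intro meet_power_le) simp_all
      also have "\<dots> \<approx> ab (m x) ^ (N + M)" using am by (intro power_cong) simp
      finally show ?thesis .
    qed
    then show "\<exists>N. \<forall>x. ab (u x) \<sqsubseteq> ab (m x) ^ N" by blast
  next
    fix N assume *: "\<forall>x. ab (u x) \<sqsubseteq> ab (m x) ^ N"
    have "ab (m x) \<sqsubseteq> ab (g x)" "ab (m x) \<sqsubseteq> ab (h x)" for x
      using le_eqv_trans(2)[OF am meet_le(1)] le_eqv_trans(2)[OF am meet_le(2)] by auto
    then show "\<exists>N. \<forall>x. ab (u x) \<sqsubseteq> ab (g x) ^ N" "\<exists>N. \<forall>x. ab (u x) \<sqsubseteq> ab (h x) ^ N"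
      using * power_mono le_trans by blast+
  qed
  moreover have "K \<inter> M \<subseteq> ratfun F" "kgen F {m} \<subseteq> ratfun F"
    using one_generated_kern[OF assms(1)] kern_kgen[of "{m}"] m(1) kern_sub by auto
  ultimately have "K \<inter> M = kgen F {m}" by blast
  then show ?thesis using m(1) by (auto simp: one_generated_def)
qed

text \<open>The product of the two absolute values dominates both generators and lies in the kernel
  that they generate.\<close>

lemma one_generated_kprod:
  assumes "one_generated K" "one_generated M" shows "one_generated (kprod F K M)"
proof -
  obtain g h where gh: "g \<in> ratfun F" "h \<in> ratfun F" "K = kgen F {g}" "M = kgen F {h}"
    using assms by (auto simp: one_generated_def)
  have rat: "rational g" "rational h" using gh by (simp_all add: ratfun_rational)
  then have "rational (\<lambda>x. ab (g x) * ab (h x))" by (intro rational_mult rational_ab)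
  then obtain m where m: "m \<in> ratfun F" "(\<lambda>x. ab (g x) * ab (h x)) \<simeq> m"
    using rational_ratfun by blast
  have N: "kern (kgen F {m})" and GH: "kern (kgen F {g, h})" using m gh by (simp_all add: kern_kgen)
  have mm: "mem (kgen F {m}) (\<lambda>x. ab (g x) * ab (h x))"
    using kgen_sub m by (auto simp: mem_def)
  have "kgen F {g, h} = kgen F {m}"
  proof (intro equalityI kgen_least N GH)
    have "mem (kgen F {m}) g" "mem (kgen F {m}) h"
      by (auto intro!: mem_bound[OF N mm] rat le_mult_right le_mult_left)
    then show "{g, h} \<subseteq> kgen F {m}" using mem_iff[OF N] gh by auto
    have "mem (kgen F {g, h}) g" "mem (kgen F {g, h}) h" using kgen_sub by (blast intro: memI)+
    then have "mem (kgen F {g, h}) m"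
      by (intro mem_cong[OF mem_mult[OF GH mem_ab[OF GH] mem_ab[OF GH]] m(2)])
    then show "{m} \<subseteq> kgen F {g, h}" using mem_iff[OF GH m(1)] by simp
  qed
  moreover have "kprod F K M = kgen F {g, h}"
    using kprod_kgen[of "{g}" "{h}"] gh by (simp add: insert_commute)
  ultimately show ?thesis using m(1) by (auto simp: one_generated_def)
qed

subsection \<open>Laurent monomials\<close>

lemma power_star_cancel: "a ^ n * (a\<^sup>\<star>) ^ n \<approx> 1"
  by (induction n) (simp_all add: mult.assoc mult.left_commute[of _ "nu F (a\<^sup>\<star>)"])

text \<open>Allowing any representation of the exponent as a difference of naturals removes the sign
  distinction in \<open>zpow\<close> from the exponent laws.\<close>

lemma zpow_diff: "zpow F a (int m - int n) \<approx> a ^ m * (a\<^sup>\<star>) ^ n"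
proof (cases "n \<le> m")
  case True
  then have "a ^ m * (a\<^sup>\<star>) ^ n = a ^ (m - n) * (a ^ n * (a\<^sup>\<star>) ^ n)"
    by (simp flip: power_add mult.assoc)
  also have "\<dots> \<approx> a ^ (m - n)" using power_star_cancel[of a n] by (simp only: nu_mult nu_one_mult)
  finally show ?thesis using True by (simp add: zpow_def nat_diff_distrib)
next
  case False
  then have "a ^ m * (a\<^sup>\<star>) ^ n = (a\<^sup>\<star>) ^ (n - m) * (a ^ m * (a\<^sup>\<star>) ^ m)"
    by (simp add: mult.left_commute flip: power_add)
  also have "\<dots> \<approx> (a\<^sup>\<star>) ^ (n - m)" using power_star_cancel[of a m] by (simp only: nu_mult nu_one_mult)
  finally show ?thesis using False by (simp add: zpow_def nat_diff_distrib)
qed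

lemma zpow_nat [simp]: "zpow F a (int n) = a ^ n" "zpow F a 0 = 1" "zpow F a 1 = a"
  by (simp_all add: zpow_def)

lemma zpow_add: "zpow F a (j + k) \<approx> zpow F a j * zpow F a k"
proof -
  obtain m n m' n' where jk: "j = int m - int n" "k = int m' - int n'" by (metis int_diff_cases)
  have "j + k = int (m + m') - int (n + n')" by (simp add: jk)
  then have "zpow F a (j + k) \<approx> a ^ (m + m') * (a\<^sup>\<star>) ^ (n + n')" by (simp only: zpow_diff)
  also have "a ^ (m + m') * (a\<^sup>\<star>) ^ (n + n') = (a ^ m * (a\<^sup>\<star>) ^ n) * (a ^ m' * (a\<^sup>\<star>) ^ n')"
    by (simp add: power_add ac_simps)
  also have "\<dots> \<approx> zpow F a j * zpow F a k" unfolding jk using zpow_diff by (simp only: nu_mult)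
  finally show ?thesis .
qed

lemma zpow_cong: "a \<approx> b \<Longrightarrow> zpow F a k \<approx> zpow F b k"
  unfolding zpow_def by (auto intro: power_cong star_cong)

lemma zpow_mult_distrib: "zpow F (a * b) k \<approx> zpow F a k * zpow F b k"
proof -
  obtain m n where k: "k = int m - int n" by (metis int_diff_cases)
  have "zpow F (a * b) k \<approx> (a * b) ^ m * ((a * b)\<^sup>\<star>) ^ n" unfolding k by (rule zpow_diff)
  also have "\<dots> = nu F ((a * b) ^ m * (a\<^sup>\<star> * b\<^sup>\<star>) ^ n)"
    using power_cong[of "(a * b)\<^sup>\<star>" "a\<^sup>\<star> * b\<^sup>\<star>" n] by simp
  also have "(a * b) ^ m * (a\<^sup>\<star> * b\<^sup>\<star>) ^ n = (a ^ m * (a\<^sup>\<star>) ^ n) * (b ^ m * (b\<^sup>\<star>) ^ n)"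
    by (simp add: power_mult_distrib ac_simps)
  also have "\<dots> \<approx> zpow F a k * zpow F b k" unfolding k using zpow_diff by (simp only: nu_mult)
  finally show ?thesis .
qed

lemma zpow_one: "zpow F 1 k \<approx> 1"
  by (simp add: zpow_def star_one)

lemma zpow_minus: "zpow F a (- k) \<approx> (zpow F a k)\<^sup>\<star>"
  by (rule star_unique[symmetric]) (use zpow_add[of a k "- k"] in simp)

lemma zpow_minus_star: "zpow F a (- k) \<approx> zpow F (a\<^sup>\<star>) k"
proof -
  have "zpow F a k * zpow F (a\<^sup>\<star>) k \<approx> zpow F (a * a\<^sup>\<star>) k" by (rule zpow_mult_distrib[symmetric])
  also have "\<dots> = nu F (zpow F 1 k)" by (rule zpow_cong) simp
  also have "\<dots> = nu F (1)" by (rule zpow_one)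
  finally have "(zpow F a k)\<^sup>\<star> \<approx> zpow F (a\<^sup>\<star>) k" by (rule star_unique)
  with zpow_minus show ?thesis by simp
qed

lemma zpow_power: "zpow F (a ^ n) k \<approx> zpow F a (int n * k)"
proof (induction n)
  case 0 then show ?case by (simp add: zpow_one)
next
  case (Suc n)
  have "zpow F (a ^ Suc n) k \<approx> zpow F a k * zpow F (a ^ n) k" using zpow_mult_distrib[of a "a ^ n" k] by simp
  also have "\<dots> = nu F (zpow F a k * zpow F a (int n * k))" using Suc by simp
  also have "\<dots> = nu F (zpow F a (k + int n * k))" by (rule zpow_add[symmetric])
  finally show ?case by (simp add: distrib_right)
qed

lemma zpow_zpow: "zpow F (zpow F a j) k \<approx> zpow F a (j * k)"
proof (cases "j \<ge> 0")
  case True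
  then show ?thesis using zpow_power[of a "nat j" k] by (simp add: zpow_def[of F a j])
next
  case False
  have "zpow F (zpow F a j) k \<approx> zpow F (a\<^sup>\<star>) (- j * k)"
    using zpow_power[of "a\<^sup>\<star>" "nat (- j)" k] False by (simp add: zpow_def[of F a j])
  also have "\<dots> = nu F (zpow F a (j * k))" using zpow_minus_star[of a "- j * k"] by simp
  finally show ?thesis .
qed

lemma zpow_sum: "finite A \<Longrightarrow> zpow F a (sum f A) \<approx> (\<Prod>i\<in>A. zpow F a (f i))"
  by (induction rule: finite_induct) (simp_all add: zpow_add)

definition lmon :: "'a \<Rightarrow> ('n::finite \<Rightarrow> int) \<Rightarrow> ('n, 'a) fn" where
  "lmon c k = (\<lambda>x. c * power_prod (\<lambda>i. nat (k i)) x * (power_prod (\<lambda>i. nat (- k i)) x)\<^sup>\<star>)"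

lemma L_monomials_lmon: "L_monomials F = {lmon c k | c k. k \<noteq> (\<lambda>_. 0)}"
  by (simp add: L_monomials_def lmon_def)

lemma lmon_ratfun: "lmon c k \<in> ratfun F"
proof -
  have "[(c, \<lambda>i. nat (k i))] \<in> polys UNIV" "[(1, \<lambda>i. nat (- k i))] \<in> polys (tangible F)"
    by (auto simp: polys_def tangible_one)
  moreover have "lmon c k = (\<lambda>x. peval [(c, \<lambda>i. nat (k i))] x * (peval [(1, \<lambda>i. nat (- k i))] x)\<^sup>\<star>)"
    by (simp add: lmon_def)
  ultimately show ?thesis unfolding ratfun_def by blast
qed

lemma L_monomials_ratfun: "L_monomials F \<subseteq> ratfun F"
  by (auto simp: L_monomials_lmon lmon_ratfun)

lemma lmon_rational: "rational (lmon c k)"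
  by (simp add: lmon_ratfun ratfun_rational)

lemma lmon_eqv: "lmon c k x \<approx> c * (\<Prod>i\<in>UNIV. zpow F (x i) (k i))"
proof -
  let ?p = "\<lambda>i. x i ^ nat (k i)" and ?q = "\<lambda>i. x i ^ nat (- k i)"
  have "(prod ?q UNIV)\<^sup>\<star> \<approx> (\<Prod>i\<in>UNIV. (?q i)\<^sup>\<star>)" by (rule star_prod)
  also have "\<dots> = nu F (\<Prod>i\<in>UNIV. ((x i)\<^sup>\<star>) ^ nat (- k i))"
    by (rule prod_cong) (rule star_power)
  finally have "prod ?p UNIV * (prod ?q UNIV)\<^sup>\<star> \<approx> (\<Prod>i\<in>UNIV. ?p i * ((x i)\<^sup>\<star>) ^ nat (- k i))"
    by (simp add: prod.distrib)
  also have "\<dots> = nu F ((\<Prod>i\<in>UNIV. zpow F (x i) (k i)))"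
    by (rule prod_cong) (auto simp: zpow_def)
  finally show ?thesis by (simp add: lmon_def power_prod_def mult.assoc)
qed

lemma lmon_const: "lmon c (\<lambda>_. 0) = (\<lambda>_. c)"
  by (simp add: lmon_def star_one)

lemma lmon_mult: "lmon (c * d) (\<lambda>i. k i + l i) \<simeq> (\<lambda>x. lmon c k x * lmon d l x)"
proof
  fix x
  have "(\<Prod>i\<in>UNIV. zpow F (x i) (k i + l i)) \<approx> (\<Prod>i\<in>UNIV. zpow F (x i) (k i) * zpow F (x i) (l i))"
    by (rule prod_cong) (rule zpow_add)
  then show "lmon (c * d) (\<lambda>i. k i + l i) x \<approx> lmon c k x * lmon d l x"
    by (simp add: lmon_eqv prod.distrib ac_simps)
qed

lemma lmon_star: "lmon (c\<^sup>\<star>) (\<lambda>i. - k i) \<simeq> (\<lambda>x. (lmon c k x)\<^sup>\<star>)"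
proof
  fix x
  have "lmon (c * c\<^sup>\<star>) (\<lambda>i. k i + - k i) x \<approx> lmon c k x * lmon (c\<^sup>\<star>) (\<lambda>i. - k i) x"
    using lmon_mult[of c "c\<^sup>\<star>" k "\<lambda>i. - k i"] by blast
  then have "lmon c k x * lmon (c\<^sup>\<star>) (\<lambda>i. - k i) x \<approx> 1" by (simp add: lmon_const)
  then show "lmon (c\<^sup>\<star>) (\<lambda>i. - k i) x \<approx> (lmon c k x)\<^sup>\<star>" by (rule star_unique[symmetric])
qed

lemma lmon_power: "lmon (c ^ N) (\<lambda>i. int N * k i) \<simeq> (\<lambda>x. lmon c k x ^ N)"
proof (induction N)
  case 0 then show ?case by (simp add: lmon_const)
next
  case (Suc N)
  have "lmon (c ^ Suc N) (\<lambda>i. int (Suc N) * k i) = lmon (c * c ^ N) (\<lambda>i. k i + int N * k i)"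
    by (simp add: distrib_right)
  then show ?case using lmon_mult[of c "c ^ N" k "\<lambda>i. int N * k i"] Suc by simp
qed

lemma lmon_coeff: "lmon (c * d) k \<simeq> (\<lambda>x. c * lmon d k x)"
  by (simp add: lmon_eqv mult.assoc)

lemma lmon_coeff_cong: "c \<approx> d \<Longrightarrow> lmon c k \<simeq> lmon d k"
  by (simp add: lmon_eqv)

text \<open>The point with multiplicative parameter \<open>h\<close> on the line through
  \<open>x\<close> in direction \<open>v\<close>. Along it a monomial changes by a power of
  \<open>h\<close> whose exponent is the scalar product with \<open>v\<close>.\<close>

definition shift :: "'a \<Rightarrow> ('n \<Rightarrow> int) \<Rightarrow> ('n \<Rightarrow> 'a) \<Rightarrow> 'n \<Rightarrow> 'a" where
  "shift h v x = (\<lambda>i. x i * zpow F h (v i))"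

lemma lmon_shift: "lmon c k (shift h v x) \<approx> lmon c k x * zpow F h (\<Sum>i\<in>UNIV. v i * k i)"
proof -
  have "(\<Prod>i\<in>UNIV. zpow F (x i * zpow F h (v i)) (k i)) \<approx>
      (\<Prod>i\<in>UNIV. zpow F (x i) (k i) * zpow F h (v i * k i))"
    by (rule prod_cong) (simp add: zpow_mult_distrib zpow_zpow)
  also have "\<dots> = nu F ((\<Prod>i\<in>UNIV. zpow F (x i) (k i)) * zpow F h (\<Sum>i\<in>UNIV. v i * k i))"
    using zpow_sum[of UNIV h "\<lambda>i. v i * k i"] by (simp add: prod.distrib)
  finally show ?thesis by (simp add: shift_def lmon_eqv mult.assoc)
qed

lemma mem_lmon_quotient:
  assumes "kern K" "mem K (lmon c k)" "mem K (lmon d k)"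
  shows "mem K (\<lambda>_. c * d\<^sup>\<star>)"
proof -
  have "mem K (\<lambda>x. lmon c k x * (lmon d k x)\<^sup>\<star>)" using assms by (intro mem_mult mem_star)
  moreover have "(\<lambda>x. lmon c k x * (lmon d k x)\<^sup>\<star>) \<simeq> (\<lambda>_. c * d\<^sup>\<star>)"
  proof
    fix x
    have "lmon (c * d\<^sup>\<star>) (\<lambda>i. k i + - k i) x \<approx> lmon c k x * lmon (d\<^sup>\<star>) (\<lambda>i. - k i) x"
      using lmon_mult[of c "d\<^sup>\<star>" k "\<lambda>i. - k i"] by blast
    then show "lmon c k x * (lmon d k x)\<^sup>\<star> \<approx> c * d\<^sup>\<star>"
      using lmon_star[of d k] by (simp add: lmon_const)
  qed
  ultimately show ?thesis by (rule mem_cong)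
qed

subsection \<open>Kernels in the lattice generated by the HP-kernels\<close>

definition hs_gens :: "('n::finite, 'a) fn set \<Rightarrow> bool" where
  "hs_gens S \<longleftrightarrow> finite S \<and> S \<noteq> {} \<and> S \<subseteq> L_monomials F"

lemma hs_gens_ratfun: "hs_gens S \<Longrightarrow> S \<subseteq> ratfun F"
  using L_monomials_ratfun by (auto simp: hs_gens_def)

text \<open>A normal form for \<open>Omega F\<close>: finite intersections of kernels generated by
  finitely many monomials, products having been pushed inside.\<close>

inductive_set hs_meets :: "('n::finite, 'a) fn set set" where
  base: "hs_gens S \<Longrightarrow> kgen F S \<in> hs_meets"
| Int: "K \<in> hs_meets \<Longrightarrow> M \<in> hs_meets \<Longrightarrow> K \<inter> M \<in> hs_meets"

lemma hs_meets_kern: "K \<in> hs_meets \<Longrightarrow> kern K"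
  by (induction rule: hs_meets.induct) (auto simp: kern_Int kern_kgen hs_gens_ratfun)

lemma hs_meets_kprod_base:
  "K \<in> hs_meets \<Longrightarrow> hs_gens S \<Longrightarrow> kprod F K (kgen F S) \<in> hs_meets"
proof (induction rule: hs_meets.induct)
  case (base T)
  then have "hs_gens (T \<union> S)" by (auto simp: hs_gens_def)
  then show ?case using base by (simp add: kprod_kgen hs_gens_ratfun hs_meets.base)
next
  case (Int K M)
  then show ?case by (simp add: kprod_Int_distrib hs_meets_kern kern_kgen hs_gens_ratfun hs_meets.Int)
qed

lemma hs_meets_kprod: "M \<in> hs_meets \<Longrightarrow> K \<in> hs_meets \<Longrightarrow> kprod F M K \<in> hs_meets"
proof (induction rule: hs_meets.induct)
  case (base S)
  then show ?case
    using hs_meets_kprod_base[of K S] kprod_commute[of K "kgen F S"]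
    by (simp add: hs_meets_kern kern_kgen hs_gens_ratfun)
next
  case (Int M M')
  then show ?case by (simp add: kprod_Int_distrib hs_meets_kern hs_meets.Int)
qed

lemma Omega_hs_meets: "K \<in> Omega F \<Longrightarrow> K \<in> hs_meets"
proof (induction rule: Omega.induct)
  case (HP K)
  then show ?case by (auto simp: HP_kernel_def hs_gens_def intro!: hs_meets.base)
qed (auto intro: hs_meets.Int hs_meets_kprod)

lemma kgen_Omega: "hs_gens S \<Longrightarrow> kgen F S \<in> Omega F"
proof -
  have "finite S \<Longrightarrow> S \<noteq> {} \<Longrightarrow> S \<subseteq> L_monomials F \<Longrightarrow> kgen F S \<in> Omega F"
  proof (induction rule: finite_ne_induct)
    case (singleton m)
    then show ?case by (auto simp: HP_kernel_def intro!: Omega.HP)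
  next
    case (insert m S)
    have "kgen F {m} \<in> Omega F" using insert by (auto simp: HP_kernel_def intro!: Omega.HP)
    with insert have "kprod F (kgen F {m}) (kgen F S) \<in> Omega F" by (auto intro: Omega.Prod)
    moreover have "kprod F (kgen F {m}) (kgen F S) = kgen F (insert m S)"
      using kprod_kgen[of "{m}" S] insert L_monomials_ratfun by auto
    ultimately show ?case by simp
  qed
  then show "hs_gens S \<Longrightarrow> kgen F S \<in> Omega F" by (auto simp: hs_gens_def)
qed

lemma hs_meets_Omega: "K \<in> hs_meets \<Longrightarrow> K \<in> Omega F"
  by (induction rule: hs_meets.induct) (auto intro: kgen_Omega Omega.Int)

lemma Omega_one_generated: "K \<in> Omega F \<Longrightarrow> one_generated K"
proof (induction rule: Omega.induct)
  case (HP K)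
  then show ?case using L_monomials_ratfun by (auto simp: HP_kernel_def one_generated_def)
qed (auto intro: one_generated_Int one_generated_kprod)

text \<open>Members of \<open>Omega F\<close> are principal and have the normal form
  \<open>hs_meets\<close>, so reducibility can be tested on the latter without naming
  generators.\<close>

lemma reducible_iff:
  "reducible F L \<longleftrightarrow> (\<exists>K\<in>hs_meets. \<exists>M\<in>hs_meets. \<not> K \<subseteq> L \<and> \<not> M \<subseteq> L \<and> K \<inter> M \<subseteq> L)"
proof
  assume "reducible F L"
  then show "\<exists>K\<in>hs_meets. \<exists>M\<in>hs_meets. \<not> K \<subseteq> L \<and> \<not> M \<subseteq> L \<and> K \<inter> M \<subseteq> L"
    unfolding reducible_def using Omega_hs_meets by blast
next
  assume "\<exists>K\<in>hs_meets. \<exists>M\<in>hs_meets. \<not> K \<subseteq> L \<and> \<not> M \<subseteq> L \<and> K \<inter> M \<subseteq> L"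
  then obtain K M where *: "K \<in> hs_meets" "M \<in> hs_meets" "\<not> K \<subseteq> L \<and> \<not> M \<subseteq> L \<and> K \<inter> M \<subseteq> L" by blast
  from * obtain g h where "g \<in> ratfun F" "K = kgen F {g}" "h \<in> ratfun F" "M = kgen F {h}"
    using Omega_one_generated hs_meets_Omega unfolding one_generated_def by meson
  with * show "reducible F L" unfolding reducible_def
    using hs_meets_Omega by blast
qed

lemma HSpec_iff: "L \<in> HSpec F \<longleftrightarrow> L \<in> hs_meets \<and> \<not> reducible F L"
  unfolding HSpec_def using Omega_one_generated[of L] hs_meets_Omega[of L] Omega_hs_meets[of L]
  by (auto simp: one_generated_def)

text \<open>Whenever an intersection lies in the irreducible \<open>L\<close>, one of its members
  does. Descending through the normal form of \<open>K\<close> with \<open>K \<subseteq> L\<close>,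
  a finitely generated kernel is found between \<open>K\<close> and \<open>L\<close>; the choice
  \<open>K = L\<close> finishes.\<close>

lemma HSpec_gens:
  assumes "L \<in> HSpec F" shows "\<exists>S. hs_gens S \<and> L = kgen F S"
proof -
  have L: "L \<in> hs_meets" "\<not> reducible F L" using assms by (auto simp: HSpec_iff)
  have "K \<in> hs_meets \<Longrightarrow> K \<subseteq> L \<Longrightarrow> \<exists>S. hs_gens S \<and> K \<subseteq> kgen F S \<and> kgen F S \<subseteq> L" for K
  proof (induction rule: hs_meets.induct)
    case (Int K M)
    then have "K \<subseteq> L \<or> M \<subseteq> L" using L(2) unfolding reducible_iff by blast
    then show ?case using Int by blast
  qed auto
  from this[OF L(1)] show ?thesis by blast
qed

text \<open>If \<open>c \<sqinter> d \<approx> 1\<close> then \<open>\<bar>cm\<bar> \<sqinter> \<bar>dm\<bar> \<sqsubseteq> \<bar>m\<bar>\<close> for a monomial \<open>m\<close> of \<open>L\<close>, so irreducibility puts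
  \<open>cm\<close> or \<open>dm\<close>, hence \<open>c\<close> or \<open>d\<close>, into \<open>L\<close>.\<close>

lemma HSpec_total:
  assumes L: "L \<in> HSpec F" and nc: "\<And>c. (\<lambda>_. c) \<in> L \<Longrightarrow> c \<approx> 1"
  shows "a \<sqsubseteq> b \<or> b \<sqsubseteq> a"
proof -
  obtain S where S: "hs_gens S" "L = kgen F S" using HSpec_gens[OF L] by blast
  then obtain c0 k where m: "lmon c0 k \<in> S" "k \<noteq> (\<lambda>_. 0)"
    by (force simp: hs_gens_def L_monomials_lmon)
  have LK: "kern L" using S by (simp add: kern_kgen hs_gens_ratfun)
  have memL: "mem L (lmon c0 k)" using S m kgen_sub by (blast intro: memI)
  \<comment> \<open>Dividing \<open>a\<close> and \<open>b\<close> by their infimum makes them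
    orthogonal elements above 1; \<open>a\<close> and \<open>b\<close> are comparable as soon as
    \<open>c\<close> or \<open>d\<close> is trivial.\<close>
  define c d where "c = a * (a \<sqinter> b)\<^sup>\<star>" and "d = b * (a \<sqinter> b)\<^sup>\<star>"
  have "(a \<sqinter> b) * (a \<sqinter> b)\<^sup>\<star> \<sqsubseteq> c" "(a \<sqinter> b) * (a \<sqinter> b)\<^sup>\<star> \<sqsubseteq> d"
    unfolding c_def d_def by (intro mult_right_mono meet_le)+
  then have ge: "1 \<sqsubseteq> c" "1 \<sqsubseteq> d" by (simp_all add: le_def)
  have cd: "c \<sqinter> d \<sqsubseteq> 1"
    using meet_mult_le[of a "(a \<sqinter> b)\<^sup>\<star>" b] by (simp add: c_def d_def le_def)
  let ?H = "\<lambda>e. kgen F {lmon (e * c0) k}"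
  have H: "hs_gens {lmon (e * c0) k}" for e using m by (auto simp: hs_gens_def L_monomials_lmon)
  have Hk: "kern (?H e)" for e using kern_kgen[OF hs_gens_ratfun[OF H]] .
  have Lh: "L \<in> hs_meets" using L by (simp add: HSpec_iff)
  have hm: "kprod F (?H e) L \<in> hs_meets" for e
    using H Lh by (intro hs_meets_kprod hs_meets.base)
  have bound: "ab (lmon (e * c0) k x) \<sqsubseteq> e * ab (lmon c0 k x)" if "1 \<sqsubseteq> e" for e x
  proof -
    have "ab (lmon (e * c0) k x) \<approx> ab (e * lmon c0 k x)"
      using lmon_coeff[of e c0 k] by (intro ab_cong) blast
    then have "ab (lmon (e * c0) k x) \<sqsubseteq> ab e * ab (lmon c0 k x)" using ab_mult by (rule le_eqv_trans)
    then show ?thesis using ab_pos[OF that] by (simp add: le_def)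
  qed
  have "u \<in> L" if u: "u \<in> ?H c \<inter> ?H d" for u
  proof -
    have ru: "u \<in> ratfun F" using u kern_sub[OF Hk] by blast
    obtain N where N: "\<And>x. ab (u x) \<sqsubseteq> ab (lmon (c * c0) k x) ^ N"
      using u kgen_single_iff[OF lmon_ratfun ru] by blast
    obtain M where M: "\<And>x. ab (u x) \<sqsubseteq> ab (lmon (d * c0) k x) ^ M"
      using u kgen_single_iff[OF lmon_ratfun ru] by blast
    have "mem L u"
    proof (rule mem_bound[OF LK mem_power[OF LK mem_ab[OF LK memL]] ratfun_rational[OF ru]])
      fix x
      let ?p = "ab (lmon (c * c0) k x)" and ?q = "ab (lmon (d * c0) k x)" and ?m = "ab (lmon c0 k x)"
      have "?p \<sqinter> ?q \<sqsubseteq> c * ?m \<sqinter> d * ?m"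
        using bound[OF ge(1), of x] bound[OF ge(2), of x] le_trans[OF meet_le(1)] le_trans[OF meet_le(2)]
        by (intro meet_greatest) blast+
      also have "\<dots> \<sqsubseteq> (c \<sqinter> d) * ?m" by (rule meet_mult_le)
      also have "\<dots> \<sqsubseteq> 1 * ?m" by (rule mult_right_mono[OF cd])
      finally have "?p \<sqinter> ?q \<sqsubseteq> ?m" by simp
      have "ab (u x) \<sqsubseteq> ?p ^ N \<sqinter> ?q ^ M" using N M by (intro meet_greatest)
      also have "\<dots> \<sqsubseteq> (?p \<sqinter> ?q) ^ (N + M)" by (intro meet_power_le) simp_all
      also have "\<dots> \<sqsubseteq> ?m ^ (N + M)" by (rule power_mono) fact
      finally show "ab (u x) \<sqsubseteq> ?m ^ (N + M)" .
    qed
    then show ?thesis using mem_iff[OF LK ru] by simp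
  qed
  then have "?H c \<inter> ?H d \<subseteq> L" by blast
  then have "kprod F (?H c \<inter> ?H d) L \<subseteq> L" using LK by (intro kprod_least) auto
  then have "kprod F (?H c) L \<inter> kprod F (?H d) L \<subseteq> L"
    using kprod_Int_distrib[OF Hk Hk LK] by simp
  then have "kprod F (?H c) L \<subseteq> L \<or> kprod F (?H d) L \<subseteq> L"
    using L hm unfolding HSpec_iff reducible_iff by blast
  then have "?H c \<subseteq> L \<or> ?H d \<subseteq> L"
    using kprod_upper(1)[OF Hk LK] by blast
  then have "lmon (c * c0) k \<in> L \<or> lmon (d * c0) k \<in> L"
    using kgen_sub by blast
  moreover have "e \<approx> 1" if e: "lmon (e * c0) k \<in> L" for e
  proof -
    have "mem L (\<lambda>_. e * c0 * c0\<^sup>\<star>)" by (rule mem_lmon_quotient[OF LK memI[OF e] memL])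
    then have "mem L (\<lambda>_. e)" by (rule mem_cong) (simp add: mult.assoc)
    then show ?thesis using nc mem_iff[OF LK const_ratfun] by blast
  qed
  ultimately have "c \<approx> 1 \<or> d \<approx> 1" by blast
  then show ?thesis
  proof
    assume "c \<approx> 1"
    then have "c * (a \<sqinter> b) \<approx> a \<sqinter> b" by simp
    then have "a \<approx> a \<sqinter> b" by (simp add: c_def mult.assoc)
    then show ?thesis using le_eqv_trans(2)[OF _ meet_le(2)] by blast
  next
    assume "d \<approx> 1"
    then have "d * (a \<sqinter> b) \<approx> a \<sqinter> b" by simp
    then have "b \<approx> a \<sqinter> b" by (simp add: d_def mult.assoc)
    then show ?thesis using le_eqv_trans(2)[OF _ meet_le(1)] by blast
  qed
qed

end

subsection \<open>Integral exponent vectors\<close>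

definition ratvec :: "('n::finite \<Rightarrow> int) \<Rightarrow> rat ^ 'n" where
  "ratvec k = (\<chi> i. of_int (k i))"

lemma clear_denominators: "\<exists>N\<ge>1. \<exists>k. ratvec k = of_nat N *s (w :: rat ^ 'n::finite)"
proof -
  define a where "a i = fst (quotient_of (w $ i))" for i
  define b where "b i = snd (quotient_of (w $ i))" for i
  have b: "b i > 0" for i unfolding b_def by (rule quotient_of_denom_pos')
  have w: "w $ i = of_int (a i) / of_int (b i)" for i
    unfolding a_def b_def by (simp add: quotient_of_div)
  define N where "N = nat (prod b UNIV)"
  have pos: "prod b UNIV > 0" using b by (simp add: prod_pos)
  define k where "k i = a i * (prod b UNIV div b i)" for i
  have "of_int (k i) = of_nat N * w $ i" for i
  proof -
    have "b i dvd prod b UNIV" by (rule dvd_prodI) auto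
    then obtain c where c: "prod b UNIV = b i * c" by blast
    have "of_nat N = (of_int (prod b UNIV) :: rat)" using pos by (simp add: N_def)
    then show ?thesis using b[of i] by (simp add: k_def w c)
  qed
  then have "ratvec k = of_nat N *s w" by (simp add: ratvec_def vec_eq_iff)
  moreover have "N \<ge> 1" using pos by (simp add: N_def)
  ultimately show ?thesis by blast
qed

text \<open>Provides the direction of a line along which monomials with exponents in
  \<open>E\<close> are constant while the one with exponent \<open>k\<close> grows. It is a normal
  vector of the rational span, with denominators cleared.\<close>

lemma separating_exponent:
  assumes "ratvec k \<notin> vec.span E"
  shows "\<exists>v. (\<Sum>i\<in>UNIV. v i * k i) > 0 \<and> (\<forall>l. ratvec l \<in> E \<longrightarrow> (\<Sum>i\<in>UNIV. v i * l i) = 0)"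
proof -
  obtain B where B: "B \<subseteq> E" "vec.independent B" "E \<subseteq> vec.span B"
    using vec.maximal_independent_subset by blast
  have k: "ratvec k \<notin> vec.span B" using assms vec.span_mono[OF B(1)] by blast
  then have "vec.independent (insert (ratvec k) B)" using B(2) by (rule vec.independent_insertI)
  from vec.linear_independent_extend[OF this, of "\<lambda>x. if x = ratvec k then 1 else 0"]
  obtain g :: "rat ^ 'a \<Rightarrow> rat ^ 'a" where g: "Vector_Spaces.linear (*s) (*s) g"
    "\<forall>x\<in>insert (ratvec k) B. g x = (if x = ratvec k then 1 else 0)" by blast
  have gB: "g x = 0" if "x \<in> B" for x
    using that g(2) k vec.span_base[of x B] by auto
  have gE: "g x = 0" if "x \<in> E" for x
    using vec.linear_eq_0_on_span[OF g(1) gB] B(3) that by blast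
  define A where "A = matrix g"
  have A: "A *v x = g x" for x unfolding A_def by (rule matrix_works[OF g(1)])
  \<comment> \<open>Any row of the matrix will do: \<open>g\<close> sends \<open>ratvec k\<close> to
    the vector with all entries 1 and kills \<open>E\<close>.\<close>
  obtain i0 :: 'a where True by simp
  define w where "w = A $ i0"
  have row: "(\<Sum>i\<in>UNIV. w $ i * x $ i) = g x $ i0" for x
    by (simp add: w_def matrix_vector_mult_def flip: A)
  obtain N v where N: "N \<ge> 1" "ratvec v = of_nat N *s w" using clear_denominators by blast
  have v: "of_int (v i) = of_nat N * w $ i" for i
    using N(2) by (simp add: ratvec_def vec_eq_iff)
  have dot: "of_int (\<Sum>i\<in>UNIV. v i * l i) = of_nat N * g (ratvec l) $ i0" for l
    unfolding row[symmetric] by (simp add: v ratvec_def sum_distrib_left mult.assoc)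
  have "of_int (\<Sum>i\<in>UNIV. v i * k i) = (of_nat N :: rat)"
    unfolding dot using g(2) by simp
  then have "(\<Sum>i\<in>UNIV. v i * k i) > 0" using N(1) by (metis of_int_of_nat_eq of_int_eq_iff of_nat_0_less_iff less_le_trans zero_less_one)
  moreover have "(\<Sum>i\<in>UNIV. v i * l i) = 0" if "ratvec l \<in> E" for l
  proof -
    have "of_int (\<Sum>i\<in>UNIV. v i * l i) = (0 :: rat)" unfolding dot using gE[OF that] by simp
    then show ?thesis by (simp only: of_int_eq_0_iff)
  qed
  ultimately show ?thesis by blast
qed

section \<open>Exponent vectors and convex dependence\<close>

context div_semifield
begin

text \<open>A function might be written as a monomial in several ways, so one exponent vector is
  chosen; \<open>expo_lmon\<close> supplies the coefficient that goes with it.\<close>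

definition expo :: "('n::finite, 'a) fn \<Rightarrow> rat ^ 'n" where
  "expo m = ratvec (SOME k. \<exists>c. m = lmon c k)"

lemma expo_lmon: "m \<in> L_monomials F \<Longrightarrow> \<exists>c k. m = lmon c k \<and> expo m = ratvec k"
proof -
  assume "m \<in> L_monomials F"
  then have "\<exists>k c. m = lmon c k" by (auto simp: L_monomials_lmon)
  then have "\<exists>c. m = lmon c (SOME k. \<exists>c. m = lmon c k)" by (rule someI_ex)
  then show ?thesis by (auto simp: expo_def)
qed

definition exponents :: "('n::finite, 'a) fn set \<Rightarrow> ('n \<Rightarrow> int) set" where
  "exponents K = {k. \<exists>c. mem K (lmon c k)}"

lemma root_exists: "n \<ge> 1 \<Longrightarrow> \<exists>b. b ^ n = (a :: 'a)"
  using divisible unfolding nu_divisible_def by blast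

context
  fixes K :: "('n::finite, 'a) fn set" assumes K: "kern K"
begin

lemma exponents_zero: "(\<lambda>_. 0) \<in> exponents K"
  using mem_one[OF K] unfolding exponents_def by (auto simp: lmon_const intro!: exI[of _ 1])

lemma exponents_add: "k \<in> exponents K \<Longrightarrow> l \<in> exponents K \<Longrightarrow> (\<lambda>i. k i + l i) \<in> exponents K"
  unfolding exponents_def using mem_cong[OF mem_mult[OF K] feq_sym[OF lmon_mult]] by blast

lemma exponents_minus: "k \<in> exponents K \<Longrightarrow> (\<lambda>i. - k i) \<in> exponents K"
  unfolding exponents_def using mem_cong[OF mem_star[OF K] feq_sym[OF lmon_star]] by blast

lemma exponents_nat: "k \<in> exponents K \<Longrightarrow> (\<lambda>i. int N * k i) \<in> exponents K"
  unfolding exponents_def using mem_cong[OF mem_power[OF K] feq_sym[OF lmon_power]] by blast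

lemma exponents_int: "k \<in> exponents K \<Longrightarrow> (\<lambda>i. z * k i) \<in> exponents K"
proof (cases "z \<ge> 0")
  case True
  then show "k \<in> exponents K \<Longrightarrow> ?thesis" using exponents_nat[of k "nat z"] by simp
next
  case False
  then show "k \<in> exponents K \<Longrightarrow> ?thesis"
    using exponents_minus[OF exponents_nat[of k "nat (- z)"]] by simp
qed

text \<open>Divisibility supplies an \<open>N\<close>-th root of the coefficient, and
  \<open>mem_root\<close> an \<open>N\<close>-th root of the monomial inside the kernel. So the
  exponents are the integral points of a rational subspace.\<close>

lemma exponents_root: "(\<lambda>i. int N * k i) \<in> exponents K \<Longrightarrow> N \<ge> 1 \<Longrightarrow> k \<in> exponents K"
proof -
  assume "(\<lambda>i. int N * k i) \<in> exponents K" and N: "N \<ge> 1"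
  then obtain c where c: "mem K (lmon c (\<lambda>i. int N * k i))" by (auto simp: exponents_def)
  obtain d where "d ^ N = c" using root_exists[OF N] by blast
  then have "mem K (\<lambda>x. lmon d k x ^ N)" using c mem_cong[OF _ lmon_power] by blast
  then have "mem K (lmon d k)" by (rule mem_root[OF K _ N lmon_rational])
  then show ?thesis by (auto simp: exponents_def)
qed

lemma span_exponents:
  assumes S: "S \<subseteq> L_monomials F" "S \<subseteq> K" and k: "ratvec k \<in> vec.span (expo ` S)"
  shows "k \<in> exponents K"
proof -
  let ?W = "{w. \<exists>N\<ge>1. \<exists>k\<in>exponents K. ratvec k = of_nat N *s w}"
  have "vec.subspace ?W"
  proof (rule vec.subspaceI)
    show "0 \<in> ?W" using exponents_zero
      by (auto simp: ratvec_def vec_eq_iff intro!: exI[of _ 1] bexI[of _ "\<lambda>_. 0"])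
  next
    fix v w assume "v \<in> ?W" "w \<in> ?W"
    then obtain N M k l where *: "N \<ge> 1" "M \<ge> 1" "k \<in> exponents K" "l \<in> exponents K"
      "ratvec k = of_nat N *s v" "ratvec l = of_nat M *s w" by blast
    have "(\<lambda>i. int M * k i + int N * l i) \<in> exponents K"
      using * by (intro exponents_add exponents_nat)
    moreover have "ratvec (\<lambda>i. int M * k i + int N * l i) = of_nat (N * M) *s (v + w)"
      using *(5,6) by (simp add: ratvec_def vec_eq_iff algebra_simps)
    moreover have "N * M \<ge> 1" using * by simp
    ultimately show "v + w \<in> ?W" by blast
  next
    fix c :: rat and w assume "w \<in> ?W"
    then obtain N k where *: "N \<ge> 1" "k \<in> exponents K" "ratvec k = of_nat N *s w" by blast
    define p q where "p = fst (quotient_of c)" and "q = snd (quotient_of c)"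
    have q: "q > 0" unfolding q_def by (rule quotient_of_denom_pos')
    have c: "c = of_int p / of_int q" unfolding p_def q_def by (simp add: quotient_of_div)
    have "(\<lambda>i. p * k i) \<in> exponents K" using * by (intro exponents_int)
    moreover have "ratvec (\<lambda>i. p * k i) = of_nat (nat q * N) *s (c *s w)"
      using *(3) q by (simp add: ratvec_def vec_eq_iff c)
    moreover have "nat q * N \<ge> 1" using * q by simp
    ultimately show "c *s w \<in> ?W" by blast
  qed
  moreover have "expo ` S \<subseteq> ?W"
  proof
    fix w assume "w \<in> expo ` S"
    then obtain m where m: "m \<in> S" "w = expo m" by blast
    obtain c k where ck: "m = lmon c k" "expo m = ratvec k" using m S expo_lmon by blast
    then have "k \<in> exponents K" using m S by (auto simp: exponents_def intro!: exI[of _ c] memI)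
    then show "w \<in> ?W" using m ck by (auto intro!: exI[of _ 1] bexI[of _ k])
  qed
  ultimately have "ratvec k \<in> ?W" using vec.span_minimal k by blast
  then obtain N l where N: "N \<ge> 1" "l \<in> exponents K" "ratvec l = of_nat N *s ratvec k" by blast
  have "l = (\<lambda>i. int N * k i)"
  proof
    fix i
    have "of_int (l i) = (of_int (int N * k i) :: rat)" using N(3) by (simp add: ratvec_def vec_eq_iff)
    then show "l i = int N * k i" by (simp only: of_int_eq_iff)
  qed
  then show ?thesis using N exponents_root by blast
qed

end

lemma coeff_unique:
  assumes "kern K" "\<And>c. (\<lambda>_. c) \<in> K \<Longrightarrow> c \<approx> 1" "mem K (lmon c k)" "mem K (lmon d k)"
  shows "c \<approx> d"
proof -
  have "(\<lambda>_. c * d\<^sup>\<star>) \<in> K"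
    using mem_lmon_quotient[OF assms(1,3,4)] mem_iff[OF assms(1) const_ratfun] by blast
  then have "c * d\<^sup>\<star> \<approx> 1" by (rule assms(2))
  then have "c * d\<^sup>\<star> \<approx> d * d\<^sup>\<star>" by simp
  then show ?thesis by (rule eqv_cancel)
qed

text \<open>\<open>span_exponents\<close> yields a monomial of \<open>K\<close> with the exponents
  of \<open>m\<close> but an unknown coefficient. Uniqueness of coefficients in the larger kernel
  \<open>L\<close> identifies it with \<open>m\<close>.\<close>

lemma span_absorb:
  assumes K: "kern K" and L: "kern L" "\<And>c. (\<lambda>_. c) \<in> L \<Longrightarrow> c \<approx> 1" and sub: "K \<subseteq> L"
    and S: "S \<subseteq> L_monomials F" "S \<subseteq> K"
    and m: "m \<in> L_monomials F" "m \<in> L" "expo m \<in> vec.span (expo ` S)"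
  shows "m \<in> K"
proof -
  obtain c k where ck: "m = lmon c k" "expo m = ratvec k" using m expo_lmon by blast
  then have "k \<in> exponents K" using span_exponents[OF K S] m by simp
  then obtain d where d: "mem K (lmon d k)" by (auto simp: exponents_def)
  have "d \<approx> c" by (rule coeff_unique[OF L mem_mono[OF sub d]]) (use m ck in \<open>auto intro: memI\<close>)
  then have "mem K m" using mem_cong[OF d lmon_coeff_cong] ck by blast
  then show ?thesis using mem_iff[OF K] m L_monomials_ratfun by blast
qed

lemma constants_ratfun: "constants \<subseteq> ratfun F"
  by (auto simp: constants_def const_ratfun)

text \<open>The constants are included among the generators so that the result serves both for
  \<open>kgen F S\<close> and for its product with the kernel of constants.\<close>

lemma lmon_span:
  assumes nt: "\<exists>h. \<not> h \<approx> 1" and S: "S \<subseteq> L_monomials F"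
    and m: "mem (kgen F (S \<union> constants)) (lmon c k)"
  shows "ratvec k \<in> vec.span (expo ` S)"
proof (rule ccontr)
  assume "ratvec k \<notin> vec.span (expo ` S)"
  then obtain v where v: "(\<Sum>i\<in>UNIV. v i * k i) > 0"
    "\<And>l. ratvec l \<in> expo ` S \<Longrightarrow> (\<Sum>i\<in>UNIV. v i * l i) = 0"
    using separating_exponent[of k "expo ` S"] by blast
  define q where "q = (\<Sum>i\<in>UNIV. v i * k i)"
  \<comment> \<open>The functions bounded along every line in direction \<open>v\<close> form a kernel containing
    \<open>S\<close> and the constants, but the monomial with exponent \<open>k\<close> is unbounded there.\<close>
  let ?W = "{w :: ('b, 'a) fn. (\<forall>x. 1 \<sqsubseteq> w x) \<and> (\<forall>h x. w (shift h v x) \<approx> w x)}"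
  let ?B = "{u \<in> ratfun F. \<exists>w\<in>?W. \<forall>x. ab (u x) \<sqsubseteq> w x}"
  have "kern ?B"
    by (rule kern_bounded) (auto intro: one_le_mult)
  moreover have "S \<subseteq> ?B"
  proof
    fix s assume s: "s \<in> S"
    then obtain d l where dl: "s = lmon d l" "expo s = ratvec l" using S expo_lmon by blast
    have "(\<lambda>x. ab (s x)) \<in> ?W"
    proof (intro CollectI conjI allI)
      fix h x
      have "ratvec l \<in> expo ` S" using s dl by force
      then show "ab (s (shift h v x)) \<approx> ab (s x)"
        using lmon_shift[of d l h v x] v(2)[of l] dl(1) by (intro ab_cong) simp
    qed simp
    then have "\<exists>w\<in>?W. \<forall>x. ab (s x) \<sqsubseteq> w x" by (rule bexI[rotated]) simp
    then show "s \<in> ?B" using s S L_monomials_ratfun by blast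
  qed
  moreover have "constants \<subseteq> ?B"
  proof
    fix s :: "('b, 'a) fn" assume s: "s \<in> constants"
    then obtain d where d: "s = (\<lambda>_. d)" by (auto simp: constants_def)
    have "(\<lambda>_. ab d) \<in> ?W" by simp
    then have "\<exists>w\<in>?W. \<forall>x. ab (s x) \<sqsubseteq> w x" by (rule bexI[rotated]) (simp add: d)
    then show "s \<in> ?B" using s constants_ratfun by blast
  qed
  ultimately have "kgen F (S \<union> constants) \<subseteq> ?B" by (intro kgen_least) auto
  then have "mem ?B (lmon c k)" using m by (rule mem_mono)
  then have "lmon c k \<in> ?B" using mem_iff[OF \<open>kern ?B\<close> lmon_ratfun] by simp
  then obtain w where w: "w \<in> ?W" "\<And>x. ab (lmon c k x) \<sqsubseteq> w x" by blast
  define x0 :: "'b \<Rightarrow> 'a" where "x0 = (\<lambda>_. 1)"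
  \<comment> \<open>Dividing the bound at \<open>x0\<close> by the value of the monomial there
    leaves a single \<open>C\<close> above the \<open>q\<close>-th power of every element.\<close>
  define C where "C = w x0 * (lmon c k x0)\<^sup>\<star>"
  have le_C: "g ^ nat q \<sqsubseteq> C" for g
  proof -
    have "lmon c k x0 * zpow F g q \<approx> lmon c k (shift g v x0)"
      unfolding q_def by (rule lmon_shift[symmetric])
    also have "lmon c k (shift g v x0) \<sqsubseteq> w (shift g v x0)"
      using w(2) by (simp add: ab_le_iff)
    also have "w (shift g v x0) \<approx> w x0" using w(1) by blast
    finally have "lmon c k x0 * zpow F g q * (lmon c k x0)\<^sup>\<star> \<sqsubseteq> C" unfolding C_def by (rule mult_right_mono)
    moreover have "zpow F g q \<approx> lmon c k x0 * zpow F g q * (lmon c k x0)\<^sup>\<star>"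
      by (simp add: mult.commute[of "nu F (lmon c k x0)"] mult.assoc)
    ultimately have "zpow F g q \<sqsubseteq> C" by (rule le_eqv_trans(2)[rotated])
    then show ?thesis using v(1) by (simp add: zpow_def q_def)
  qed
  have C: "1 \<sqsubseteq> C" using le_C[of 1] by simp
  obtain h0 where "\<not> h0 \<approx> 1" using nt by blast
  then have h0: "\<not> ab h0 \<approx> 1" using ab_eqv_one by blast
  \<comment> \<open>A bound valid for every \<open>g\<close> is refuted by a \<open>g\<close> built
    from it: for \<open>ab h0 * C\<close> it forces \<open>ab h0 \<sqsubseteq> 1\<close>.\<close>
  have "1 \<sqsubseteq> ab h0 * C" using C by (simp add: one_le_mult)
  then have "ab h0 * C \<sqsubseteq> (ab h0 * C) ^ nat q" using v(1) by (intro le_power) (auto simp: q_def)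
  then have "ab h0 * C \<sqsubseteq> 1 * C" using le_trans[OF _ le_C] by simp
  then have "ab h0 \<sqsubseteq> 1" by (rule mult_le_cancel)
  then show False using h0 one_le_ab le_antisym by blast
qed

text \<open>Translates convex dependence of monomials into linear dependence over the rationals, so
  that exchange arguments can be taken from linear algebra.\<close>

lemma convexly_dependent_iff:
  assumes nt: "\<exists>h. \<not> h \<approx> 1" and A: "A \<subseteq> L_monomials F" and f: "f \<in> L_monomials F"
  shows "f \<in> kprod F (kgen F A) (kgen F constants) \<longleftrightarrow> expo f \<in> vec.span (expo ` A)"
proof -
  let ?K = "kgen F (A \<union> constants)"
  have AR: "A \<subseteq> ratfun F" using A L_monomials_ratfun by blast
  have K: "kern ?K" using AR constants_ratfun by (intro kern_kgen) simp
  obtain c k where ck: "f = lmon c k" "expo f = ratvec k" using f expo_lmon by blast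
  have "f \<in> ?K \<longleftrightarrow> expo f \<in> vec.span (expo ` A)"
  proof
    assume "f \<in> ?K"
    then show "expo f \<in> vec.span (expo ` A)"
      using lmon_span[OF nt A, of c k] ck by (simp add: memI)
  next
    assume "expo f \<in> vec.span (expo ` A)"
    then have "k \<in> exponents ?K"
      using span_exponents[OF K A, of k] kgen_sub[of "A \<union> constants"] ck by auto
    then obtain d where d: "mem ?K (lmon d k)" by (auto simp: exponents_def)
    \<comment> \<open>The span yields the right exponents with some coefficient \<open>d\<close>; a
      constant corrects it to \<open>c\<close>.\<close>
    have "(\<lambda>_. c * d\<^sup>\<star>) \<in> ?K" using kgen_sub[of "A \<union> constants"] by (auto simp: constants_def)
    from mem_mult[OF K memI[OF this] d] have "mem ?K (\<lambda>x. (c * d\<^sup>\<star>) * lmon d k x)" .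
    then have "mem ?K f" unfolding ck
      by (rule mem_cong) (simp add: lmon_eqv mult.assoc)
    then show "f \<in> ?K" using mem_iff[OF K] f L_monomials_ratfun by blast
  qed
  then show ?thesis by (simp add: kprod_kgen[OF AR constants_ratfun])
qed

lemma kgen_span:
  assumes nt: "\<exists>h. \<not> h \<approx> 1" and S: "S \<subseteq> L_monomials F" and m: "m \<in> L_monomials F" "m \<in> kgen F S"
  shows "expo m \<in> vec.span (expo ` S)"
proof -
  obtain c k where ck: "m = lmon c k" "expo m = ratvec k" using m expo_lmon by blast
  have "m \<in> kgen F (S \<union> constants)" using m(2) kgen_mono[of S "S \<union> constants"] by blast
  then show ?thesis using lmon_span[OF nt S, of c k] ck by (simp add: memI)
qed

text \<open>If the dimension did not grow, the two spans would coincide and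
  \<open>span_absorb\<close> would put every generator from \<open>T\<close> into
  \<open>kgen F S\<close>.\<close>

lemma rank_less:
  assumes nt: "\<exists>h. \<not> h \<approx> 1" and S: "S \<subseteq> L_monomials F" and T: "T \<subseteq> L_monomials F"
    and nc: "\<And>c. (\<lambda>_. c) \<in> kgen F T \<Longrightarrow> c \<approx> 1" and less: "kgen F S \<subset> kgen F T"
  shows "vec.dim (expo ` S) < vec.dim (expo ` T)"
proof (rule ccontr)
  have K: "kern (kgen F S)" "kern (kgen F T)" using S T L_monomials_ratfun by (auto intro!: kern_kgen)
  assume "\<not> ?thesis"
  then have dim: "vec.dim (vec.span (expo ` T)) \<le> vec.dim (vec.span (expo ` S))" by simp
  have "expo ` S \<subseteq> vec.span (expo ` T)"
    using kgen_span[OF nt T] S kgen_sub[of S] less by blast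
  then have "vec.span (expo ` S) \<subseteq> vec.span (expo ` T)" by (rule vec.span_minimal) simp
  then have eq: "vec.span (expo ` S) = vec.span (expo ` T)"
    using dim by (intro vec.subspace_dim_equal) auto
  have "T \<subseteq> kgen F S"
  proof
    fix t assume "t \<in> T"
    then show "t \<in> kgen F S"
      using eq T kgen_sub[of T] vec.span_base[of "expo t" "expo ` T"] less
      by (intro span_absorb[OF K(1) K(2) nc _ S kgen_sub]) auto
  qed
  then have "kgen F T \<subseteq> kgen F S" using K by (intro kgen_least)
  then show False using less by blast
qed

subsection \<open>Common zeros\<close>

text \<open>A zero is a point where the value is \<open>nu\<close>-equal to 1. Bounds with that
  property at \<open>z\<close> are closed under products, so zeros of the generators are zeros of
  the kernel.\<close>

lemma kgen_zero:
  assumes "S \<subseteq> ratfun F" "\<And>m. m \<in> S \<Longrightarrow> m z \<approx> 1" "mem (kgen F S) u"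
  shows "u z \<approx> 1"
proof -
  let ?W = "{w :: ('b, 'a) fn. (\<forall>x. 1 \<sqsubseteq> w x) \<and> w z \<approx> 1}"
  let ?B = "{u \<in> ratfun F. \<exists>w\<in>?W. \<forall>x. ab (u x) \<sqsubseteq> w x}"
  have K: "kern ?B" by (rule kern_bounded) (auto intro: one_le_mult)
  have "S \<subseteq> ?B"
  proof
    fix s assume s: "s \<in> S"
    have "ab (s z) \<approx> 1" using ab_cong[OF assms(2)[OF s]] ab_one by simp
    then have "(\<lambda>x. ab (s x)) \<in> ?W" by simp
    then have "\<exists>w\<in>?W. \<forall>x. ab (s x) \<sqsubseteq> w x" by (rule bexI[rotated]) simp
    then show "s \<in> ?B" using s assms by blast
  qed
  then have "kgen F S \<subseteq> ?B" using K by (intro kgen_least)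
  then have "mem ?B u" using assms(3) by (rule mem_mono)
  then obtain u' w where u': "u \<simeq> u'" "w \<in> ?W" "\<forall>x. ab (u' x) \<sqsubseteq> w x" unfolding mem_def by blast
  then have "ab (u' z) \<sqsubseteq> 1" using le_eqv_trans(1)[of "ab (u' z)" "w z" 1] by blast
  then have "ab (u' z) \<approx> 1" using le_antisym one_le_ab by blast
  then have "u' z \<approx> 1" by (rule ab_eqv_one)
  with u'(1) show ?thesis by simp
qed

lemma zpow_root: assumes "q > 0" shows "\<exists>h. zpow F h q = (a :: 'a)"
proof -
  have "nat q \<ge> 1" using assms by linarith
  then obtain h where "h ^ nat q = a" using root_exists by blast
  then show ?thesis using assms by (auto simp: zpow_def)
qed

text \<open>Monomials are added one at a time. A dependent one already lies in the kernel of the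
  others and vanishes with them; for an independent one, \<open>z\<close> is moved along a line on
  which the others are constant.\<close>

lemma common_zero:
  fixes S :: "('n::finite, 'a) fn set"
  assumes nt: "\<exists>h. \<not> h \<approx> 1"
  shows "finite S \<Longrightarrow> S \<subseteq> L_monomials F \<Longrightarrow> (\<And>c. (\<lambda>_. c) \<in> kgen F S \<Longrightarrow> c \<approx> 1) \<Longrightarrow>
    \<exists>z. \<forall>m\<in>S. m z \<approx> 1"
proof (induction S rule: finite_induct)
  case (insert m S)
  have S: "S \<subseteq> L_monomials F" "S \<subseteq> ratfun F" and mR: "insert m S \<subseteq> ratfun F"
    using insert.prems L_monomials_ratfun by auto
  have mono: "kgen F S \<subseteq> kgen F (insert m S)" by (rule kgen_mono) auto
  then obtain z where z: "\<And>s. s \<in> S \<Longrightarrow> s z \<approx> 1" using insert S by blast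
  obtain c k where ck: "m = lmon c k" "expo m = ratvec k" using insert.prems expo_lmon by blast
  show ?case
  proof (cases "ratvec k \<in> vec.span (expo ` S)")
    case True
    have "m \<in> kgen F S"
    proof (rule span_absorb[OF kern_kgen[OF S(2)] kern_kgen[OF mR] insert.prems(2) mono S(1) kgen_sub])
      show "expo m \<in> vec.span (expo ` S)" using True ck by simp
    qed (use insert.prems kgen_sub[of "insert m S"] in auto)
    then have "mem (kgen F S) m" by (rule memI)
    with S(2) z have "m z \<approx> 1" by (rule kgen_zero)
    then show ?thesis using z by blast
  next
    case False
    then obtain v where v: "(\<Sum>i\<in>UNIV. v i * k i) > 0"
      "\<And>l. ratvec l \<in> expo ` S \<Longrightarrow> (\<Sum>i\<in>UNIV. v i * l i) = 0"
      using separating_exponent[of k "expo ` S"] by blast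
    \<comment> \<open>Along the line \<open>m\<close> is multiplied by the power of \<open>h\<close>
      given by its positive slope; a root of the inverse of \<open>m z\<close> carries
      \<open>m\<close> to 1.\<close>
    obtain h where h: "zpow F h (\<Sum>i\<in>UNIV. v i * k i) = (m z)\<^sup>\<star>" using zpow_root[OF v(1)] by blast
    have "m (shift h v z) \<approx> 1" using lmon_shift[of c k h v z] h ck by simp
    moreover have "s (shift h v z) \<approx> 1" if s: "s \<in> S" for s
    proof -
      obtain d l where dl: "s = lmon d l" "expo s = ratvec l" using S s expo_lmon by blast
      then have "(\<Sum>i\<in>UNIV. v i * l i) = 0" using s by (intro v(2)) force
      then show ?thesis using lmon_shift[of d l h v z] dl z[OF s] by simp
    qed
    ultimately show ?thesis by blast
  qed
qed simp

lemma zpow_eqv_one: "zpow F h p \<approx> 1 \<Longrightarrow> p \<noteq> 0 \<Longrightarrow> h \<approx> 1"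
proof (cases "p > 0")
  case True
  then show "zpow F h p \<approx> 1 \<Longrightarrow> h \<approx> 1" using power_eqv_one[of h "nat p"] by (simp add: zpow_def)
next
  case False
  assume "zpow F h p \<approx> 1" "p \<noteq> 0"
  with False have "(h\<^sup>\<star>) ^ nat (- p) \<approx> 1" by (simp add: zpow_def split: if_splits)
  moreover have "nat (- p) \<ge> 1" using False \<open>p \<noteq> 0\<close> by linarith
  ultimately have "h\<^sup>\<star> \<approx> 1" by (rule power_eqv_one)
  from star_cong[OF this] show "h \<approx> 1" by (simp add: star_one)
qed

text \<open>Two zeros on a line of non-zero slope would make \<open>h\<close> a torsion element, so
  there is at most one. With slope 0 the value is constantly \<open>a\<close>.\<close>

lemma finite_zeros_on_line:
  assumes h: "\<not> h \<approx> 1" and p: "p \<noteq> 0 \<or> \<not> a \<approx> 1"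
  shows "finite {t. a * zpow F h (t * p) \<approx> 1}" (is "finite ?T")
proof (cases "p = 0")
  case True
  then have "?T = {}" using p by simp
  then show ?thesis by simp
next
  case False
  have "s = t" if s: "s \<in> ?T" and t: "t \<in> ?T" for s t
  proof (rule ccontr)
    assume "s \<noteq> t"
    have "zpow F h (s * p) * a \<approx> zpow F h (t * p) * a" using s t by (simp add: mult.commute)
    then have "zpow F h (s * p) \<approx> zpow F h (t * p)" by (rule eqv_cancel)
    moreover have "zpow F h (s * p) \<approx> zpow F h ((s - t) * p) * zpow F h (t * p)"
      using zpow_add[of h "(s - t) * p" "t * p"] by (simp add: left_diff_distrib)
    ultimately have "zpow F h ((s - t) * p) * zpow F h (t * p) \<approx> 1 * zpow F h (t * p)" by simp
    then have "zpow F h ((s - t) * p) \<approx> 1" by (rule eqv_cancel)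
    from zpow_eqv_one[OF this] show False using h False \<open>s \<noteq> t\<close> by simp
  qed
  then have "?T = {} \<or> (\<exists>t. ?T = {t})" by blast
  then show ?thesis by auto
qed

text \<open>A common zero of \<open>S\<close> can be chosen off finitely many monomials outside the
  kernel. When the next monomial happens to vanish at \<open>z\<close>, a line through
  \<open>z\<close> in the zero set leaves it again.\<close>

lemma generic_zero:
  fixes S :: "('n::finite, 'a) fn set"
  assumes nt: "\<exists>h. \<not> h \<approx> 1" and fin: "finite S" and S: "S \<subseteq> L_monomials F"
    and nc: "\<And>c. (\<lambda>_. c) \<in> kgen F S \<Longrightarrow> c \<approx> 1"
  shows "finite M \<Longrightarrow> (\<And>c k. (c, k) \<in> M \<Longrightarrow> \<not> mem (kgen F S) (lmon c k)) \<Longrightarrow>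
    \<exists>z. (\<forall>m\<in>S. m z \<approx> 1) \<and> (\<forall>(c, k)\<in>M. \<not> lmon c k z \<approx> 1)"
proof (induction M rule: finite_induct)
  case empty
  then show ?case using common_zero[OF nt fin S nc] by auto
next
  case (insert ck M)
  have SR: "S \<subseteq> ratfun F" using S L_monomials_ratfun by blast
  then have K: "kern (kgen F S)" by (rule kern_kgen)
  obtain c k where ck: "ck = (c, k)" by (cases ck)
  obtain z where z: "\<And>m. m \<in> S \<Longrightarrow> m z \<approx> 1" "\<And>c k. (c, k) \<in> M \<Longrightarrow> \<not> lmon c k z \<approx> 1"
    using insert by blast
  show ?case
  proof (cases "lmon c k z \<approx> 1")
    case False
    then show ?thesis using z ck by auto
  next
    case True
    \<comment> \<open>Otherwise the kernel has some \<open>lmon d k\<close>, which vanishes at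
      \<open>z\<close> just as \<open>lmon c k\<close> does. Then \<open>c \<approx> d\<close>, and
      \<open>lmon c k\<close> would lie in the kernel.\<close>
    have "ratvec k \<notin> vec.span (expo ` S)"
    proof
      assume "ratvec k \<in> vec.span (expo ` S)"
      then have "k \<in> exponents (kgen F S)" by (rule span_exponents[OF K S kgen_sub])
      then obtain d where d: "mem (kgen F S) (lmon d k)" by (auto simp: exponents_def)
      have "lmon d k z \<approx> 1" by (rule kgen_zero[OF SR z(1) d])
      then have "c * (\<Prod>i\<in>UNIV. zpow F (z i) (k i)) \<approx> d * (\<Prod>i\<in>UNIV. zpow F (z i) (k i))"
        using True by (simp add: lmon_eqv)
      then have "c \<approx> d" by (rule eqv_cancel)
      then have "lmon d k \<simeq> lmon c k" by (intro lmon_coeff_cong) simp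
      with d have "mem (kgen F S) (lmon c k)" by (rule mem_cong)
      then show False using insert.prems ck by blast
    qed
    then obtain v where v: "(\<Sum>i\<in>UNIV. v i * k i) > 0"
      "\<And>l. ratvec l \<in> expo ` S \<Longrightarrow> (\<Sum>i\<in>UNIV. v i * l i) = 0"
      using separating_exponent[of k "expo ` S"] by blast
    obtain h where h: "\<not> h \<approx> 1" using nt by blast
    \<comment> \<open>Integral multiples of \<open>v\<close> with a fixed nontrivial
      \<open>h\<close> provide infinitely many parameters, of which each monomial spoils finitely
      many.\<close>
    define zt where "zt t = shift h (\<lambda>i. t * v i) z" for t
    have lt: "lmon d l (zt t) \<approx> lmon d l z * zpow F h (t * (\<Sum>i\<in>UNIV. v i * l i))" for d l t
      using lmon_shift[of d l h "\<lambda>i. t * v i" z] by (simp add: zt_def mult.assoc sum_distrib_left)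
    let ?bad = "\<lambda>(d, l). {t. lmon d l (zt t) \<approx> 1}"
    have "finite (?bad dl)" if dl: "dl \<in> insert ck M" for dl
    proof -
      obtain d l where eq: "dl = (d, l)" by (cases dl)
      have "?bad dl = {t. lmon d l z * zpow F h (t * (\<Sum>i\<in>UNIV. v i * l i)) \<approx> 1}"
        unfolding eq by (simp only: lt prod.case)
      \<comment> \<open>The new monomial has positive slope along the line, and the earlier ones
        differ from 1 at \<open>z\<close>; these are the two alternatives required.\<close>
      also have "finite \<dots>"
        by (rule finite_zeros_on_line[OF h]) (use dl eq ck v(1) z(2) in auto)
      finally show ?thesis .
    qed
    then have "finite (\<Union> (?bad ` insert ck M))" using insert.hyps(1) by blast
    from ex_new_if_finite[OF infinite_UNIV_int this]
    obtain t where t: "t \<notin> \<Union> (?bad ` insert ck M)" ..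
    have "s (zt t) \<approx> 1" if s: "s \<in> S" for s
    proof -
      obtain d l where dl: "s = lmon d l" "expo s = ratvec l" using S s expo_lmon by blast
      then have "(\<Sum>i\<in>UNIV. v i * l i) = 0" using s by (intro v(2)) force
      then show ?thesis using lt[of d l t] dl z(1)[OF s] by simp
    qed
    moreover have "\<forall>(c, k)\<in>insert ck M. \<not> lmon c k (zt t) \<approx> 1" using t by blast
    ultimately show ?thesis by blast
  qed
qed

subsection \<open>HS-kernels without constants are irreducible\<close>

text \<open>Totality is essential: two values strictly above 1 in a partial lattice order may have
  infimum 1, but in a total order the infimum is one of them.\<close>

lemma Int_nonzero:
  assumes tot: "\<And>a b :: 'a. a \<sqsubseteq> b \<or> b \<sqsubseteq> a" and kk: "kern K" "kern K'"
    and u: "mem K u" "\<not> u z \<approx> 1" "mem K' u'" "\<not> u' z \<approx> 1"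
  shows "\<exists>w. mem (K \<inter> K') w \<and> \<not> w z \<approx> 1"
proof (intro exI conjI)
  let ?w = "\<lambda>x. ab (u x) \<sqinter> ab (u' x)"
  have rat: "rational ?w" using u kk by (intro rational_meet rational_ab mem_rational)
  have "mem K ?w" "mem K' ?w"
    by (rule mem_between[OF kk(1) mem_ab[OF kk(1) u(1)] rat]
        mem_between[OF kk(2) mem_ab[OF kk(2) u(3)] rat]; simp add: meet_le meet_greatest)+
  then show "mem (K \<inter> K') ?w" using mem_Int[OF kk] by blast
  show "\<not> ?w z \<approx> 1"
  proof
    assume w: "?w z \<approx> 1"
    have "ab (u z) \<sqsubseteq> ?w z \<or> ab (u' z) \<sqsubseteq> ?w z"
      using tot[of "ab (u z)" "ab (u' z)"] by (auto intro: meet_greatest)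
    then have "ab (u z) \<sqsubseteq> 1 \<or> ab (u' z) \<sqsubseteq> 1" using w le_eqv_trans(1) by blast
    then show False using u ab_eqv_one le_antisym one_le_ab by blast
  qed
qed

text \<open>\<open>M\<close> collects one generator outside \<open>L\<close> for each kernel in the
  intersection. Wherever none of them vanishes, each of these kernels has a non-vanishing member,
  and so does their intersection.\<close>

lemma hs_meets_nonzero:
  assumes tot: "\<And>a b :: 'a. a \<sqsubseteq> b \<or> b \<sqsubseteq> a" and L: "kern L"
  shows "K \<in> hs_meets \<Longrightarrow> \<not> K \<subseteq> L \<Longrightarrow>
    \<exists>M. finite M \<and> (\<forall>(c, k)\<in>M. \<not> mem L (lmon c k)) \<and>
      (\<forall>z. (\<forall>(c, k)\<in>M. \<not> lmon c k z \<approx> 1) \<longrightarrow> (\<exists>u. mem K u \<and> \<not> u z \<approx> 1))"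
proof (induction rule: hs_meets.induct)
  case (base T)
  have "\<not> T \<subseteq> L" using base kgen_least[OF L] by blast
  then obtain t where t: "t \<in> T" "t \<notin> L" by blast
  then have "t \<in> L_monomials F" using base.hyps unfolding hs_gens_def by blast
  then obtain c k where ck: "t = lmon c k" by (auto simp: L_monomials_lmon)
  have "\<not> mem L (lmon c k)" using t ck mem_iff[OF L lmon_ratfun] by blast
  moreover have "mem (kgen F T) (lmon c k)" using t ck kgen_sub by (blast intro: memI)
  ultimately show ?case by (intro exI[of _ "{(c, k)}"]) auto
next
  case (Int K K')
  then have kk: "kern K" "kern K'" by (auto simp: hs_meets_kern)
  obtain M M' where M: "finite M" "\<forall>(c, k)\<in>M. \<not> mem L (lmon c k)"
      "\<And>z. (\<forall>(c, k)\<in>M. \<not> lmon c k z \<approx> 1) \<Longrightarrow> \<exists>u. mem K u \<and> \<not> u z \<approx> 1"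
    "finite M'" "\<forall>(c, k)\<in>M'. \<not> mem L (lmon c k)"
      "\<And>z. (\<forall>(c, k)\<in>M'. \<not> lmon c k z \<approx> 1) \<Longrightarrow> \<exists>u. mem K' u \<and> \<not> u z \<approx> 1"
    using Int by blast
  have "\<exists>u. mem (K \<inter> K') u \<and> \<not> u z \<approx> 1" if z: "\<forall>(c, k)\<in>M \<union> M'. \<not> lmon c k z \<approx> 1" for z
  proof -
    obtain u u' where u: "mem K u" "\<not> u z \<approx> 1" "mem K' u'" "\<not> u' z \<approx> 1"
      using M(3,6)[of z] z by blast
    show ?thesis by (rule Int_nonzero[OF tot kk u])
  qed
  then show ?case using M by (intro exI[of _ "M \<union> M'"]) auto
qed

text \<open>At a zero of \<open>S\<close> that avoids the monomials witnessing \<open>K\<close> and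
  \<open>K'\<close>, some function in \<open>K \<inter> K'\<close> does not vanish, whereas all of
  \<open>kgen F S\<close> vanishes there.\<close>

lemma hs_irreducible:
  assumes nt: "\<exists>h. \<not> h \<approx> 1" and tot: "\<And>a b :: 'a. a \<sqsubseteq> b \<or> b \<sqsubseteq> a"
    and S: "hs_gens S" and nc: "\<And>c. (\<lambda>_. c) \<in> kgen F S \<Longrightarrow> c \<approx> 1"
  shows "kgen F S \<in> HSpec F"
proof -
  have SR: "S \<subseteq> ratfun F" using S by (rule hs_gens_ratfun)
  have LK: "kern (kgen F S)" using SR by (rule kern_kgen)
  have False if *: "K \<in> hs_meets" "K' \<in> hs_meets" "\<not> K \<subseteq> kgen F S" "\<not> K' \<subseteq> kgen F S"
      "K \<inter> K' \<subseteq> kgen F S" for K K'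
  proof -
    have kk: "kern K" "kern K'" using * by (auto simp: hs_meets_kern)
    obtain M where M: "finite M" "\<forall>(c, k)\<in>M. \<not> mem (kgen F S) (lmon c k)"
      "\<And>z. (\<forall>(c, k)\<in>M. \<not> lmon c k z \<approx> 1) \<Longrightarrow> \<exists>u. mem K u \<and> \<not> u z \<approx> 1"
      using hs_meets_nonzero[OF tot LK *(1,3)] by blast
    obtain M' where M': "finite M'" "\<forall>(c, k)\<in>M'. \<not> mem (kgen F S) (lmon c k)"
      "\<And>z. (\<forall>(c, k)\<in>M'. \<not> lmon c k z \<approx> 1) \<Longrightarrow> \<exists>u. mem K' u \<and> \<not> u z \<approx> 1"
      using hs_meets_nonzero[OF tot LK *(2,4)] by blast
    have "\<exists>z. (\<forall>m\<in>S. m z \<approx> 1) \<and> (\<forall>(c, k)\<in>M \<union> M'. \<not> lmon c k z \<approx> 1)"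
      using S M M' by (intro generic_zero[OF nt _ _ nc]) (auto simp: hs_gens_def)
    then obtain z where z: "\<And>m. m \<in> S \<Longrightarrow> m z \<approx> 1" "\<forall>(c, k)\<in>M \<union> M'. \<not> lmon c k z \<approx> 1" by blast
    obtain u u' where u: "mem K u" "\<not> u z \<approx> 1" "mem K' u'" "\<not> u' z \<approx> 1"
      using M(3)[of z] M'(3)[of z] z(2) by blast
    obtain w where w: "mem (K \<inter> K') w" "\<not> w z \<approx> 1" using Int_nonzero[OF tot kk u] by blast
    from SR z(1) mem_mono[OF *(5) w(1)] have "w z \<approx> 1" by (rule kgen_zero)
    with w(2) show False by contradiction
  qed
  then show ?thesis unfolding HSpec_iff reducible_iff using S by (blast intro: hs_meets.base)
qed

subsection \<open>Quotients\<close>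

lemma mod_equiv_iff: "mod_equiv F P f g \<longleftrightarrow> mem P (\<lambda>x. f x * (g x)\<^sup>\<star>)"
  unfolding mod_equiv_def fn_equiv_iff mem_def by (metis feq_sym)

lemma mod_equiv_mem:
  fixes K :: "('n::finite, 'a) fn set"
  assumes K: "kern K" "P \<subseteq> K" and u: "mod_equiv F P u v" and v: "mem K v"
  shows "mem K u"
proof -
  have "mem K (\<lambda>x. u x * (v x)\<^sup>\<star>)" using u K by (auto simp: mod_equiv_iff intro: mem_mono)
  from mem_mult[OF K(1) this v] show ?thesis by (rule mem_cong) (simp add: mult.assoc)
qed

text \<open>The correspondence theorem for quotients. The convexity clause carries the content,
  since its weights add up to 1 only modulo \<open>P\<close>.\<close>

lemma is_kernel_mod_iff:
  fixes P :: "('n::finite, 'a) fn set"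
  assumes P: "kern P"
  shows "is_kernel F (mod_equiv F P) K \<longleftrightarrow> kern K \<and> P \<subseteq> K"
proof
  assume *: "is_kernel F (mod_equiv F P) K"
  have eqv: "mod_equiv F P u v" if "u \<simeq> v" for u v :: "('n, 'a) fn"
    unfolding mod_equiv_iff using mem_one[OF P] by (rule mem_cong) (simp add: that)
  have closed: "K \<subseteq> ratfun F" "K \<noteq> {}"
    "\<And>a b u. a \<in> K \<Longrightarrow> b \<in> K \<Longrightarrow> u \<in> ratfun F \<Longrightarrow> mod_equiv F P u (\<lambda>x. a x * b x) \<Longrightarrow> u \<in> K"
    "\<And>a u. a \<in> K \<Longrightarrow> u \<in> ratfun F \<Longrightarrow> mod_equiv F P u (\<lambda>x. (a x)\<^sup>\<star>) \<Longrightarrow> u \<in> K"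
    "\<And>a b \<alpha> \<beta> u. a \<in> K \<Longrightarrow> b \<in> K \<Longrightarrow> \<alpha> \<in> ratfun F \<Longrightarrow> \<beta> \<in> ratfun F \<Longrightarrow>
      mod_equiv F P (\<lambda>x. \<alpha> x + \<beta> x) (\<lambda>_. 1) \<Longrightarrow> u \<in> ratfun F \<Longrightarrow>
      mod_equiv F P u (\<lambda>x. \<alpha> x * a x + \<beta> x * b x) \<Longrightarrow> u \<in> K"
    using * unfolding is_kernel_def by blast+
  have K: "kern K"
    unfolding is_kernel_def fn_equiv_iff
    by (intro conjI ballI impI closed(1,2)) (blast intro: closed eqv)+
  have "(\<lambda>_. 1) \<in> K" using mem_one[OF K] mem_iff[OF K const_ratfun] by blast
  have "P \<subseteq> K"
  proof
    fix p assume p: "p \<in> P"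
    have "mem P (\<lambda>x. p x * (1 * 1)\<^sup>\<star>)" using memI[OF p] by (rule mem_cong) (simp add: star_one)
    then have "mod_equiv F P p (\<lambda>x. 1 * 1)" by (simp add: mod_equiv_iff)
    then show "p \<in> K" using closed(3) \<open>(\<lambda>_. 1) \<in> K\<close> kern_sub[OF P] p by blast
  qed
  with K show "kern K \<and> P \<subseteq> K" ..
next
  assume "kern K \<and> P \<subseteq> K"
  then have K: "kern K" "P \<subseteq> K" by auto
  have inK: "u \<in> K" if "u \<in> ratfun F" "mod_equiv F P u v" "mem K v" for u v
    using mod_equiv_mem[OF K that(2,3)] mem_iff[OF K(1) that(1)] by blast
  show "is_kernel F (mod_equiv F P) K"
    unfolding is_kernel_def
  proof (intro conjI ballI impI)
    show "K \<subseteq> ratfun F" using K by (intro kern_sub)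
    show "K \<noteq> {}" using mem_one[OF K(1)] by (auto simp: mem_def)
  next
    fix a b u assume "a \<in> K" "b \<in> K" "u \<in> ratfun F" "mod_equiv F P u (\<lambda>x. a x * b x)"
    then show "u \<in> K" using mem_mult[OF K(1) memI memI] by (intro inK)
  next
    fix a u assume "a \<in> K" "u \<in> ratfun F" "mod_equiv F P u (\<lambda>x. (a x)\<^sup>\<star>)"
    then show "u \<in> K" using mem_star[OF K(1) memI] by (intro inK)
  next
    fix a b \<alpha> \<beta> u
    assume *: "a \<in> K" "b \<in> K" "\<alpha> \<in> ratfun F" "\<beta> \<in> ratfun F" "mod_equiv F P (\<lambda>x. \<alpha> x + \<beta> x) (\<lambda>_. 1)"
      "u \<in> ratfun F" "mod_equiv F P u (\<lambda>x. \<alpha> x * a x + \<beta> x * b x)"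
    define s where "s x = \<alpha> x + \<beta> x" for x
    \<comment> \<open>Since \<open>s\<close> lies in \<open>P\<close>, dividing \<open>\<alpha>\<close> and \<open>\<beta>\<close> by \<open>s\<close> gives an honest convex combination.\<close>
    have "mem K (\<lambda>x. s x * 1\<^sup>\<star>)" using *(5) K(2) by (auto simp: mod_equiv_iff s_def intro: mem_mono)
    then have s: "mem K s" by (rule mem_cong) (simp add: star_one)
    have rs: "rational s" "rational \<alpha>" "rational \<beta>" using * mem_rational[OF K(1) s] by (auto intro: ratfun_rational)
    have "mem K (\<lambda>x. (\<alpha> x * (s x)\<^sup>\<star>) * a x + (\<beta> x * (s x)\<^sup>\<star>) * b x)"
    proof (rule mem_conv[OF K(1) memI[OF *(1)] memI[OF *(2)]])
      have "\<alpha> x * (s x)\<^sup>\<star> + \<beta> x * (s x)\<^sup>\<star> \<approx> s x * (s x)\<^sup>\<star>" for x by (simp only: s_def distrib_right)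
      then show "(\<lambda>x. \<alpha> x * (s x)\<^sup>\<star> + \<beta> x * (s x)\<^sup>\<star>) \<simeq> (\<lambda>_. 1)" by simp
    qed (use rs in \<open>auto intro!: rational_mult rational_star\<close>)
    from mem_mult[OF K(1) s this] have "mem K (\<lambda>x. \<alpha> x * a x + \<beta> x * b x)"
    proof (rule mem_cong, intro allI)
      fix x
      have "s x * ((\<alpha> x * (s x)\<^sup>\<star>) * a x + (\<beta> x * (s x)\<^sup>\<star>) * b x) =
        (s x * (s x)\<^sup>\<star>) * (\<alpha> x * a x) + (s x * (s x)\<^sup>\<star>) * (\<beta> x * b x)"
        unfolding distrib_left by (simp only: ac_simps)
      then show "s x * ((\<alpha> x * (s x)\<^sup>\<star>) * a x + (\<beta> x * (s x)\<^sup>\<star>) * b x) \<approx> \<alpha> x * a x + \<beta> x * b x"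
        by (simp flip: mult.assoc)
    qed
    then show "u \<in> K" using * by (intro inK)
  qed
qed

lemma gen_kernel_mod: "kern P \<Longrightarrow> gen_kernel F (mod_equiv F P) S = kgen F (P \<union> S)"
  unfolding gen_kernel_def by (rule arg_cong[of _ _ Inter]) (auto simp: is_kernel_mod_iff)

text \<open>A kernel containing \<open>P\<close> is already a union of classes modulo
  \<open>P\<close>, so passing to the quotient leaves its set of representatives unchanged.\<close>

lemma kquot_kern:
  assumes "kern Q" "kern P" "P \<subseteq> Q" shows "kquot F Q P = Q"
proof
  show "kquot F Q P \<subseteq> Q"
  proof
    fix u assume "u \<in> kquot F Q P"
    then obtain f where f: "u \<in> ratfun F" "f \<in> Q" "mod_equiv F P u f" unfolding kquot_def by blast
    then have "mem Q u" using mod_equiv_mem[OF assms(1,3) f(3)] memI by blast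
    then show "u \<in> Q" using mem_iff[OF assms(1) f(1)] by simp
  qed
  show "Q \<subseteq> kquot F Q P"
  proof
    fix u assume u: "u \<in> Q"
    have "mod_equiv F P u u" unfolding mod_equiv_iff using mem_one[OF assms(2)] by (rule mem_cong) simp
    then show "u \<in> kquot F Q P" using u kern_sub[OF assms(1)] by (auto simp: kquot_def)
  qed
qed

subsection \<open>Convex dimension\<close>

text \<open>Independent sets of monomials correspond under \<open>expo\<close> to linearly
  independent sets of vectors. Injectivity is part of this: two monomials with equal exponent
  vectors depend on each other.\<close>

lemma hs_d_conv:
  fixes S :: "('n::finite, 'a) fn set"
  assumes nt: "\<exists>h. \<not> h \<approx> 1" and S: "S \<subseteq> L_monomials F"
  shows "has_d_conv F (kgen F S) (vec.dim (expo ` S))"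
proof -
  let ?M = "L_monomials F \<inter> kprod F (kgen F S) (kgen F constants) :: ('n, 'a) fn set"
  have M: "m \<in> ?M \<longleftrightarrow> m \<in> L_monomials F \<and> expo m \<in> vec.span (expo ` S)" for m
    using convexly_dependent_iff[OF nt S] by auto
  have indep: "convexly_independent F A \<longleftrightarrow> (\<forall>f\<in>A. expo f \<notin> vec.span (expo ` (A - {f})))"
    if "A \<subseteq> ?M" for A
    unfolding convexly_independent_def convexly_dependent_def
    using convexly_dependent_iff[OF nt, of "A - {_}"] that by blast
  have inj: "inj_on expo A \<and> vec.independent (expo ` A)"
    if A: "A \<subseteq> ?M" "convexly_independent F A" for A
  proof -
    have *: "\<And>f. f \<in> A \<Longrightarrow> expo f \<notin> vec.span (expo ` (A - {f}))" using A indep by blast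
    have inj: "inj_on expo A"
    proof (rule inj_onI, rule ccontr)
      fix f g assume "f \<in> A" "g \<in> A" "expo f = expo g" "f \<noteq> g"
      then have "expo f \<in> expo ` (A - {f})" by auto
      then have "expo f \<in> vec.span (expo ` (A - {f}))" by (rule vec.span_base)
      then show False using *[OF \<open>f \<in> A\<close>] by contradiction
    qed
    moreover have "expo ` A - {expo f} = expo ` (A - {f})" if "f \<in> A" for f
      using inj that by (auto simp: inj_on_def)
    ultimately show ?thesis using * unfolding vec.dependent_def by auto
  qed
  have conv: "convexly_independent F A"
    if A: "A \<subseteq> ?M" "inj_on expo A" "vec.independent (expo ` A)" for A
  proof -
    have "expo ` A - {expo f} = expo ` (A - {f})" if "f \<in> A" for f
      using A(2) that by (auto simp: inj_on_def)
    then show ?thesis using A unfolding vec.dependent_def indep[OF A(1)] by auto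
  qed
  have "expo s \<in> vec.span (expo ` S)" if "s \<in> S" for s
    using that by (intro vec.span_base) simp
  then have SM: "S \<subseteq> ?M" using M S by blast
  have card: "finite B \<and> card B = vec.dim (expo ` S)" if B: "conv_basis F (kgen F S) B" for B
  proof -
    have BM: "B \<subseteq> ?M" "convexly_independent F B"
      and max: "\<And>A. A \<subseteq> ?M \<Longrightarrow> convexly_independent F A \<Longrightarrow> B \<subseteq> A \<Longrightarrow> A = B"
      using B unfolding conv_basis_def by blast+
    have iB: "inj_on expo B" "vec.independent (expo ` B)" using inj[OF BM] by auto
    \<comment> \<open>By maximality: a generator outside the span could be adjoined to
      \<open>B\<close> without losing independence.\<close>
    have "expo ` S \<subseteq> vec.span (expo ` B)"
    proof (rule ccontr)
      assume "\<not> expo ` S \<subseteq> vec.span (expo ` B)"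
      then obtain s where s: "s \<in> S" "expo s \<notin> vec.span (expo ` B)" by blast
      then have "expo s \<notin> expo ` B" using vec.span_base[of "expo s" "expo ` B"] by blast
      then have sB: "s \<notin> B" "inj_on expo (insert s B)" using iB(1) by auto
      have "vec.independent (expo ` insert s B)" using s(2) iB(2) by (simp add: vec.independent_insertI)
      then have "convexly_independent F (insert s B)" using BM SM s sB by (intro conv) auto
      then have "insert s B = B" using max[of "insert s B"] BM SM s by blast
      then show False using sB by blast
    qed
    moreover have "expo ` B \<subseteq> vec.span (expo ` S)" using BM M by blast
    ultimately have "vec.span (expo ` B) = vec.span (expo ` S)"
      by (intro equalityI vec.span_minimal) simp_all
    then have "vec.dim (expo ` S) = card (expo ` B)" using iB(2) by (intro vec.dim_eq_card)
    moreover have "finite B" using vec.finiteI_independent[OF iB(2)] iB(1) finite_imageD by blast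
    ultimately show ?thesis using card_image[OF iB(1)] by simp
  qed
  obtain E where E: "E \<subseteq> expo ` S" "vec.independent E" "expo ` S \<subseteq> vec.span E"
    using vec.maximal_independent_subset by blast
  obtain B where B: "B \<subseteq> S" "inj_on expo B" "expo ` B = E"
    using E(1) subset_image_inj[of E expo S] by blast
  have BM: "B \<subseteq> ?M" using B SM by blast
  have "A = B" if A: "A \<subseteq> ?M" "convexly_independent F A" "B \<subseteq> A" for A
  proof (rule ccontr)
    assume "A \<noteq> B"
    then obtain f where f: "f \<in> A" "f \<notin> B" using A by blast
    have "expo f \<in> vec.span (expo ` S)" using A f M by blast
    also have "vec.span (expo ` S) \<subseteq> vec.span E" using E(3) by (intro vec.span_minimal) simp_all
    also have "\<dots> \<subseteq> vec.span (expo ` (A - {f}))" using B A f by (intro vec.span_mono) blast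
    finally show False using A f indep[OF A(1)] by blast
  qed
  then have "conv_basis F (kgen F S) B"
    unfolding conv_basis_def using BM conv[OF BM B(2)] E(2) B(3) by blast
  then show ?thesis unfolding has_d_conv_def using card by blast
qed

subsection \<open>Height\<close>

text \<open>Lets the bottom member of a chain count as generated by a finite, possibly empty, set of
  monomials like all the others.\<close>

lemma kgen_empty: "kgen F {\<lambda>_. 1} = kgen F {}"
proof
  have K: "kern (kgen F {})" by (rule kern_kgen) simp
  then have "(\<lambda>_. 1) \<in> kgen F {}" using mem_one mem_iff const_ratfun by blast
  then show "kgen F {\<lambda>_. 1} \<subseteq> kgen F {}" using K by (intro kgen_least) auto
qed (simp add: kgen_mono)

lemma hs_chain_gens:
  assumes "hs_chain F P t" "i \<le> t"
  shows "\<exists>S. finite S \<and> S \<subseteq> L_monomials F \<and> P i = kgen F S"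
proof (cases "P i \<in> HSpec F")
  case True
  from HSpec_gens[OF True] show ?thesis unfolding hs_gens_def by blast
next
  case False
  then have "P i = kgen F {}" using assms by (auto simp: hs_chain_def kgen_empty)
  then show ?thesis by auto
qed

lemma hs_chain_step: "hs_chain F P t \<Longrightarrow> i < t \<Longrightarrow> P i \<subset> P (Suc i)"
  unfolding hs_chain_def by blast

lemma hs_chain_kern:
  assumes "hs_chain F P t" "i \<le> t" shows "kern (P i)"
proof -
  obtain S where S: "S \<subseteq> L_monomials F" "P i = kgen F S" using hs_chain_gens[OF assms] by blast
  then have "S \<subseteq> ratfun F" using L_monomials_ratfun by blast
  then show ?thesis unfolding S(2) by (rule kern_kgen)
qed

lemma hs_chain_mono: "hs_chain F P t \<Longrightarrow> i \<le> j \<Longrightarrow> j \<le> t \<Longrightarrow> P i \<subseteq> P j"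
proof (induction j)
  case (Suc j)
  show ?case
  proof (cases "i = Suc j")
    case False
    then have "P i \<subseteq> P j" using Suc by simp
    also have "P j \<subseteq> P (Suc j)" using hs_chain_step[OF Suc.prems(1), of j] Suc.prems by auto
    finally show ?thesis .
  qed simp
qed simp

text \<open>Defined from the kernel itself, hence independent of generators;
  \<open>rank_kgen\<close> computes it from any generating set of monomials.\<close>

definition hs_rank :: "('n::finite, 'a) fn set \<Rightarrow> nat" where
  "hs_rank K = vec.dim (expo ` (K \<inter> L_monomials F))"

lemma rank_kgen:
  assumes nt: "\<exists>h. \<not> h \<approx> 1" and S: "S \<subseteq> L_monomials F"
  shows "hs_rank (kgen F S) = vec.dim (expo ` S)"
  unfolding hs_rank_def
proof (rule vec.span_eq_dim, rule equalityI)
  have "expo ` (kgen F S \<inter> L_monomials F) \<subseteq> vec.span (expo ` S)"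
    using kgen_span[OF nt S] by blast
  then show "vec.span (expo ` (kgen F S \<inter> L_monomials F)) \<subseteq> vec.span (expo ` S)"
    by (intro vec.span_minimal) simp_all
  show "vec.span (expo ` S) \<subseteq> vec.span (expo ` (kgen F S \<inter> L_monomials F))"
    using S kgen_sub[of S] by (intro vec.span_mono) blast
qed

text \<open>Each step raises the rank by at least one. Counting from the bottom and from the top
  pins the rank of every member once the top rank equals the length.\<close>

lemma hs_chain_rank:
  assumes nt: "\<exists>h. \<not> h \<approx> 1" and P: "hs_chain F P t"
    and nc: "\<And>c. (\<lambda>_. c) \<in> P t \<Longrightarrow> c \<approx> 1" and i: "i \<le> t"
  shows "i \<le> hs_rank (P i)" "hs_rank (P i) + (t - i) \<le> hs_rank (P t)"
proof -
  have step: "hs_rank (P j) < hs_rank (P (Suc j))" if j: "j < t" for j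
  proof -
    obtain S T where S: "S \<subseteq> L_monomials F" "P j = kgen F S" and T: "T \<subseteq> L_monomials F" "P (Suc j) = kgen F T"
      using hs_chain_gens[OF P, of j] hs_chain_gens[OF P, of "Suc j"] j by auto
    have "kgen F S \<subset> kgen F T" using hs_chain_step[OF P j] unfolding S T .
    moreover have "P (Suc j) \<subseteq> P t" using hs_chain_mono[OF P] j by simp
    ultimately have "vec.dim (expo ` S) < vec.dim (expo ` T)"
      using nc T by (intro rank_less[OF nt S(1) T(1)]) auto
    then show ?thesis using S T by (simp add: rank_kgen[OF nt])
  qed
  show "i \<le> hs_rank (P i)" using i
  proof (induction i)
    case (Suc i)
    then show ?case using step[of i] by simp
  qed simp
  show "hs_rank (P i) + (t - i) \<le> hs_rank (P t)" using i
  proof (induction "t - i" arbitrary: i)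
    case (Suc n)
    then have i: "i < t" "n = t - Suc i" by linarith+
    then have "hs_rank (P (Suc i)) + (t - Suc i) \<le> hs_rank (P t)" by (intro Suc.hyps(1)) simp_all
    then show ?case using step[OF i(1)] i by linarith
  qed simp
qed

text \<open>The monomials of a basis are adjoined one at a time. The members above the bottom are
  irreducible by \<open>hs_irreducible\<close>, since they inherit the lack of constants from
  \<open>kgen F S\<close>.\<close>

lemma hs_chain_exists:
  fixes S :: "('n::finite, 'a) fn set"
  assumes nt: "\<exists>h. \<not> h \<approx> 1" and tot: "\<And>a b :: 'a. a \<sqsubseteq> b \<or> b \<sqsubseteq> a"
    and S: "hs_gens S" and nc: "\<And>c. (\<lambda>_. c) \<in> kgen F S \<Longrightarrow> c \<approx> 1"
  shows "\<exists>P. hs_chain F P (vec.dim (expo ` S)) \<and> P (vec.dim (expo ` S)) = kgen F S"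
proof -
  let ?d = "vec.dim (expo ` S)"
  have SL: "S \<subseteq> L_monomials F" and SR: "S \<subseteq> ratfun F" using S hs_gens_ratfun by (auto simp: hs_gens_def)
  obtain E where E: "E \<subseteq> expo ` S" "vec.independent E" "expo ` S \<subseteq> vec.span E" "card E = ?d"
    using vec.basis_exists by blast
  obtain B where B: "B \<subseteq> S" "inj_on expo B" "expo ` B = E"
    using E(1) subset_image_inj[of E expo S] by blast
  have finB: "finite B" using B S finite_subset by (auto simp: hs_gens_def)
  then obtain bs where bs: "set bs = B" "distinct bs" using finite_distinct_list by blast
  have len: "length bs = ?d" using distinct_card[OF bs(2)] bs(1) card_image[OF B(2)] B(3) E(4) by simp
  define P where "P i = kgen F (set (take i bs))" for i
  have sub: "set (take i bs) \<subseteq> S" for i using set_take_subset[of i bs] bs B by blast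
  have PS: "P i \<subseteq> kgen F S" for i unfolding P_def by (rule kgen_mono) (rule sub)
  \<comment> \<open>The basis may omit generators from \<open>S\<close>; \<open>span_absorb\<close>
    recovers them with their coefficients.\<close>
  have Pd: "P ?d = kgen F S"
  proof (rule equalityI[OF PS])
    have "P ?d = kgen F B" using bs len by (simp add: P_def)
    moreover have "S \<subseteq> kgen F B"
    proof
      fix s assume s: "s \<in> S"
      show "s \<in> kgen F B"
      proof (rule span_absorb[OF _ kern_kgen[OF SR] nc kgen_mono[OF B(1)] _ kgen_sub])
        show "kern (kgen F B)" using B SR by (intro kern_kgen) blast
        show "B \<subseteq> L_monomials F" "s \<in> L_monomials F" using B SL s by auto
        show "s \<in> kgen F S" using s kgen_sub by blast
        show "expo s \<in> vec.span (expo ` B)" using E(3) B(3) s by blast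
      qed
    qed
    moreover have "kern (kgen F B)" using B SR by (intro kern_kgen) blast
    ultimately show "kgen F S \<subseteq> P ?d" using kgen_least by simp
  qed
  have "P i \<in> HSpec F" if "i \<le> ?d" "i \<noteq> 0" for i
    unfolding P_def
  proof (rule hs_irreducible[OF nt tot])
    have "length (take i bs) \<noteq> 0" using that len by (simp del: vec.dim_eq_0)
    then have "take i bs \<noteq> []" by force
    then show "hs_gens (set (take i bs))" using sub SL by (auto simp: hs_gens_def)
    show "c \<approx> 1" if "(\<lambda>_. c) \<in> kgen F (set (take i bs))" for c using that nc PS by (auto simp: P_def)
  qed
  moreover have "P 0 = kgen F {\<lambda>_. 1}" by (simp add: P_def kgen_empty)
  moreover have "P i \<subset> P (Suc i)" if i: "i < ?d" for i
  proof
    have take: "take (Suc i) bs = take i bs @ [bs ! i]" using i len by (simp add: take_Suc_conv_app_nth)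
    show "P i \<subseteq> P (Suc i)" unfolding P_def take by (rule kgen_mono) auto
    have "bs ! i \<in> P (Suc i)" unfolding P_def take using kgen_sub[of "set (take i bs @ [bs ! i])"] by auto
    \<comment> \<open>Membership would express \<open>expo (bs ! i)\<close> through other vectors of
      the basis \<open>E\<close>.\<close>
    moreover have "bs ! i \<notin> P i"
    proof
      have bi: "bs ! i \<in> B" using i len bs by auto
      assume "bs ! i \<in> P i"
      then have "expo (bs ! i) \<in> vec.span (expo ` set (take i bs))"
        using sub SL bi B by (intro kgen_span[OF nt]) (auto simp: P_def)
      also have "expo ` set (take i bs) \<subseteq> E - {expo (bs ! i)}"
      proof
        fix w assume "w \<in> expo ` set (take i bs)"
        then obtain m where m: "m \<in> set (take i bs)" "w = expo m" by blast
        then obtain j where j: "j < i" "m = bs ! j" using i len by (auto simp: in_set_conv_nth)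
        then have "m \<noteq> bs ! i" "m \<in> B" using bs i len by (auto simp: nth_eq_iff_index_eq)
        then show "w \<in> E - {expo (bs ! i)}" using B bi m by (auto simp: inj_on_def)
      qed
      then have "vec.span (expo ` set (take i bs)) \<subseteq> vec.span (E - {expo (bs ! i)})" by (rule vec.span_mono)
      finally show False using E(2) bi B(3) unfolding vec.dependent_def by blast
    qed
    ultimately show "P i \<noteq> P (Suc i)" by blast
  qed
  ultimately have "hs_chain F P ?d" unfolding hs_chain_def by auto
  with Pd show ?thesis by blast
qed

lemma hs_hgt_iff:
  fixes S :: "('n::finite, 'a) fn set"
  assumes nt: "\<exists>h. \<not> h \<approx> 1" and tot: "\<And>a b :: 'a. a \<sqsubseteq> b \<or> b \<sqsubseteq> a"
    and S: "hs_gens S" and nc: "\<And>c. (\<lambda>_. c) \<in> kgen F S \<Longrightarrow> c \<approx> 1"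
  shows "has_hgt F (kgen F S) t \<longleftrightarrow> t = vec.dim (expo ` S)"
proof -
  let ?d = "vec.dim (expo ` S)"
  have bound: "t \<le> ?d" if "hs_chain F P t" "P t = kgen F S" for P t
    using hs_chain_rank(1)[OF nt that(1), of t] that(2) nc S rank_kgen[OF nt, of S]
    by (simp add: hs_gens_def)
  obtain P where P: "hs_chain F P ?d" "P ?d = kgen F S"
    using hs_chain_exists[OF assms] by blast
  \<comment> \<open>\<open>has_hgt\<close> excludes only length \<open>t + 1\<close>, so shorter
    lengths must all be realised, lest one of them pass for the height. Dropping the lowest
    \<open>?d - t\<close> members does this; the trivial kernel can remain only at index 0.\<close>
  have "\<exists>Q. hs_chain F Q t \<and> Q t = kgen F S" if t: "t \<le> ?d" for t
  proof (intro exI conjI)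
    let ?Q = "\<lambda>i. P (i + (?d - t))"
    show "hs_chain F ?Q t" unfolding hs_chain_def
    proof (intro conjI allI impI)
      fix i assume "i \<le> t"
      then have "i + (?d - t) \<le> ?d" using t by simp
      then have "?Q i \<in> HSpec F \<or> i + (?d - t) = 0 \<and> ?Q i = kgen F {\<lambda>_. 1}"
        using P(1) unfolding hs_chain_def by blast
      then show "?Q i \<in> HSpec F \<or> i = 0 \<and> ?Q i = kgen F {\<lambda>_. 1}" by auto
    next
      fix i assume "i < t"
      then have "i + (?d - t) < ?d" using t by simp
      then show "?Q i \<subset> ?Q (Suc i)" using P(1) unfolding hs_chain_def by simp
    qed
    show "?Q t = kgen F S" using P(2) t by simp
  qed
  then have "(\<exists>Q. hs_chain F Q t \<and> Q t = kgen F S) \<longleftrightarrow> t \<le> ?d" for t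
    using bound by blast
  then show ?thesis unfolding has_hgt_def by auto
qed

text \<open>Maximal length forces the rank to rise by exactly one. A generator \<open>m\<close> of
  the upper kernel outside the lower one already uses up this increase, so by
  \<open>rank_less\<close> nothing is left above the lower kernel with \<open>m\<close>
  adjoined.\<close>

lemma hs_chain_factor:
  fixes P :: "nat \<Rightarrow> ('n::finite, 'a) fn set"
  assumes nt: "\<exists>h. \<not> h \<approx> 1" and P: "hs_chain F P t"
    and nc: "\<And>c. (\<lambda>_. c) \<in> P t \<Longrightarrow> c \<approx> 1" and max: "hs_rank (P t) = t" and i: "i < t"
  shows "HP_kernel F (mod_equiv F (P i)) (kquot F (P (Suc i)) (P i))"
proof -
  obtain S T where S: "S \<subseteq> L_monomials F" "P i = kgen F S" and T: "T \<subseteq> L_monomials F" "P (Suc i) = kgen F T"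
    using hs_chain_gens[OF P, of i] hs_chain_gens[OF P, of "Suc i"] i by auto
  have rank: "hs_rank (P i) = i" "hs_rank (P (Suc i)) = Suc i"
    using hs_chain_rank[OF nt P nc, of i] hs_chain_rank[OF nt P nc, of "Suc i"] max i by auto
  have k: "kern (P i)" "kern (P (Suc i))" using hs_chain_kern[OF P] i by auto
  have less: "P i \<subset> P (Suc i)" using P i by (rule hs_chain_step)
  have nc': "c \<approx> 1" if "(\<lambda>_. c) \<in> P (Suc i)" for c
    using that nc hs_chain_mono[OF P, of "Suc i" t] i by auto
  have "\<not> T \<subseteq> P i" using less T kgen_least[OF k(1)] by blast
  then obtain m where m: "m \<in> T" "m \<notin> P i" by blast
  have mP: "m \<in> P (Suc i)" using m T kgen_sub by blast
  have span: "expo m \<notin> vec.span (expo ` S)"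
    using span_absorb[OF k(1) k(2) nc' _ S(1) _ _ mP] less S m T kgen_sub by blast
  have "kgen F (insert m S) \<subseteq> P (Suc i)"
    using mP S less kgen_sub[of S] by (intro kgen_least[OF k(2)]) auto
  moreover have "\<not> kgen F (insert m S) \<subset> P (Suc i)"
  proof
    assume "kgen F (insert m S) \<subset> P (Suc i)"
    then have "vec.dim (expo ` insert m S) < vec.dim (expo ` T)"
      using m S T nc' by (intro rank_less[OF nt]) auto
    moreover have "vec.dim (expo ` S) = i" "vec.dim (expo ` T) = Suc i"
      using rank rank_kgen[OF nt S(1)] rank_kgen[OF nt T(1)] unfolding S(2) T(2) by simp_all
    ultimately show False using span by (simp add: vec.dim_insert)
  qed
  ultimately have eq: "P (Suc i) = kgen F (insert m S)" by blast
  have "kgen F (P i \<union> {m}) = kgen F (insert m S)"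
  proof
    have "insert m S \<subseteq> ratfun F" using m S T L_monomials_ratfun by auto
    then have "kern (kgen F (insert m S))" by (rule kern_kgen)
    moreover have "P i \<union> {m} \<subseteq> kgen F (insert m S)"
      using less mP eq by blast
    ultimately show "kgen F (P i \<union> {m}) \<subseteq> kgen F (insert m S)" by (rule kgen_least)
    show "kgen F (insert m S) \<subseteq> kgen F (P i \<union> {m})"
      using S kgen_sub by (intro kgen_mono) auto
  qed
  then have "kquot F (P (Suc i)) (P i) = gen_kernel F (mod_equiv F (P i)) {m}"
    using kquot_kern[OF k(2,1)] less eq gen_kernel_mod[OF k(1)] by auto
  then show ?thesis using m T unfolding HP_kernel_def by blast
qed

subsection \<open>The case of a single ghost element\<close>

text \<open>All functions are \<open>nu\<close>-equal here, and kernels are saturated; chains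
  therefore cannot ascend.\<close>

lemma trivial_kern:
  fixes K :: "('n::finite, 'a) fn set"
  assumes "\<And>a :: 'a. a \<approx> 1" and K: "kern K" shows "K = ratfun F"
proof
  show "ratfun F \<subseteq> K"
  proof
    fix u :: "('n, 'a) fn" assume u: "u \<in> ratfun F"
    have "mem K u" using mem_one[OF K] by (rule mem_cong) (intro allI assms(1)[symmetric])
    then show "u \<in> K" using mem_iff[OF K u] by simp
  qed
qed (rule kern_sub[OF K])

lemma trivial_chain:
  assumes "\<And>a :: 'a. a \<approx> 1" and P: "hs_chain F P t" shows "t = 0"
proof (rule ccontr)
  assume t: "t \<noteq> 0"
  have "P 0 = ratfun F" "P (Suc 0) = ratfun F"
    using t hs_chain_kern[OF P] by (auto intro!: trivial_kern[OF assms(1)])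
  then show False using hs_chain_step[OF P, of 0] t by auto
qed

lemma trivial_hgt:
  assumes "\<And>a :: 'a. a \<approx> 1" and L: "L \<in> HSpec F" shows "has_hgt F L 0"
proof -
  have "hs_chain F (\<lambda>_. L) 0" using L by (simp add: hs_chain_def)
  then show ?thesis using trivial_chain[OF assms(1)] unfolding has_hgt_def by fastforce
qed

text \<open>Even a single monomial depends on the empty set, so the empty set is the only
  independent one.\<close>

lemma trivial_d_conv:
  assumes triv: "\<And>a :: 'a. a \<approx> 1" and L: "kern L" shows "has_d_conv F L 0"
proof -
  have dep: "A = {}" if "convexly_independent F A" "A \<subseteq> L_monomials F" for A
  proof (rule ccontr)
    assume "A \<noteq> {}"
    then obtain f where f: "f \<in> A" by blast
    have "kern (kprod F (kgen F (A - {f})) (kgen F constants))"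
      using that L_monomials_ratfun constants_ratfun by (intro kern_kprod kern_kgen) auto
    then have "kprod F (kgen F (A - {f})) (kgen F constants) = ratfun F" by (rule trivial_kern[OF triv])
    then show False
      using that f L_monomials_ratfun unfolding convexly_independent_def convexly_dependent_def by blast
  qed
  then have "conv_basis F L B \<longleftrightarrow> B = {}" for B
    unfolding conv_basis_def by (auto simp: convexly_independent_def[of F "{}"])
  then show ?thesis by (simp add: has_d_conv_def)
qed

end

theorem theorem12p0p4:
  fixes F :: "'a::{comm_semiring, comm_monoid_mult} nu_struct"
    and L :: "('n::finite, 'a) fn set"
  assumes "nu_semifield F" and "nu_divisible F" and "nu_archimedean F"
    and "L \<in> HSpec F"
    and no_constants: "\<forall>c. (\<lambda>_. c) \<in> L \<longrightarrow> nu_equiv F c 1"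
  shows "(\<exists>d. has_hgt F L d \<and> has_d_conv F L d) \<and>
         (\<forall>P t. hs_chain F P t \<and> P t = L \<and> has_hgt F L t \<longrightarrow>
            (\<forall>i<t. HP_kernel F (mod_equiv F (P i)) (kquot F (P (Suc i)) (P i))))"
proof -
  interpret div_semifield F using assms(1,2) by unfold_locales
  obtain S where S: "hs_gens S" "L = kgen F S" using HSpec_gens[OF assms(4)] by blast
  have nc: "nu F c = nu F 1" if "(\<lambda>_. c) \<in> L" for c
    using no_constants that by (simp add: nu_equiv_def)
  show ?thesis
  proof (cases "\<exists>h. nu F h \<noteq> nu F 1")
    case nt: True
    have tot: "le a b \<or> le b a" for a b using HSpec_total[OF assms(4) nc] by blast
    have hgt: "has_hgt F L t \<longleftrightarrow> t = vec.dim (expo ` S)" for t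
      using hs_hgt_iff[OF nt tot S(1)] nc S(2) by blast
    have SL: "S \<subseteq> L_monomials F" using S(1) by (simp add: hs_gens_def)
    \<comment> \<open>Having length equal to the height means \<open>t = hs_rank (P t)\<close>, the
      maximality that \<open>hs_chain_factor\<close> requires.\<close>
    have "HP_kernel F (mod_equiv F (P i)) (kquot F (P (Suc i)) (P i))"
      if "hs_chain F P t" "P t = L" "has_hgt F L t" "i < t" for P t i
      using that nc hgt S(2) rank_kgen[OF nt SL] by (intro hs_chain_factor[OF nt, of P t]) auto
    then show ?thesis using hgt hs_d_conv[OF nt SL] S(2) by blast
  next
    case False
    \<comment> \<open>Chains have length 0 here, so the claim about factors is vacuous.\<close>
    then have triv: "nu F a = nu F 1" for a by blast
    have "kern L" using S by (simp add: kern_kgen hs_gens_ratfun)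
    then show ?thesis
      using trivial_hgt[OF triv assms(4)] trivial_d_conv[OF triv] trivial_chain[OF triv] by blast
  qed
qed

end
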